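(* Let $H=(x_n)_{n\in\mathbb N}$ be a weakly null sequence in a Banach space with $BS[(x_n)_{n\in\mathbb N}]=\xi$. Then $\xi$ is the unique ordinal satisfying the following. (a) For every $M\in[\mathbb N]$ there exists $L\in[M]$ such that for every $P\in[L]$, $\lim_{n\to\infty}\|\xi^P_n\cdot H\|=0$. (b) For every $\zeta<\xi$ there exists $L_\zeta\in[\mathbb N]$, $L_\zeta=(n_i)_{i\in\mathbb N}$, such that $(x_{n_i})_{i\in\mathbb N}$ is an $\ell^1_\zeta$ spreading model. (c) If $\xi=\zeta+1$, there exist $\varepsilon>0$ and $L\in[\mathbb N]$ such that for all $P\in[L]$ one has $\|\zeta^P_n\cdot H\|>\varepsilon$ for all $n\in\mathbb N$, and $(\zeta^P_n\cdot H)_{n\in\mathbb N}$ is Cesàro summable.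
   Context: Notation: $\mathbb N=\{1,2,\dots\}$. For an infinite $N\subset\mathbb N$, $[N]$ is the set of all infinite subsets of $N$. Writing $M=(m_i)_{i\in\mathbb N}$ means $m_1<m_2<\cdots$ is the increasing enumeration of $M$. For nonempty finite sets, $F<G$ means $\max F<\min G$, and $n\le F$ means $n\le\min F$. Generalized Schreier families $(\mathcal F_\xi)_{\xi<\omega_1}$ of finite subsets of $\mathbb N$: $\mathcal F_0=\{\{n\}:n\in\mathbb N\}\cup\{\emptyset\}$; $\mathcal F_{\zeta+1}$ consists of $\emptyset$ and all sets $\bigcup_{i=1}^nF_i$ with $n\in\mathbb N$, $F_i\in\mathcal F_\zeta$, $n\le F_1<\cdots<F_n$; for a (nonzero) limit ordinal $\xi$ one fixes a strictly increasing sequence $(\xi_n)_{n\in\mathbb N}$ of successor ordinals with $\sup_n\xi_n=\xi$, and $\mathcal F_\xi$ consists of $\emptyset$ and all finite $F$ such that for some $n$, $n\le\min F$ and $F\in\mathcal F_{\xi_n}$. The choices of sequences are fixed throughout. $\ell^1_\xi$ spreading model: for a bounded sequence $(x_n)$ and $M=(m_i)$, $(x_{m_i})_{i\in\mathbb N}$ is an $\ell^1_\xi$ spreading model if there is $\varepsilon>0$ such that $\|\sum_{i\in F}a_ix_{m_i}\|\ge\varepsilon\sum_{i\in F}|a_i|$ for all $F\in\mathcal F_\xi$ and all scalars $(a_i)_{i\in F}$. Banach–Saks index: for a weakly null sequence, $BS[(x_n)_{n\in\mathbb N}]$ is the least ordinal $\xi$ such that no subsequence of $(x_n)$ is an $\ell^1_\xi$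 spreading model (it is known that such a $\xi<\omega_1$ exists). Repeated Averages (RA) Hierarchy: for $M\in[\mathbb N]$ and $\xi<\omega_1$ one defines a sequence $(\xi^M_n)_{n\in\mathbb N}$ of finitely supported elements of the positive part $S^+_{\ell^1}$ of the unit sphere of $\ell^1(\mathbb N)$ (with successive supports whose union is $M$) by induction on $\xi$. Here $(e_n)$ is the unit vector basis. (i) $0^M_n=e_{m_n}$ where $M=(m_n)_{n\in\mathbb N}$. (ii) If $\xi=\zeta+1$: put $k_1=0$, $s_1=\min\operatorname{supp}\zeta^M_1$, and for $n\ge2$ put $k_n=k_{n-1}+s_{n-1}$, $s_n=\min\operatorname{supp}\zeta^M_{k_n+1}$; then $\xi^M_n=\frac1{s_n}\left(\zeta^M_{k_n+1}+\cdots+\zeta^M_{k_n+s_n}\right)$. (iii) If $\xi$ is a limit ordinal and $(\xi_n)$ is the sequence used to define $\mathcal F_\xi$: put $M_1=M$, $n_1=\min M_1$, and inductively $M_{k+1}=M_k\setminus\operatorname{supp}(\xi_{n_k})^{M_k}_1$, $n_{k+1}=\min M_{k+1}$; then $\xi^M_k=(\xi_{n_k})^{M_k}_1$. For $A=(a_n)\in S^+_{\ell^1}$ put $A\cdot H=\sum_na_nx_n$. A sequence $(y_n)$ is Cesàro summable if $\frac1n\sum_{k=1}^ny_k$ converges in norm. *)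

theory Defs
  imports "HOL-Analysis.Analysis"
begin

section \<open>The countable ordinals\<close>

unbundle cardinal_syntax

text \<open>
  The type \<open>omega1\<close> is the well-order of the first uncountable ordinal; its elements are the
  ordinals \<open>\<xi> < \<omega>\<^sub>1\<close>.
\<close>

typedef omega1 = "Field (cardSuc natLeq)"
proof -
  have "infinite (Field (cardSuc natLeq))"
    using cardSuc_finite[OF natLeq_Card_order] by (simp add: Field_natLeq)
  then show ?thesis by (metis ex_in_conv finite.emptyI)
qed

instantiation omega1 :: linorder
begin

definition less_eq_omega1 :: "omega1 \<Rightarrow> omega1 \<Rightarrow> bool"
  where "\<alpha> \<le> \<beta> \<longleftrightarrow> (Rep_omega1 \<alpha>, Rep_omega1 \<beta>) \<in> cardSuc natLeq"

definition less_omega1 :: "omega1 \<Rightarrow> omega1 \<Rightarrow> bool"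
  where "\<alpha> < \<beta> \<longleftrightarrow> \<alpha> \<le> \<beta> \<and> \<alpha> \<noteq> (\<beta> :: omega1)"

lemma cardSuc_natLeq_Card_order: "Card_order (cardSuc natLeq)"
  by (simp add: cardSuc_Card_order natLeq_Card_order)

lemma cardSuc_natLeq_Well_order: "Well_order (cardSuc natLeq)"
  using cardSuc_natLeq_Card_order by (simp add: card_order_on_def)

instance
proof
  have lin: "Linear_order (cardSuc natLeq)"
    using cardSuc_natLeq_Well_order by (simp add: well_order_on_def)
  have refl: "Refl (cardSuc natLeq)" and trans: "trans (cardSuc natLeq)"
    and anti: "antisym (cardSuc natLeq)" and tot: "Total (cardSuc natLeq)"
    using lin by (auto simp: order_on_defs)
  fix x y z :: omega1
  show "x \<le> x"
    using refl Rep_omega1[of x] by (auto simp: less_eq_omega1_def refl_on_def)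
  show "x \<le> y \<Longrightarrow> y \<le> z \<Longrightarrow> x \<le> z"
    using trans unfolding less_eq_omega1_def by (rule transD)
  show "x \<le> y \<Longrightarrow> y \<le> x \<Longrightarrow> x = y"
    using anti by (auto simp: less_eq_omega1_def Rep_omega1_inject dest: antisymD)
  then show "(x < y) = (x \<le> y \<and> \<not> y \<le> x)"
    using \<open>x \<le> x\<close> by (auto simp: less_omega1_def)
  show "x \<le> y \<or> y \<le> x"
    using tot refl Rep_omega1[of x] Rep_omega1[of y]
    by (cases "x = y") (auto simp: less_eq_omega1_def total_on_def refl_on_def Rep_omega1_inject)
qed

end

lemma less_omega1_alt: "\<alpha> < \<beta> \<longleftrightarrow> (Rep_omega1 \<alpha>, Rep_omega1 \<beta>) \<in> cardSuc natLeq - Id"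
  by (auto simp: less_omega1_def less_eq_omega1_def Rep_omega1_inject)

instance omega1 :: wellorder
proof
  fix P :: "omega1 \<Rightarrow> bool" and a
  assume step: "\<And>x. (\<And>y. y < x \<Longrightarrow> P y) \<Longrightarrow> P x"
  have "wf (cardSuc natLeq - Id)"
    using cardSuc_natLeq_Well_order by (simp add: well_order_on_def)
  then have "wf (inv_image (cardSuc natLeq - Id) Rep_omega1)" by (rule wf_inv_image)
  then show "P a"
  proof (induction a rule: wf_induct_rule)
    case (less x)
    show ?case
      by (rule step, rule less) (simp add: less_omega1_alt in_inv_image)
  qed
qed

lemma countable_iff_ordLeq_natLeq: "countable A \<longleftrightarrow> |A| \<le>o natLeq"
proof -
  have "countable A \<longleftrightarrow> |A| \<le>o |UNIV :: nat set|"
    unfolding countable_def card_of_ordLeq[symmetric] by auto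
  then show ?thesis
    using card_of_nat ordLeq_ordIso_trans ordIso_symmetric by blast
qed

text \<open>
  Every proper initial segment is countable and the whole type is not, which determines the
  order type to be \<open>\<omega>\<^sub>1\<close>.
\<close>

lemma countable_lessThan_omega1: "countable {..<\<xi> :: omega1}"
proof -
  let ?r = "cardSuc natLeq"
  have "|underS ?r (Rep_omega1 \<xi>)| <o ?r"
    using cardSuc_natLeq_Card_order Rep_omega1 by (rule card_of_underS)
  then have "|underS ?r (Rep_omega1 \<xi>)| \<le>o natLeq"
    unfolding cardSuc_ordLeq_ordLess[OF natLeq_Card_order card_of_Card_order] .
  then have "countable (underS ?r (Rep_omega1 \<xi>))"
    by (simp add: countable_iff_ordLeq_natLeq)
  moreover have "Rep_omega1 ` {..<\<xi>} \<subseteq> underS ?r (Rep_omega1 \<xi>)"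
    by (auto simp: underS_def less_omega1_alt)
  ultimately have "countable (Rep_omega1 ` {..<\<xi>})" by (rule countable_subset[rotated])
  then show ?thesis
    by (rule countable_image_inj_on) (simp add: inj_on_def Rep_omega1_inject)
qed

lemma uncountable_omega1: "uncountable (UNIV :: omega1 set)"
proof
  assume "countable (UNIV :: omega1 set)"
  then have "countable (range Rep_omega1)" by (rule countable_image)
  then have "countable (Field (cardSuc natLeq))"
    by (simp add: type_definition.Rep_range[OF type_definition_omega1])
  then have "|Field (cardSuc natLeq)| \<le>o natLeq"
    by (simp add: countable_iff_ordLeq_natLeq)
  then have "cardSuc natLeq \<le>o natLeq"
    by (rule ordIso_ordLeq_trans[OF ordIso_symmetric[OF
          card_of_Field_ordIso[OF cardSuc_natLeq_Card_order]]])
  then show False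
    using not_ordLess_ordLeq[OF cardSuc_greater[OF natLeq_Card_order]] by (rule notE[rotated])
qed

instantiation omega1 :: zero
begin
definition zero_omega1 :: omega1 where "0 = (LEAST \<alpha> :: omega1. True)"
instance ..
end

lemma zero_le_omega1 [simp]: "0 \<le> (\<alpha> :: omega1)"
  by (simp add: zero_omega1_def Least_le)

definition osuc :: "omega1 \<Rightarrow> omega1"
  where "osuc \<alpha> = (LEAST \<beta>. \<alpha> < \<beta>)"

definition is_succ :: "omega1 \<Rightarrow> bool"
  where "is_succ \<xi> \<longleftrightarrow> (\<exists>\<zeta>. \<xi> = osuc \<zeta>)"

definition is_limit :: "omega1 \<Rightarrow> bool"
  where "is_limit \<xi> \<longleftrightarrow> \<xi> \<noteq> 0 \<and> \<not> is_succ \<xi>"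

definition opred :: "omega1 \<Rightarrow> omega1"
  where "opred \<xi> = (THE \<zeta>. \<xi> = osuc \<zeta>)"

lemma ex_greater_omega1: "\<exists>\<beta>. \<alpha> < (\<beta> :: omega1)"
proof (rule ccontr)
  assume "\<not> ?thesis"
  then have "(UNIV :: omega1 set) = insert \<alpha> {..<\<alpha>}"
    using linorder_less_linear by auto
  then show False
    using uncountable_omega1 countable_lessThan_omega1[of \<alpha>] by (metis countable_insert)
qed

lemma less_osuc: "\<alpha> < osuc \<alpha>"
  unfolding osuc_def using ex_greater_omega1 by (rule LeastI_ex)

lemma osuc_le_iff: "osuc \<alpha> \<le> \<beta> \<longleftrightarrow> \<alpha> < \<beta>"
  using less_osuc[of \<alpha>] unfolding osuc_def by (meson Least_le order_less_le_trans)

lemma osuc_inject [simp]: "osuc \<alpha> = osuc \<beta> \<longleftrightarrow> \<alpha> = \<beta>"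
  by (metis less_osuc linorder_neqE not_less osuc_le_iff)

lemma opred_osuc [simp]: "opred (osuc \<alpha>) = \<alpha>"
  by (simp add: opred_def)

lemma osuc_neq_zero [simp]: "osuc \<alpha> \<noteq> 0"
  by (metis less_osuc not_less zero_le_omega1)

lemma is_succ_osuc [simp]: "is_succ (osuc \<alpha>)"
  by (auto simp: is_succ_def)

lemma not_is_succ_zero [simp]: "\<not> is_succ 0"
  by (metis is_succ_def osuc_neq_zero)

unbundle no cardinal_syntax

section \<open>Fundamental sequences and transfinite recursion\<close>

text \<open>
  \<open>s \<xi> n\<close> is the \<open>n\<close>-th term \<open>\<xi>\<^sub>n\<close> of the sequence chosen for the limit ordinal \<open>\<xi>\<close>.
  Here, and for all sequences below, \<open>\<nat> = {1, 2, \<dots>}\<close> is \<open>{1..}\<close>, and the value at index \<open>0\<close>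
  is irrelevant. The last two clauses say that \<open>\<xi>\<close> is the supremum of the sequence.
\<close>

definition fundamental_sequences :: "(omega1 \<Rightarrow> nat \<Rightarrow> omega1) \<Rightarrow> bool"
  where "fundamental_sequences s \<longleftrightarrow> (\<forall>\<xi>. is_limit \<xi> \<longrightarrow>
    strict_mono_on {1..} (s \<xi>) \<and>
    (\<forall>n\<ge>1. is_succ (s \<xi> n)) \<and>
    (\<forall>n\<ge>1. s \<xi> n \<le> \<xi>) \<and>
    (\<forall>\<eta>. (\<forall>n\<ge>1. s \<xi> n \<le> \<eta>) \<longrightarrow> \<xi> \<le> \<eta>))"

lemma fundamental_sequences_less:
  assumes "fundamental_sequences s" "is_limit \<xi>" "n \<ge> 1"
  shows "s \<xi> n < \<xi>"
  using assms unfolding fundamental_sequences_def is_limit_def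
  by (metis order_le_imp_less_or_eq)

lemma ex_fundamental_sequences: "\<exists>s. fundamental_sequences s"
proof -
  define Q where "Q \<xi> t \<longleftrightarrow> strict_mono_on {1..} t \<and> (\<forall>n\<ge>1. is_succ (t n)) \<and>
      (\<forall>n\<ge>1. t n \<le> \<xi>) \<and> (\<forall>\<eta>. (\<forall>n\<ge>1. t n \<le> \<eta>) \<longrightarrow> \<xi> \<le> \<eta>)"
    for \<xi> and t :: "nat \<Rightarrow> omega1"
  have "\<exists>t. Q \<xi> t" if lim: "is_limit \<xi>" for \<xi>
  proof -
    have pos: "0 < \<xi>"
      using lim zero_le_omega1[of \<xi>] unfolding is_limit_def by (simp add: order_less_le)
    have closed: "osuc \<alpha> < \<xi>" if "\<alpha> < \<xi>" for \<alpha>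
      using that lim osuc_le_iff[of \<alpha> \<xi>]
      by (metis is_limit_def is_succ_osuc order_less_le)
    define f where "f = from_nat_into {..<\<xi>}"
    have ne: "{..<\<xi>} \<noteq> {}" using pos by blast
    have f: "range f = {..<\<xi>}"
      unfolding f_def using ne countable_lessThan_omega1 by (rule range_from_nat_into)
    define t where "t = rec_nat (osuc 0) (\<lambda>n \<beta>. osuc (max \<beta> (f n)))"
    have t0: "t 0 = osuc 0" and tS: "t (Suc n) = osuc (max (t n) (f n))" for n
      by (simp_all add: t_def)
    have less: "t n < \<xi>" for n
    proof (induction n)
      case 0
      then show ?case using closed[OF pos] by (simp add: t0)
    next
      case (Suc n)
      then show ?case using f closed[of "max (t n) (f n)"] by (auto simp: tS)
    qed
    have "t n < t (Suc n)" for n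
      using less_osuc[of "max (t n) (f n)"] by (auto simp: tS)
    then have "strict_mono t" by (simp add: strict_mono_Suc_iff)
    then have "strict_mono_on {1..} t" by (simp add: strict_mono_def strict_mono_on_def)
    moreover have "is_succ (t n)" for n
      by (cases n) (simp_all add: t0 tS)
    moreover have "\<xi> \<le> \<eta>" if \<eta>: "\<And>n. n \<ge> 1 \<Longrightarrow> t n \<le> \<eta>" for \<eta>
    proof (rule ccontr)
      assume "\<not> \<xi> \<le> \<eta>"
      then obtain n where "\<eta> = f n" using f by (metis imageE lessThan_iff not_le)
      then have "\<eta> < t (Suc n)" using less_osuc[of "max (t n) (f n)"] by (auto simp: tS)
      then show False using \<eta>[of "Suc n"] by simp
    qed
    ultimately have "Q \<xi> t" using less by (simp add: Q_def less_imp_le)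
    then show ?thesis by blast
  qed
  then have "\<forall>\<xi>. \<exists>t. is_limit \<xi> \<longrightarrow> Q \<xi> t" by blast
  then obtain s where "\<forall>\<xi>. is_limit \<xi> \<longrightarrow> Q \<xi> (s \<xi>)" by (rule choice[THEN exE])
  then have "fundamental_sequences s" unfolding Q_def fundamental_sequences_def .
  then show ?thesis by blast
qed

text \<open>
  Recursion with the value \<open>z\<close> at \<open>0\<close>, the step \<open>f\<close> at successors and the step \<open>g\<close>, which receives
  the values along the fundamental sequence, at limits.
\<close>

definition omega1_rec ::
    "(omega1 \<Rightarrow> nat \<Rightarrow> omega1) \<Rightarrow> 'b \<Rightarrow> ('b \<Rightarrow> 'b) \<Rightarrow> ((nat \<Rightarrow> 'b) \<Rightarrow> 'b) \<Rightarrow> omega1 \<Rightarrow> 'b"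
  where "omega1_rec s z f g = wfrec {(\<alpha>, \<beta>). \<alpha> < \<beta>} (\<lambda>r \<xi>.
    if \<xi> = 0 then z
    else if is_succ \<xi> then f (r (opred \<xi>))
    else g (\<lambda>n. r (s \<xi> n)))"

lemma omega1_rec_unfold:
  "omega1_rec s z f g \<xi> =
    (let r = cut (omega1_rec s z f g) {(\<alpha>, \<beta>). \<alpha> < \<beta>} \<xi> in
     if \<xi> = 0 then z
     else if is_succ \<xi> then f (r (opred \<xi>))
     else g (\<lambda>n. r (s \<xi> n)))"
  unfolding Let_def by (rule def_wfrec[OF eq_reflection[OF omega1_rec_def] wf])

lemma omega1_rec_zero: "omega1_rec s z f g 0 = z"
  by (subst omega1_rec_unfold) simp

lemma omega1_rec_osuc: "omega1_rec s z f g (osuc \<zeta>) = f (omega1_rec s z f g \<zeta>)"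
  by (subst omega1_rec_unfold) (simp add: cut_apply less_osuc)

lemma omega1_rec_limit_cut:
  assumes "is_limit \<xi>"
  shows "omega1_rec s z f g \<xi> =
    g (\<lambda>n. if s \<xi> n < \<xi> then omega1_rec s z f g (s \<xi> n) else undefined)"
  using assms unfolding is_limit_def by (subst omega1_rec_unfold) (simp add: cut_def)

section \<open>Generalized Schreier families\<close>

definition schreier_succ :: "nat set set \<Rightarrow> nat set set"
  where "schreier_succ \<F> = {{}} \<union> {\<Union>i\<in>{1..n}. F i | n F.
    n \<ge> 1 \<and> (\<forall>i\<in>{1..n}. F i \<in> \<F> \<and> F i \<noteq> {}) \<and>
    n \<le> Min (F 1) \<and> (\<forall>i\<in>{1..<n}. Max (F i) < Min (F (i + 1)))}"

definition schreier_limit :: "(nat \<Rightarrow> nat set set) \<Rightarrow> nat set set"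
  where "schreier_limit \<F> = {{}} \<union> {F. finite F \<and> F \<noteq> {} \<and> (\<exists>n\<ge>1. n \<le> Min F \<and> F \<in> \<F> n)}"

definition schreier :: "(omega1 \<Rightarrow> nat \<Rightarrow> omega1) \<Rightarrow> omega1 \<Rightarrow> nat set set"
  where "schreier s = omega1_rec s ({{n} | n. n \<ge> 1} \<union> {{}}) schreier_succ schreier_limit"

lemma schreier_zero: "schreier s 0 = {{n} | n. n \<ge> 1} \<union> {{}}"
  by (simp add: schreier_def omega1_rec_zero)

lemma schreier_osuc: "schreier s (osuc \<zeta>) = schreier_succ (schreier s \<zeta>)"
  by (simp add: schreier_def omega1_rec_osuc)

lemma schreier_is_limit:
  assumes "fundamental_sequences s" "is_limit \<xi>"
  shows "schreier s \<xi> = schreier_limit (\<lambda>n. schreier s (s \<xi> n))"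
  using fundamental_sequences_less[OF assms]
  by (auto simp: schreier_def omega1_rec_limit_cut[OF assms(2)] schreier_limit_def)

section \<open>The repeated averages hierarchy\<close>

definition infsets :: "nat set \<Rightarrow> nat set set"
  where "infsets N = {M. M \<subseteq> N \<and> infinite M}"

text \<open>The increasing enumeration \<open>m\<^sub>1 < m\<^sub>2 < \<dots>\<close> of an infinite set, indexed from \<open>1\<close>.\<close>

definition enum1 :: "nat set \<Rightarrow> nat \<Rightarrow> nat"
  where "enum1 M i = enumerate M (i - 1)"

definition supp :: "(nat \<Rightarrow> real) \<Rightarrow> nat set"
  where "supp a = {j. a j \<noteq> 0}"

text \<open>
  The hierarchy assigns to a set \<open>M\<close> and an index \<open>n \<ge> 1\<close> a finitely supported element of
  \<open>\<ell>\<^sup>1\<close>, represented by its coefficients. For the successor step, \<open>a\<close> is the sequence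
  \<open>(\<zeta>\<^sup>M\<^sub>n)\<close>, \<open>block_start a n\<close> is \<open>k\<^sub>n\<close> and \<open>block_length a n\<close> is \<open>s\<^sub>n\<close>.
\<close>

fun block_start :: "(nat \<Rightarrow> nat \<Rightarrow> real) \<Rightarrow> nat \<Rightarrow> nat"
  where
    "block_start a 0 = 0"
  | "block_start a (Suc 0) = 0"
  | "block_start a (Suc (Suc n)) =
       block_start a (Suc n) + Min (supp (a (block_start a (Suc n) + 1)))"

definition block_length :: "(nat \<Rightarrow> nat \<Rightarrow> real) \<Rightarrow> nat \<Rightarrow> nat"
  where "block_length a n = Min (supp (a (block_start a n + 1)))"

definition ra_succ :: "(nat set \<Rightarrow> nat \<Rightarrow> nat \<Rightarrow> real) \<Rightarrow> nat set \<Rightarrow> nat \<Rightarrow> nat \<Rightarrow> real"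
  where "ra_succ A M n = (\<lambda>j. 1 / real (block_length (A M) n) *
    (\<Sum>i = 1..block_length (A M) n. A M (block_start (A M) n + i) j))"

text \<open>
  For the limit step, \<open>A n\<close> is the hierarchy at the ordinal \<open>\<xi>\<^sub>n\<close>, \<open>ra_rest A M k\<close> is the set \<open>M\<^sub>k\<close>,
  and \<open>Inf\<close> is the minimum of a nonempty set of natural numbers.
\<close>

fun ra_rest :: "(nat \<Rightarrow> nat set \<Rightarrow> nat \<Rightarrow> nat \<Rightarrow> real) \<Rightarrow> nat set \<Rightarrow> nat \<Rightarrow> nat set"
  where
    "ra_rest A M 0 = M"
  | "ra_rest A M (Suc 0) = M"
  | "ra_rest A M (Suc (Suc k)) =
       ra_rest A M (Suc k) - supp (A (Inf (ra_rest A M (Suc k))) (ra_rest A M (Suc k)) 1)"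

definition ra_limit ::
    "(nat \<Rightarrow> nat set \<Rightarrow> nat \<Rightarrow> nat \<Rightarrow> real) \<Rightarrow> nat set \<Rightarrow> nat \<Rightarrow> nat \<Rightarrow> real"
  where "ra_limit A M k = A (Inf (ra_rest A M k)) (ra_rest A M k) 1"

definition RA :: "(omega1 \<Rightarrow> nat \<Rightarrow> omega1) \<Rightarrow> omega1 \<Rightarrow> nat set \<Rightarrow> nat \<Rightarrow> nat \<Rightarrow> real"
  where "RA s = omega1_rec s (\<lambda>M n j. if j = enum1 M n then 1 else 0) ra_succ ra_limit"

lemma RA_zero: "RA s 0 M n = (\<lambda>j. if j = enum1 M n then 1 else 0)"
  by (simp add: RA_def omega1_rec_zero)

lemma RA_osuc: "RA s (osuc \<zeta>) = ra_succ (RA s \<zeta>)"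
  by (simp add: RA_def omega1_rec_osuc)

text \<open>
  For infinite \<open>M \<subseteq> \<nat>\<close> the sequence \<open>(\<xi>\<^sup>M\<^sub>n)\<close> consists of finitely supported nonnegative elements of
  norm one with successive supports whose union is \<open>M\<close>.
\<close>

definition ra_seq :: "nat set \<Rightarrow> (nat \<Rightarrow> nat \<Rightarrow> real) \<Rightarrow> bool"
  where "ra_seq M a \<longleftrightarrow>
    (\<forall>n\<ge>1. finite (supp (a n)) \<and> (\<forall>j. 0 \<le> a n j) \<and> a n sums 1) \<and>
    (\<forall>m n. 1 \<le> m \<and> m < n \<longrightarrow> (\<forall>p\<in>supp (a m). \<forall>q\<in>supp (a n). p < q)) \<and>
    (\<Union>n\<in>{1..}. supp (a n)) = M"

lemma ra_seq_nonempty: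
  assumes "ra_seq M a" "n \<ge> 1"
  shows "supp (a n) \<noteq> {}"
proof
  assume "supp (a n) = {}"
  then have "a n = (\<lambda>_. 0)" by (auto simp: supp_def fun_eq_iff)
  moreover have "a n sums 1" using assms by (simp add: ra_seq_def)
  ultimately show False using sums_unique2[OF sums_zero] by fastforce
qed

lemma ra_seq_zero:
  assumes "infinite M"
  shows "ra_seq M (\<lambda>n j. if j = enum1 M n then 1 else 0)"
proof -
  have supp: "supp (\<lambda>j. if j = enum1 M n then 1 else 0) = {enum1 M n}" for n
    by (auto simp: supp_def)
  have "(\<lambda>j. if j = enum1 M n then 1 else 0 :: real) sums 1" for n
    using sums_If_finite_set[of "{enum1 M n}" "\<lambda>_. 1 :: real"] by simp
  moreover have "enum1 M m < enum1 M n" if "1 \<le> m" "m < n" for m n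
    using that assms by (simp add: enum1_def)
  moreover have "(\<Union>n\<in>{1..}. {enum1 M n}) = M"
  proof safe
    fix n show "enum1 M n \<in> M" using assms by (simp add: enum1_def enumerate_in_set)
  next
    fix p assume "p \<in> M"
    then obtain n where "enumerate M n = p" using assms enumerate_Ex by blast
    then have "p = enum1 M (Suc n)" by (simp add: enum1_def)
    then show "p \<in> (\<Union>n\<in>{1..}. {enum1 M n})" by (auto intro!: bexI[of _ "Suc n"])
  qed
  ultimately show ?thesis by (simp add: ra_seq_def supp)
qed

lemma block_start_Suc: "n \<ge> 1 \<Longrightarrow> block_start a (Suc n) = block_start a n + block_length a n"
  by (cases n) (simp_all add: block_length_def)

lemma ra_seq_succ:
  assumes a: "ra_seq M (A M)" and M: "M \<subseteq> {1..}"
  shows "ra_seq M (ra_succ A M)"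
proof -
  let ?k = "block_start (A M)" and ?s = "block_length (A M)"
  let ?B = "\<lambda>n. {?k n + 1..?k n + ?s n}"
  have fin: "finite (supp (A M n))" and nn: "0 \<le> A M n j" and sums: "A M n sums 1"
    if "n \<ge> 1" for n j using a that by (auto simp: ra_seq_def)
  have sub: "supp (A M n) \<subseteq> M" if "n \<ge> 1" for n using a that by (auto simp: ra_seq_def)
  have s: "?s n \<ge> 1" for n
  proof -
    have "?s n \<in> supp (A M (?k n + 1))"
      unfolding block_length_def using fin ra_seq_nonempty[OF a] by (intro Min_in) auto
    then show ?thesis using sub[of "?k n + 1"] M by auto
  qed
  have kS: "?k (Suc n) = ?k n + ?s n" if "n \<ge> 1" for n
    using that by (rule block_start_Suc)
  have k_mono: "?k m + ?s m \<le> ?k n" if "1 \<le> m" "m < n" for m n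
    using \<open>m < n\<close>
  proof (induction n)
    case (Suc n)
    then show ?case using kS[of m] kS[of n] \<open>1 \<le> m\<close> by (cases "m = n") auto
  qed simp
  have supp: "supp (ra_succ A M n) = (\<Union>i\<in>?B n. supp (A M i))" for n
  proof -
    have "ra_succ A M n j = 0 \<longleftrightarrow> (\<forall>i\<in>{1..?s n}. A M (?k n + i) j = 0)" for j
    proof -
      have "(\<Sum>i = 1..?s n. A M (?k n + i) j) = 0 \<longleftrightarrow> (\<forall>i\<in>{1..?s n}. A M (?k n + i) j = 0)"
        by (rule sum_nonneg_eq_0_iff) (auto intro: nn)
      then show ?thesis using s[of n] by (simp add: ra_succ_def)
    qed
    then have "supp (ra_succ A M n) = (\<Union>i\<in>{1..?s n}. supp (A M (?k n + i)))"
      by (auto simp: supp_def)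
    also have "\<dots> = (\<Union>i\<in>(+) (?k n) ` {1..?s n}. supp (A M i))" by (simp only: image_image)
    finally show ?thesis by (simp only: image_add_atLeastAtMost add.commute[of "?k n"])
  qed
  have "finite (supp (ra_succ A M n))" for n
    unfolding supp by (auto intro!: fin)
  moreover have "0 \<le> ra_succ A M n j" for n j
    unfolding ra_succ_def by (intro mult_nonneg_nonneg sum_nonneg nn) auto
  moreover have "ra_succ A M n sums 1" for n
  proof -
    have "(\<lambda>j. 1 / real (?s n) * (\<Sum>i = 1..?s n. A M (?k n + i) j)) sums
        (1 / real (?s n) * (\<Sum>i = 1..?s n. 1))"
      by (rule sums_mult, rule sums_sum, rule sums) simp
    then show ?thesis using s[of n] by (simp add: ra_succ_def)
  qed
  moreover have "p < q" if mn: "1 \<le> m" "m < n"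
    and p: "p \<in> supp (ra_succ A M m)" and q: "q \<in> supp (ra_succ A M n)" for m n p q
  proof -
    obtain i where i: "i \<in> ?B m" "p \<in> supp (A M i)" using p supp by blast
    obtain l where l: "l \<in> ?B n" "q \<in> supp (A M l)" using q supp by blast
    have "1 \<le> i" "i < l" using i(1) l(1) k_mono[OF mn] by auto
    then show ?thesis using a i(2) l(2) unfolding ra_seq_def by blast
  qed
  moreover have "(\<Union>n\<in>{1..}. supp (ra_succ A M n)) = M"
  proof -
    have "\<exists>n\<ge>1. i \<in> ?B n" if "i \<ge> 1" for i
      using that
    proof (induction i rule: dec_induct)
      case base
      show ?case using s[of 1] by (intro exI[of _ 1]) simp
    next
      case (step i)
      then obtain n where n: "n \<ge> 1" "i \<in> ?B n" by blast
      show ?case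
      proof (cases "i = ?k n + ?s n")
        case True
        then show ?thesis using kS[OF n(1)] s[of "Suc n"] by (intro exI[of _ "Suc n"]) simp
      next
        case False
        then show ?thesis using n by (intro exI[of _ n]) auto
      qed
    qed
    then have "(\<Union>n\<in>{1..}. ?B n) = {1..}" by (intro equalityI subsetI) force+
    moreover have "(\<Union>n\<in>{1..}. supp (ra_succ A M n)) = (\<Union>i\<in>(\<Union>n\<in>{1..}. ?B n). supp (A M i))"
      unfolding supp by (rule UN_UN_flatten[symmetric])
    ultimately show ?thesis using a by (simp only: ra_seq_def)
  qed
  ultimately show ?thesis unfolding ra_seq_def by blast
qed

lemma Inf_ge_1: "N \<in> infsets {1..} \<Longrightarrow> Inf N \<ge> 1"
  using Inf_nat_def1[of N] by (auto simp: infsets_def)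

lemma infsets_mono: "N \<in> infsets M \<Longrightarrow> M \<in> infsets K \<Longrightarrow> N \<in> infsets K"
  by (auto simp: infsets_def)

lemma ra_rest_Suc:
  "k \<ge> 1 \<Longrightarrow> ra_rest A M (Suc k) = ra_rest A M k - supp (ra_limit A M k)"
  by (cases k) (simp_all add: ra_limit_def)

lemma ra_rest_infsets:
  assumes A: "\<And>n N. n \<ge> 1 \<Longrightarrow> N \<in> infsets {1..} \<Longrightarrow> ra_seq N (A n N)"
    and M: "M \<in> infsets {1..}"
  shows "ra_rest A M k \<in> infsets M"
proof (induction k)
  case 0
  then show ?case using M by (simp add: infsets_def)
next
  case (Suc k)
  show ?case
  proof (cases "k = 0")
    case True
    then show ?thesis using M by (simp add: infsets_def)
  next
    case False
    let ?N = "ra_rest A M k"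
    have N: "?N \<in> infsets {1..}" using Suc M by (rule infsets_mono)
    have "finite (supp (ra_limit A M k))"
      using A[OF Inf_ge_1[OF N] N] by (simp add: ra_seq_def ra_limit_def)
    then show ?thesis using Suc False by (auto simp: ra_rest_Suc infsets_def)
  qed
qed

lemma ra_seq_limit:
  assumes A: "\<And>n N. n \<ge> 1 \<Longrightarrow> N \<in> infsets {1..} \<Longrightarrow> ra_seq N (A n N)"
    and M: "M \<in> infsets {1..}"
  shows "ra_seq M (ra_limit A M)"
proof -
  let ?R = "ra_rest A M" and ?y = "ra_limit A M"
  have R: "?R k \<in> infsets M" for k using A M by (rule ra_rest_infsets)
  have R1: "?R k \<in> infsets {1..}" for k using R M by (rule infsets_mono)
  have seq: "ra_seq (?R k) (A (Inf (?R k)) (?R k))" for k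
    using A Inf_ge_1 R1 by blast
  have fin: "finite (supp (?y k))" and nn: "0 \<le> ?y k j" and sums: "?y k sums 1" for k j
    using seq[of k] by (auto simp: ra_seq_def ra_limit_def)
  have sub: "supp (?y k) \<subseteq> ?R k" for k
    using seq[of k] by (auto simp: ra_seq_def ra_limit_def)
  have less: "p < q" if "k \<ge> 1" "p \<in> supp (?y k)" "q \<in> ?R (Suc k)" for k p q
  proof -
    let ?a = "A (Inf (?R k)) (?R k)"
    have "q \<in> ?R k" "q \<notin> supp (?a 1)"
      using that by (auto simp: ra_rest_Suc ra_limit_def)
    then obtain n where n: "n \<ge> 1" "q \<in> supp (?a n)"
      using seq[of k] unfolding ra_seq_def by blast
    then have "1 < n" using \<open>q \<notin> supp (?a 1)\<close> by (cases "n = 1") auto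
    then show ?thesis using seq[of k] n that(2) unfolding ra_seq_def ra_limit_def by blast
  qed
  have dec: "?R n \<subseteq> ?R m" if "1 \<le> m" "m \<le> n" for m n
    using that(2)
  proof (induction n rule: dec_induct)
    case (step n)
    then show ?case using that(1) by (auto simp: ra_rest_Suc)
  qed simp
  have "p < q" if "1 \<le> m" "m < n" "p \<in> supp (?y m)" "q \<in> supp (?y n)" for m n p q
    using that less[of m p q] sub[of n] dec[of "Suc m" n] by auto
  moreover have "(\<Union>n\<in>{1..}. supp (?y n)) = M"
  proof (intro equalityI subsetI)
    fix p assume "p \<in> (\<Union>n\<in>{1..}. supp (?y n))"
    then show "p \<in> M" using sub R by (fastforce simp: infsets_def)
  next
    fix p assume p: "p \<in> M"
    show "p \<in> (\<Union>n\<in>{1..}. supp (?y n))"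
    proof (rule ccontr)
      assume *: "p \<notin> (\<Union>n\<in>{1..}. supp (?y n))"
      have pR: "p \<in> ?R (Suc k)" for k
        using p * by (induction k) (auto simp: ra_rest_Suc simp del: ra_rest.simps(3))
      have "\<forall>q\<in>?R (Suc k). k \<le> q" for k
      proof (induction k)
        case (Suc k)
        have "supp (?y (Suc k)) \<noteq> {}"
          using ra_seq_nonempty[OF seq, of 1] by (simp add: ra_limit_def)
        then obtain r where r: "r \<in> supp (?y (Suc k))" by blast
        then have "k \<le> r" using Suc sub by blast
        then show ?case using less[OF _ r] by fastforce
      qed simp
      from this[of "Suc p"] pR[of "Suc p"] show False by fastforce
    qed
  qed
  ultimately show ?thesis using fin nn sums unfolding ra_seq_def by blast
qed

lemma ra_limit_cong:
  assumes A: "\<And>n N. n \<ge> 1 \<Longrightarrow> N \<in> infsets {1..} \<Longrightarrow> ra_seq N (A n N)"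
    and M: "M \<in> infsets {1..}"
    and AB: "\<And>n. n \<ge> 1 \<Longrightarrow> B n = A n"
  shows "ra_limit B M = ra_limit A M"
proof -
  have Inf: "Inf (ra_rest A M k) \<ge> 1" for k
    using infsets_mono[OF ra_rest_infsets[OF A M] M] by (rule Inf_ge_1)
  have "ra_rest B M k = ra_rest A M k" for k
  proof (induction k)
    case (Suc k)
    then show ?case using AB[OF Inf[of k]] by (cases k) simp_all
  qed simp
  then show ?thesis using AB[OF Inf] by (auto simp: ra_limit_def fun_eq_iff)
qed

lemma ra_seq_RA:
  assumes s: "fundamental_sequences s"
  shows "M \<in> infsets {1..} \<Longrightarrow> ra_seq M (RA s \<xi> M)"
proof (induction \<xi> arbitrary: M rule: less_induct)
  case (less \<xi>)
  consider "\<xi> = 0" | \<zeta> where "\<xi> = osuc \<zeta>" | "is_limit \<xi>"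
    by (auto simp: is_limit_def is_succ_def)
  then show ?case
  proof cases
    case 1
    have "RA s \<xi> M = (\<lambda>n j. if j = enum1 M n then 1 else 0)"
      by (simp add: 1 RA_def omega1_rec_zero)
    then show ?thesis using less.prems ra_seq_zero[of M] by (simp add: infsets_def)
  next
    case 2
    then show ?thesis
      using less.IH[OF _ less.prems, of \<zeta>] less.prems less_osuc[of \<zeta>]
      by (simp add: RA_osuc ra_seq_succ infsets_def)
  next
    case 3
    then show ?thesis
      using less.prems less.IH fundamental_sequences_less[OF s 3]
      by (auto simp: RA_def omega1_rec_limit_cut intro!: ra_seq_limit)
  qed
qed

lemma RA_is_limit:
  assumes s: "fundamental_sequences s" and "is_limit \<xi>" and M: "M \<in> infsets {1..}"
  shows "RA s \<xi> M = ra_limit (\<lambda>n. RA s (s \<xi> n)) M"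
proof -
  have "RA s \<xi> M = ra_limit (\<lambda>n. if s \<xi> n < \<xi> then RA s (s \<xi> n) else undefined) M"
    using assms(2) unfolding RA_def by (simp add: omega1_rec_limit_cut cong: if_cong)
  also have "\<dots> = ra_limit (\<lambda>n. RA s (s \<xi> n)) M"
    using ra_seq_RA[OF s] M fundamental_sequences_less[OF assms(1,2)]
    by (intro ra_limit_cong) auto
  finally show ?thesis .
qed

section \<open>Weakly null sequences and spreading models\<close>

definition weakly_null :: "(nat \<Rightarrow> 'a::real_normed_vector) \<Rightarrow> bool"
  where "weakly_null x \<longleftrightarrow> (\<forall>f :: 'a \<Rightarrow> real. bounded_linear f \<longrightarrow> (\<lambda>n. f (x n)) \<longlonglongrightarrow> 0)"

text \<open>
  This is used for subsequences \<open>y\<close> of weakly null sequences only, which are bounded.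
\<close>

definition l1_spreading_model ::
    "(omega1 \<Rightarrow> nat \<Rightarrow> omega1) \<Rightarrow> omega1 \<Rightarrow> (nat \<Rightarrow> 'a::real_normed_vector) \<Rightarrow> bool"
  where "l1_spreading_model s \<xi> y \<longleftrightarrow> (\<exists>\<epsilon>>0. \<forall>F\<in>schreier s \<xi>. \<forall>a :: nat \<Rightarrow> real.
    norm (\<Sum>i\<in>F. a i *\<^sub>R y i) \<ge> \<epsilon> * (\<Sum>i\<in>F. \<bar>a i\<bar>))"

text \<open>
  The Banach-Saks index is a relation and not a function of the sequence: that some countable
  ordinal has the property \<open>no_l1_subsequence\<close> is a theorem about weakly null sequences.
\<close>

definition no_l1_subsequence ::
    "(omega1 \<Rightarrow> nat \<Rightarrow> omega1) \<Rightarrow> (nat \<Rightarrow> 'a::real_normed_vector) \<Rightarrow> omega1 \<Rightarrow> bool"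
  where "no_l1_subsequence s x \<xi> \<longleftrightarrow>
    (\<forall>M\<in>infsets {1..}. \<not> l1_spreading_model s \<xi> (\<lambda>i. x (enum1 M i)))"

definition has_BS_index ::
    "(omega1 \<Rightarrow> nat \<Rightarrow> omega1) \<Rightarrow> (nat \<Rightarrow> 'a::real_normed_vector) \<Rightarrow> omega1 \<Rightarrow> bool"
  where "has_BS_index s x \<xi> \<longleftrightarrow>
    no_l1_subsequence s x \<xi> \<and> (\<forall>\<eta>. no_l1_subsequence s x \<eta> \<longrightarrow> \<xi> \<le> \<eta>)"

text \<open>The vector \<open>A \<cdot> H = \<Sum>\<^sub>n a\<^sub>n x\<^sub>n\<close>; the coefficients used below vanish at index \<open>0\<close>.\<close>

definition dot :: "(nat \<Rightarrow> real) \<Rightarrow> (nat \<Rightarrow> 'a::real_normed_vector) \<Rightarrow> 'a"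
  where "dot a x = (\<Sum>n. a n *\<^sub>R x n)"

definition cesaro_summable :: "(nat \<Rightarrow> 'a::real_normed_vector) \<Rightarrow> bool"
  where "cesaro_summable y \<longleftrightarrow> convergent (\<lambda>n. (1 / real n) *\<^sub>R (\<Sum>k = 1..n. y k))"

end

theory Submission
  imports Defs
begin

text \<open>
  Write \<open>u\<^sub>\<xi>(P)\<close> for the first average \<open>\<xi>\<^sup>P\<^sub>1\<close>; every \<open>\<xi>\<^sup>P\<^sub>n\<close> is the first average of a tail of \<open>P\<close>, and
  \<open>u\<^sub>\<xi>(P)\<close> depends on a finite initial segment of \<open>P\<close> only. Hence the open Ramsey theorem applies to
  the condition \<open>\<parallel>u\<^sub>\<xi>(P) \<cdot> H\<parallel> > \<epsilon>\<close>.

  If it holds for all \<open>P \<in> [M]\<close>, norming functionals show that the hereditary family of finite sets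
  on which some functional of norm at most one is at least \<open>\<epsilon> / 2\<close> carries a fixed proportion of
  every \<open>u\<^sub>\<xi>(P)\<close>. For \<open>\<zeta> < \<xi>\<close> unions of boundedly many members of \<open>\<F>\<^sub>\<zeta>\<close> have arbitrarily small mass under
  suitable \<open>u\<^sub>\<xi>(P)\<close>, so by the dichotomy for pairs of hereditary families the first family contains all
  such unions, and after diagonalization a copy of \<open>\<F>\<^sub>\<xi>\<close>. A subsequence on which functionals can be
  made small off a given set without being lowered on that set (weak nullity and Ramsey again) is
  then an \<open>\<ell>\<^sup>1\<^sub>\<xi>\<close> spreading model. So the absence of such subsequences gives (a), uniformly in \<open>P\<close>.

  Conversely an \<open>\<ell>\<^sup>1\<^sub>\<zeta>\<close> spreading model along \<open>M\<close> bounds \<open>\<parallel>u\<^sub>\<zeta>(P) \<cdot> H\<parallel>\<close> from below, because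
  up to small mass the support of \<open>u\<^sub>\<zeta>(P)\<close> is the image of a member of \<open>\<F>\<^sub>\<zeta>\<close> when \<open>P \<subseteq> M\<close> is sparse.
  This gives the lower bound in (c) and uniqueness. For Cesaro summability, a block of \<open>l - 1\<close>
  consecutive \<open>\<zeta>\<close>-averages, preceded by one fixed \<open>\<zeta>\<close>-average that starts at \<open>l\<close>, is \<open>l\<close> times
  a single \<open>(\<zeta> + 1)\<close>-average, which is uniformly small.
\<close>

section \<open>Diagonal sets and the open Ramsey theorem\<close>

text \<open>At a limit the index of the average depends on the minimum of \<open>P\<close>, so no
  single infinite set serves all \<open>P\<close> at once. Inductive estimates are therefore proved
  for sets \<open>P\<close> with a prescribed minimum \<open>n\<close>, with only
  \<open>P - {Inf P}\<close> inside a set \<open>L\<close> that may depend on \<open>n\<close>; the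
  sets for different \<open>n\<close> are then merged by a diagonal argument. The price is that the
  first of the \<open>n\<close> averages in a block is uncontrolled, which costs
  \<open>1 / n\<close>.

  Smallness on lower families does not follow by induction on its own: when \<xi> is the successor
  of \<zeta>, a member of \<open>schreier s \<zeta>\<close> may carry nearly all the mass of a
  single \<zeta>-average. What saves the step is that its masses over all consecutive
  \<zeta>-averages sum to at most 2 and are then divided by \<open>Inf P\<close>. Hence the joint
  induction on \<open>lower_small\<close> and \<open>total_bounded\<close>.

  Functionals enter through one-sided inequalities \<open>t \<le> g v\<close>. Such constraints form
  a convex cone, and norming functionals as well as cluster points of sequences of functionals come
  from one extension theorem for cones.\<close>

lemma infsets_refl: "infinite M \<Longrightarrow> M \<in> infsets M"
  by (simp add: infsets_def)

lemma infsets_above: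
  assumes "infinite L" "finite (A :: nat set)"
  shows "{l\<in>L. \<forall>a\<in>A. a < l} \<in> infsets L"
proof -
  have "L \<subseteq> {l\<in>L. \<forall>a\<in>A. a < l} \<union> (\<Union>a\<in>A. {..a})" by (auto simp: not_less)
  then have "infinite {l\<in>L. \<forall>a\<in>A. a < l}"
    using assms by (meson finite_UN finite_Un finite_atMost finite_subset)
  then show ?thesis by (auto simp: infsets_def)
qed

lemma infsets_greater: "infinite L \<Longrightarrow> {l\<in>L. (n::nat) < l} \<in> infsets L"
  using infsets_above[of L "{n}"] by simp

lemma Inf_mem: "infinite (P :: nat set) \<Longrightarrow> Inf P \<in> P"
  by (intro Inf_nat_def1) auto

lemma Inf_le: "p \<in> P \<Longrightarrow> Inf P \<le> (p::nat)"
  by (simp add: cInf_lower)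

text \<open>Shrink once for each condition; passing to infinite subsets preserves the conditions
  already met.\<close>

lemma dense_finite:
  assumes her: "\<And>i L L'. i \<in> I \<Longrightarrow> \<Phi> i L \<Longrightarrow> L' \<in> infsets L \<Longrightarrow> \<Phi> i L'"
    and dense: "\<And>i N. i \<in> I \<Longrightarrow> N \<in> infsets M \<Longrightarrow> \<exists>L\<in>infsets N. \<Phi> i L"
    and "finite I" and N: "N \<in> infsets M"
  shows "\<exists>L\<in>infsets N. \<forall>i\<in>I. \<Phi> i L"
  using \<open>finite I\<close> her dense
proof (induction I)
  case empty
  then show ?case using N by (auto intro!: bexI[of _ N] infsets_refl simp: infsets_def)
next
  case (insert i I)
  obtain L where L: "L \<in> infsets N" "\<forall>i\<in>I. \<Phi> i L"
    using insert.IH insert.prems by (metis insert_iff)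
  obtain L' where L': "L' \<in> infsets L" "\<Phi> i L'"
    using insert.prems(2)[of i L] L N infsets_mono by blast
  show ?case
  proof (intro bexI[of _ L'] ballI)
    fix j assume "j \<in> insert i I"
    then show "\<Phi> j L'" using L(2) L' insert.prems(1)[of j L L'] by auto
  qed (use L L' infsets_mono in blast)
qed

text \<open>Fusion: in a decreasing sequence of sets, the next set meets \<open>\<Phi> A\<close> for
  every \<open>A\<close> bounded by the minimum of the current one, and the minima are collected. A
  finite \<open>A\<close> in the result has one of them as its maximum, and the later minima lie in
  the next set. All subsets of the interval up to the minimum are handled, so the chosen points need
  not be recorded.\<close>

lemma diagonal:
  fixes \<Phi> :: "nat set \<Rightarrow> nat set \<Rightarrow> bool"
  assumes her: "\<And>A L L'. \<Phi> A L \<Longrightarrow> L' \<in> infsets L \<Longrightarrow> \<Phi> A L'"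
    and dense: "\<And>A N. finite A \<Longrightarrow> N \<in> infsets M \<Longrightarrow> \<exists>L\<in>infsets N. \<Phi> A L"
    and M: "infinite M"
  shows "\<exists>L\<in>infsets M. \<forall>A. finite A \<longrightarrow> A \<subseteq> L \<longrightarrow> \<Phi> A {l\<in>L. \<forall>a\<in>A. a < l}"
proof -
  have "\<exists>N'. N' \<in> infsets {n\<in>N. Inf N < n} \<and> (\<forall>A\<in>Pow {..Inf N}. \<Phi> A N')"
    if "N \<in> infsets M" for N
  proof -
    have "{n\<in>N. Inf N < n} \<in> infsets M"
      using that infsets_greater[of N "Inf N"] infsets_mono by (auto simp: infsets_def)
    then have "\<exists>L\<in>infsets {n\<in>N. Inf N < n}. \<forall>A\<in>Pow {..Inf N}. \<Phi> A L"
    proof (rule dense_finite[rotated 3])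
      show "\<Phi> A L'" if "\<Phi> A L" "L' \<in> infsets L" for A L L' using that by (rule her)
      show "\<exists>L\<in>infsets N'. \<Phi> A L" if "A \<in> Pow {..Inf N}" "N' \<in> infsets M" for A N'
        using that finite_subset[of A "{..Inf N}"] by (intro dense) auto
    qed simp
    then show ?thesis by (simp only: Bex_def)
  qed
  then obtain nxt where nxt: "\<And>N. N \<in> infsets M \<Longrightarrow> nxt N \<in> infsets {n\<in>N. Inf N < n}"
      "\<And>N A. N \<in> infsets M \<Longrightarrow> A \<subseteq> {..Inf N} \<Longrightarrow> \<Phi> A (nxt N)"
    by (metis PowI)
  \<comment> \<open>The empty \<open>A\<close> has no maximum, so its condition is secured before
    the construction starts.\<close>
  obtain N0 where N0: "N0 \<in> infsets M" "\<Phi> {} N0"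
    using dense[of "{}" M] M infsets_refl by auto
  define NN where "NN k = (nxt ^^ k) N0" for k
  define l where "l k = Inf (NN k)" for k
  have NN_M: "NN k \<in> infsets M" for k
  proof (induction k)
    case (Suc k)
    have "nxt (NN k) \<in> infsets {n\<in>NN k. Inf (NN k) < n}" using nxt(1)[OF Suc] .
    then show ?case using Suc by (auto simp: NN_def infsets_def)
  qed (simp add: NN_def N0)
  have NN_Suc: "NN (Suc k) \<subseteq> {n\<in>NN k. l k < n}" for k
    using nxt(1)[OF NN_M[of k]] by (simp add: NN_def l_def infsets_def)
  have NN_dec: "NN j \<subseteq> NN i" if "i \<le> j" for i j
    using that by (induction rule: dec_induct) (use NN_Suc in auto)
  have l_in: "l k \<in> NN k" for k
    using NN_M[of k] by (auto simp: l_def infsets_def intro: Inf_mem)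
  have l_less: "l k < l (Suc k)" for k using NN_Suc l_in by blast
  then have l_mono: "strict_mono l" by (simp add: strict_mono_Suc_iff)
  have inf: "infinite (range l)"
    using l_mono by (simp add: range_inj_infinite strict_mono_imp_inj_on)
  show ?thesis
  proof (intro bexI[of _ "range l"] allI impI)
    show "range l \<in> infsets M" using inf l_in NN_M by (auto simp: infsets_def)
    fix A assume A: "finite A" "A \<subseteq> range l"
    let ?T = "{x\<in>range l. \<forall>a\<in>A. a < x}"
    have T: "infinite ?T" using infsets_above[OF inf A(1)] by (simp add: infsets_def)
    show "\<Phi> A ?T"
    proof (cases "A = {}")
      case True
      have "range l \<subseteq> N0" using l_in NN_dec[of 0] by (auto simp: NN_def)
      then show ?thesis using N0 her T True by (auto simp: infsets_def)
    next
      case False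
      then obtain k where k: "Max A = l k" using A Max_in by blast
      have "?T \<subseteq> NN (Suc k)"
      proof
        fix x assume "x \<in> ?T"
        moreover have "Max A \<in> A" using A(1) False by (rule Max_in)
        ultimately obtain j where j: "x = l j" "l k < l j" unfolding k by blast
        then have "Suc k \<le> j" using l_mono by (simp add: strict_mono_less Suc_le_eq)
        then show "x \<in> NN (Suc k)" using j(1) l_in NN_dec by blast
      qed
      moreover have "\<Phi> A (NN (Suc k))"
        using nxt(2)[OF NN_M[of k], of A] A(1) k Max_ge[OF A(1)] by (auto simp: NN_def l_def)
      ultimately show ?thesis using her T by (simp add: infsets_def)
    qed
  qed
qed

text \<open>Diagonal sets for conditions on single points. The hypotheses speak of points of
  \<open>M\<close>, hence the intersection \<open>A \<inter> M\<close> in the condition passed to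
  \<open>diagonal\<close>.\<close>

lemma diagonal_nat:
  fixes \<Phi> :: "nat \<Rightarrow> nat set \<Rightarrow> bool"
  assumes her: "\<And>n L L'. n \<in> M \<Longrightarrow> \<Phi> n L \<Longrightarrow> L' \<in> infsets L \<Longrightarrow> \<Phi> n L'"
    and dense: "\<And>n N. n \<in> M \<Longrightarrow> N \<in> infsets M \<Longrightarrow> \<exists>L\<in>infsets N. \<Phi> n L"
    and M: "infinite M"
  shows "\<exists>L\<in>infsets M. \<forall>n\<in>L. \<Phi> n {l\<in>L. n < l}"
proof -
  have "\<exists>L\<in>infsets N. \<forall>n\<in>A \<inter> M. \<Phi> n L" if "finite A" "N \<in> infsets M" for A N
    using dense_finite[of "A \<inter> M" \<Phi> M N] that her dense by blast
  then have "\<exists>L\<in>infsets M. \<forall>A. finite A \<longrightarrow> A \<subseteq> L \<longrightarrow> (\<forall>n\<in>A \<inter> M. \<Phi> n {l\<in>L. \<forall>a\<in>A. a < l})"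
    by (intro diagonal[where \<Phi>="\<lambda>A L. \<forall>n\<in>A \<inter> M. \<Phi> n L"] M) (use her in blast)+
  then obtain L where "L \<in> infsets M"
    "\<And>A. finite A \<Longrightarrow> A \<subseteq> L \<Longrightarrow> \<forall>n\<in>A \<inter> M. \<Phi> n {l\<in>L. \<forall>a\<in>A. a < l}" by blast
  moreover from this(2)[of "{n}" for n] this(1) have "\<Phi> n {l\<in>L. n < l}" if "n \<in> L" for n
    using that by (auto simp: infsets_def)
  ultimately show ?thesis by blast
qed

section \<open>Ramsey theory of families that are open in the product topology on infinite
  sets\<close>

definition open_family :: "(nat set \<Rightarrow> bool) \<Rightarrow> bool"
  where "open_family U \<longleftrightarrow> (\<forall>P. infinite P \<longrightarrow> U P \<longrightarrow>
    (\<exists>n. \<forall>Q. infinite Q \<longrightarrow> Q \<inter> {..n} = P \<inter> {..n} \<longrightarrow> U Q))"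

text \<open>Combinatorial forcing in the manner of Nash-Williams and Galvin-Prikry: \<open>L\<close>
  accepts a finite \<open>A\<close> if every infinite set made of \<open>A\<close> and later points
  of \<open>L\<close> lies in \<open>U\<close>, and rejects it if no infinite subset of
  \<open>L\<close> accepts it. On a suitable diagonal set, if the empty set is not accepted then no
  finite subset is, whereas by openness a member of \<open>U\<close> would have an accepted initial
  segment.\<close>

theorem ramsey_open:
  assumes U: "open_family U" and M: "infinite M"
  shows "\<exists>L\<in>infsets M. (\<forall>P\<in>infsets L. U P) \<or> (\<forall>P\<in>infsets L. \<not> U P)"
proof -
  define acc where "acc A L \<longleftrightarrow> (\<forall>P\<in>infsets L. (\<forall>a\<in>A. \<forall>p\<in>P. a < p) \<longrightarrow> U (A \<union> P))" for A L
  define rej where "rej A L \<longleftrightarrow> (\<forall>N\<in>infsets L. \<not> acc A N)" for A L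
  have acc_mono: "acc A L'" if "acc A L" "L' \<in> infsets L" for A L L'
    using that infsets_mono unfolding acc_def by blast
  have rej_mono: "rej A L'" if "rej A L" "L' \<in> infsets L" for A L L'
    using that infsets_mono unfolding rej_def by blast
  \<comment> \<open>The condition to diagonalize: either \<open>A\<close> is accepted or all its
    one-point end extensions are rejected.\<close>
  define \<Phi> where "\<Phi> A L \<longleftrightarrow> acc A L \<or> (\<forall>n\<in>L. (\<forall>a\<in>A. a < n) \<longrightarrow> rej (insert n A) L)" for A L
  have \<Phi>_mono: "\<Phi> A L'" if "\<Phi> A L" "L' \<in> infsets L" for A L L'
    using that acc_mono[of A L L'] rej_mono[of _ L L'] unfolding \<Phi>_def infsets_def by blast
  have dense: "\<exists>L\<in>infsets N. \<Phi> A L" if "finite A" "N \<in> infsets M" for A N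
  proof (cases "rej A N")
    case False
    then show ?thesis by (auto simp: rej_def \<Phi>_def)
  next
    case True
    have N: "infinite N" using that by (simp add: infsets_def)
    have "\<exists>L\<in>infsets N'. acc (insert n A) L \<or> rej (insert n A) L" if "N' \<in> infsets N" for n N'
      using that infsets_refl[of N'] unfolding rej_def infsets_def by blast
    then have "\<exists>L\<in>infsets N. \<forall>n\<in>L. acc (insert n A) {l\<in>L. n < l} \<or> rej (insert n A) {l\<in>L. n < l}"
      by (intro diagonal_nat[where \<Phi>="\<lambda>n L. acc (insert n A) L \<or> rej (insert n A) L"] N)
        (use acc_mono rej_mono in blast)+
    then obtain L where L: "L \<in> infsets N"
      "\<And>n. n \<in> L \<Longrightarrow> acc (insert n A) {l\<in>L. n < l} \<or> rej (insert n A) {l\<in>L. n < l}" by blast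
    define B where "B = {n\<in>L. acc (insert n A) {l\<in>L. n < l}}"
    \<comment> \<open>Otherwise \<open>B\<close> would accept \<open>A\<close>: an infinite set from
      \<open>B\<close> beyond \<open>A\<close> is its minimum \<open>n\<close>, for which
      \<open>insert n A\<close> is accepted, followed by later points of \<open>L\<close>. This
      contradicts the rejection of \<open>A\<close> by \<open>N\<close>.\<close>
    have "finite B"
    proof (rule ccontr)
      assume "infinite B"
      then have B: "B \<in> infsets N" using L(1) by (auto simp: B_def infsets_def)
      have "acc A B"
        unfolding acc_def
      proof (intro ballI impI)
        fix P assume P: "P \<in> infsets B" and AP: "\<forall>a\<in>A. \<forall>p\<in>P. a < p"
        let ?n = "Inf P"
        have n: "?n \<in> P" using P by (auto simp: infsets_def intro: Inf_mem)
        then have "acc (insert ?n A) {l\<in>L. ?n < l}" using P by (auto simp: infsets_def B_def)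
        moreover have gr: "?n < p" if "p \<in> P - {?n}" for p
          using that Inf_le[of p P] by auto
        then have "P - {?n} \<in> infsets {l\<in>L. ?n < l}"
          using P by (auto simp: infsets_def B_def)
        ultimately have "U (insert ?n A \<union> (P - {?n}))"
          using AP gr unfolding acc_def by auto
        moreover have "insert ?n A \<union> (P - {?n}) = A \<union> P" using n by auto
        ultimately show "U (A \<union> P)" by simp
      qed
      then show False using True B by (simp add: rej_def)
    qed
    then have L': "L - B \<in> infsets L" using L(1) by (auto simp: infsets_def)
    have "rej (insert n A) (L - B)" if n: "n \<in> L - B" for n
      unfolding rej_def
    proof
      fix N' assume N': "N' \<in> infsets (L - B)"
      then have "{l\<in>N'. n < l} \<in> infsets N'" by (auto simp: infsets_def intro!: infsets_greater[unfolded infsets_def, simplified])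
      moreover from this N' have "{l\<in>N'. n < l} \<in> infsets {l\<in>L. n < l}" by (auto simp: infsets_def)
      moreover have "rej (insert n A) {l\<in>L. n < l}" using L(2)[of n] n by (auto simp: B_def)
      ultimately show "\<not> acc (insert n A) N'" using acc_mono unfolding rej_def by blast
    qed
    then have "\<Phi> A (L - B)" by (simp add: \<Phi>_def)
    then show ?thesis using L' L(1) infsets_mono by blast
  qed
  obtain L where L: "L \<in> infsets M"
    "\<And>A. finite A \<Longrightarrow> A \<subseteq> L \<Longrightarrow> \<Phi> A {l\<in>L. \<forall>a\<in>A. a < l}"
    using diagonal[of \<Phi> M] \<Phi>_mono dense M by blast
  have Linf: "infinite L" using L(1) by (simp add: infsets_def)
  show ?thesis
  proof (cases "acc {} L")
    case True
    then show ?thesis using L(1) by (auto simp: acc_def)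
  next
    case False
    \<comment> \<open>Acceptance of \<open>A\<close> by \<open>L\<close> involves only the points of
      \<open>L\<close> beyond \<open>A\<close>, so in the induction on the maximum the first
      alternative of \<open>\<Phi>\<close> is excluded and the second one applies to the next
      point.\<close>
    have not_acc: "\<not> acc A L" if "finite A" "A \<subseteq> L" for A
      using that
    proof (induction A rule: finite_linorder_max_induct)
      case empty
      then show ?case using False by simp
    next
      case (insert n A)
      let ?LA = "{l\<in>L. \<forall>a\<in>A. a < l}"
      have "\<not> acc A L" "\<Phi> A ?LA" using insert L(2) by auto
      moreover have "acc A L" if "acc A ?LA"
        using that unfolding acc_def infsets_def by blast
      ultimately have "rej (insert n A) ?LA" using insert by (auto simp: \<Phi>_def)
      moreover have "?LA \<in> infsets L" using infsets_above[OF Linf insert.hyps(1)] .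
      ultimately show ?case
        using acc_mono infsets_refl unfolding rej_def infsets_def by blast
    qed
    have "\<not> U P" if P: "P \<in> infsets L" for P
    proof
      assume "U P"
      then obtain n where n: "\<And>Q. infinite Q \<Longrightarrow> Q \<inter> {..n} = P \<inter> {..n} \<Longrightarrow> U Q"
        using U P unfolding open_family_def infsets_def by (metis (no_types) mem_Collect_eq)
      have "\<not> P \<subseteq> {..n}" using P finite_subset[of P "{..n}"] by (auto simp: infsets_def)
      then obtain m where m: "m \<in> P" "n < m" unfolding subset_iff atMost_iff not_le[symmetric] by blast
      have "acc (P \<inter> {..m}) L"
        unfolding acc_def
      proof (intro ballI impI)
        fix Q assume Q: "Q \<in> infsets L" "\<forall>a\<in>P \<inter> {..m}. \<forall>p\<in>Q. a < p"
        have "m < p" if "p \<in> Q" for p using Q(2) m(1) that by simp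
        then have "(P \<inter> {..m} \<union> Q) \<inter> {..n} = P \<inter> {..n}" using m(2) by force
        then show "U (P \<inter> {..m} \<union> Q)" using Q(1) by (intro n) (auto simp: infsets_def)
      qed
      then show False using not_acc[of "P \<inter> {..m}"] P by (auto simp: infsets_def)
    qed
    then show ?thesis using L(1) by blast
  qed
qed

text \<open>Colour \<open>P\<close> by whether some initial segment lies in \<open>\<F>\<close> but
  not in \<open>\<G>\<close>. If all infinite subsets of \<open>L\<close> have one, extend a member
  of \<open>\<G>\<close> to such a \<open>P\<close>: the segment outside \<open>\<G>\<close> is not
  contained in that member by heredity, hence contains it, and heredity of \<open>\<F>\<close>
  applies. If none has one, use that a member of \<open>\<F>\<close> is itself an initial segment of
  some \<open>P\<close>.\<close>

lemma gasparis_dichotomy: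
  assumes F: "\<And>A B. A \<in> \<F> \<Longrightarrow> B \<subseteq> A \<Longrightarrow> B \<in> \<F>" and G: "\<And>A B. A \<in> \<G> \<Longrightarrow> B \<subseteq> A \<Longrightarrow> B \<in> \<G>"
    and fin: "\<And>A. A \<in> \<F> \<Longrightarrow> finite A" "\<And>A. A \<in> \<G> \<Longrightarrow> finite A"
    and M: "infinite M"
  shows "\<exists>L\<in>infsets M. (\<forall>A\<in>\<F>. A \<subseteq> L \<longrightarrow> A \<in> \<G>) \<or> (\<forall>A\<in>\<G>. A \<subseteq> L \<longrightarrow> A \<in> \<F>)"
proof -
  define U where "U P \<longleftrightarrow> (\<exists>n. P \<inter> {..n} \<in> \<F> - \<G>)" for P :: "nat set"
  have "open_family U" unfolding open_family_def U_def by (metis)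
  from ramsey_open[OF this M] obtain L where L: "L \<in> infsets M"
    "(\<forall>P\<in>infsets L. U P) \<or> (\<forall>P\<in>infsets L. \<not> U P)" by blast
  have ext: "\<exists>P\<in>infsets L. \<exists>n. A = P \<inter> {..n}" if "finite A" "A \<subseteq> L" for A
  proof -
    from finite_nat_iff_bounded_le[THEN iffD1, OF that(1)] obtain n where n: "A \<subseteq> {..n}" ..
    have "infinite L" using L(1) by (simp add: infsets_def)
    then have "A \<union> {l\<in>L. n < l} \<in> infsets L"
      using infsets_greater[of L n] that by (auto simp: infsets_def)
    moreover have "A = (A \<union> {l\<in>L. n < l}) \<inter> {..n}" using n by auto
    ultimately show ?thesis by blast
  qed
  from L(2) show ?thesis
  proof
    assume *: "\<forall>P\<in>infsets L. U P"
    have "A \<in> \<F>" if A: "A \<in> \<G>" "A \<subseteq> L" for A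
    proof -
      obtain P n where P: "P \<in> infsets L" "A = P \<inter> {..n}" using ext[OF fin(2)[OF A(1)] A(2)] by blast
      then obtain m where m: "P \<inter> {..m} \<in> \<F>" "P \<inter> {..m} \<notin> \<G>" using * by (auto simp: U_def)
      have "\<not> m \<le> n" using m(2) G[OF A(1), of "P \<inter> {..m}"] P(2) by (auto intro: order_trans)
      then have "A \<subseteq> P \<inter> {..m}" using P(2) by auto
      then show ?thesis using F[OF m(1)] by blast
    qed
    then show ?thesis using L(1) by blast
  next
    assume *: "\<forall>P\<in>infsets L. \<not> U P"
    have "A \<in> \<G>" if A: "A \<in> \<F>" "A \<subseteq> L" for A
    proof -
      obtain P n where P: "P \<in> infsets L" "A = P \<inter> {..n}" using ext[OF fin(1)[OF A(1)] A(2)] by blast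
      then show ?thesis using A * unfolding U_def by blast
    qed
    then show ?thesis using L(1) by blast
  qed
qed

section \<open>Schreier families\<close>

fun sblocks :: "nat set set \<Rightarrow> nat \<Rightarrow> nat set set"
  where
    "sblocks \<F> 0 = {{}}"
  | "sblocks \<F> (Suc n) = {A \<union> B | A B. A \<in> \<F> \<and> B \<in> sblocks \<F> n \<and> (\<forall>a\<in>A. \<forall>b\<in>B. a < b)}"

lemma sblocks_SucI:
  "A \<in> \<F> \<Longrightarrow> B \<in> sblocks \<F> n \<Longrightarrow> (\<And>a b. a \<in> A \<Longrightarrow> b \<in> B \<Longrightarrow> a < b) \<Longrightarrow>
    A \<union> B \<in> sblocks \<F> (Suc n)"
  by auto

lemma sblocks_UN:
  assumes "\<And>i. i < n \<Longrightarrow> F i \<in> \<F>"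
    and "\<And>i j a b. i < j \<Longrightarrow> j < n \<Longrightarrow> a \<in> F i \<Longrightarrow> b \<in> F j \<Longrightarrow> a < b"
  shows "(\<Union>i<n. F i) \<in> sblocks \<F> n"
  using assms
proof (induction n arbitrary: F)
  case (Suc n)
  have "(\<Union>i<n. F (Suc i)) \<in> sblocks \<F> n"
  proof (rule Suc.IH)
    show "F (Suc i) \<in> \<F>" if "i < n" for i using that Suc.prems(1) by simp
    show "a < b" if "i < j" "j < n" "a \<in> F (Suc i)" "b \<in> F (Suc j)" for i j a b
      using Suc.prems(2)[of "Suc i" "Suc j"] that by simp
  qed
  moreover have "F 0 \<in> \<F>" using Suc.prems(1)[of 0] by simp
  moreover have "a < b" if "a \<in> F 0" "b \<in> (\<Union>i<n. F (Suc i))" for a b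
    using that Suc.prems(2)[of 0 "Suc _"] by auto
  ultimately have "F 0 \<union> (\<Union>i<n. F (Suc i)) \<in> sblocks \<F> (Suc n)"
    by (intro sblocks_SucI) auto
  moreover have "(\<Union>i<Suc n. F i) = F 0 \<union> (\<Union>i<n. F (Suc i))"
    by (simp add: lessThan_Suc_eq_insert_0)
  ultimately show ?case by (simp only:)
qed simp

lemma sblocks_hereditary:
  assumes "\<And>A B. A \<in> \<F> \<Longrightarrow> B \<subseteq> A \<Longrightarrow> B \<in> \<F>"
  shows "A \<in> sblocks \<F> n \<Longrightarrow> B \<subseteq> A \<Longrightarrow> B \<in> sblocks \<F> n"
proof (induction n arbitrary: A B)
  case (Suc n)
  then obtain A1 A2 where A: "A = A1 \<union> A2" "A1 \<in> \<F>" "A2 \<in> sblocks \<F> n" "\<forall>a\<in>A1. \<forall>b\<in>A2. a < b"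
    by auto
  have "(A1 \<inter> B) \<union> (A2 \<inter> B) \<in> sblocks \<F> (Suc n)"
    using A assms[of A1 "A1 \<inter> B"] Suc.IH[of A2 "A2 \<inter> B"] by (intro sblocks_SucI) auto
  moreover have "B = (A1 \<inter> B) \<union> (A2 \<inter> B)" using A(1) Suc.prems(2) by auto
  ultimately show ?case by (simp only:)
qed simp

lemma sblocks_spread:
  assumes "\<And>A. A \<in> \<F> \<Longrightarrow> strict_mono_on A g \<Longrightarrow> (\<And>a. a \<in> A \<Longrightarrow> a \<le> g a) \<Longrightarrow> g ` A \<in> \<F>"
  shows "A \<in> sblocks \<F> n \<Longrightarrow> strict_mono_on A g \<Longrightarrow> (\<And>a. a \<in> A \<Longrightarrow> a \<le> g a) \<Longrightarrow>
    g ` A \<in> sblocks \<F> n"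
proof (induction n arbitrary: A)
  case (Suc n)
  then obtain A1 A2 where A: "A = A1 \<union> A2" "A1 \<in> \<F>" "A2 \<in> sblocks \<F> n" "\<forall>a\<in>A1. \<forall>b\<in>A2. a < b"
    by auto
  have mono: "strict_mono_on A1 g" "strict_mono_on A2 g"
    using Suc.prems(2) A(1) by (auto simp: strict_mono_on_def)
  have "g ` A1 \<union> g ` A2 \<in> sblocks \<F> (Suc n)"
  proof (rule sblocks_SucI)
    show "g ` A1 \<in> \<F>" using A mono Suc.prems(3) by (intro assms) auto
    show "g ` A2 \<in> sblocks \<F> n" using A mono Suc.prems(3) by (intro Suc.IH) auto
    show "a < b" if "a \<in> g ` A1" "b \<in> g ` A2" for a b
      using that A(1,4) Suc.prems(2) by (auto simp: strict_mono_on_def)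
  qed
  then show ?case by (simp only: A(1) image_Un)
qed simp

lemma sblocks_finite: "(\<And>A. A \<in> \<F> \<Longrightarrow> finite A) \<Longrightarrow> A \<in> sblocks \<F> n \<Longrightarrow> finite A"
  by (induction n arbitrary: A) auto

text \<open>
  Allowing empty pieces and fewer than \<open>n\<close> of them makes closure under subsets immediate.
\<close>

lemma schreier_succ_eq:
  assumes e: "{} \<in> \<F>" and fin: "\<And>A. A \<in> \<F> \<Longrightarrow> finite A"
  shows "schreier_succ \<F> = {A. \<exists>n. A \<in> sblocks \<F> n \<and> (\<forall>a\<in>A. n \<le> a)}"
proof (intro equalityI subsetI)
  fix A assume "A \<in> schreier_succ \<F>"
  then consider "A = {}" | n F where "A = (\<Union>i\<in>{1..n}. F i)" "n \<ge> 1"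
      "\<And>i. i \<in> {1..n} \<Longrightarrow> F i \<in> \<F> \<and> F i \<noteq> {}" "n \<le> Min (F 1)"
      "\<And>i. i \<in> {1..<n} \<Longrightarrow> Max (F i) < Min (F (i + 1))"
    unfolding schreier_succ_def by blast
  then show "A \<in> {A. \<exists>n. A \<in> sblocks \<F> n \<and> (\<forall>a\<in>A. n \<le> a)}"
  proof cases
    case 1
    then show ?thesis by (auto intro!: exI[of _ 0])
  next
    case (2 n F)
    have less: "Max (F i) < Min (F j)" if "1 \<le> i" "i < j" "j \<le> n" for i j
      using that(2,3)
    proof (induction j)
      case (Suc j)
      show ?case
      proof (cases "i = j")
        case True
        then show ?thesis using 2(5)[of j] that(1) Suc.prems by simp
      next
        case False
        have j: "finite (F j)" "F j \<noteq> {}" using 2(3)[of j] that(1) Suc.prems False fin by auto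
        have "Max (F i) < Min (F j)" using Suc False by simp
        also have "Min (F j) \<le> Max (F j)" using j by (meson Max_in Min_le)
        also have "\<dots> < Min (F (Suc j))" using 2(5)[of j] that(1) Suc.prems by simp
        finally show ?thesis .
      qed
    qed simp
    have less': "a < b" if "1 \<le> i" "i < j" "j \<le> n" "a \<in> F i" "b \<in> F j" for i j a b
    proof -
      have "finite (F i)" "finite (F j)" using 2(3) fin that by auto
      then have "a \<le> Max (F i)" "Min (F j) \<le> b" using that by auto
      then show ?thesis using less[of i j] that by simp
    qed
    have "F (Suc i) \<in> \<F>" if "i < n" for i using that 2(3)[of "Suc i"] by simp
    moreover have "a < b" if "i < j" "j < n" "a \<in> F (Suc i)" "b \<in> F (Suc j)" for i j a b
      using less'[of "Suc i" "Suc j" a b] that by simp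
    ultimately have "(\<Union>i<n. F (Suc i)) \<in> sblocks \<F> n"
      using sblocks_UN[of n "\<lambda>i. F (Suc i)" \<F>] by blast
    moreover have "A = (\<Union>i<n. F (Suc i))"
      unfolding 2(1) by (simp only: image_Suc_lessThan[symmetric] image_image)
    moreover have "n \<le> a" if a: "a \<in> A" for a
    proof -
      obtain i where i: "i \<in> {1..n}" "a \<in> F i" using a 2(1) by blast
      have F1: "finite (F 1)" "F 1 \<noteq> {}" using 2(2,3) fin by auto
      then have "Min (F 1) \<in> F 1" by simp
      then have "Min (F 1) \<le> a"
        using i less'[of 1 i "Min (F 1)" a] F1(1) by (cases "i = 1") (simp_all add: less_imp_le)
      then show ?thesis using 2(4) by simp
    qed
    ultimately show ?thesis by blast
  qed
next
  fix A assume "A \<in> {A. \<exists>n. A \<in> sblocks \<F> n \<and> (\<forall>a\<in>A. n \<le> a)}"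
  then obtain n where n: "A \<in> sblocks \<F> n" "\<And>a. a \<in> A \<Longrightarrow> n \<le> a" by blast
  have "\<exists>m G. m \<le> n \<and> (\<forall>i\<in>{1..m}. G i \<in> \<F> \<and> G i \<noteq> {}) \<and> A = (\<Union>i\<in>{1..m}. G i) \<and>
      (\<forall>i\<in>{1..<m}. Max (G i) < Min (G (i + 1)))"
    using n(1)
  proof (induction n arbitrary: A)
    case 0
    then show ?case by (auto intro!: exI[of _ 0])
  next
    case (Suc n)
    then obtain A1 A2 where A: "A = A1 \<union> A2" "A1 \<in> \<F>" "A2 \<in> sblocks \<F> n" "\<forall>a\<in>A1. \<forall>b\<in>A2. a < b"
      by auto
    obtain m G where m: "m \<le> n" "\<And>i. i \<in> {1..m} \<Longrightarrow> G i \<in> \<F> \<and> G i \<noteq> {}"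
      "A2 = (\<Union>i\<in>{1..m}. G i)" "\<And>i. i \<in> {1..<m} \<Longrightarrow> Max (G i) < Min (G (i + 1))"
      using Suc.IH[OF A(3)] by blast
    \<comment> \<open>An empty first piece is dropped and a nonempty one becomes \<open>H 1\<close>;
      dropping is the reason for \<open>m \<le> n\<close> instead of equality.\<close>
    show ?case
    proof (cases "A1 = {}")
      case True
      then have "A = (\<Union>i\<in>{1..m}. G i)" using A(1) m(3) by simp
      then show ?thesis using m by (intro exI[of _ m] exI[of _ G]) auto
    next
      case False
      define H where "H i = (if i = 1 then A1 else G (i - 1))" for i :: nat
      have "{1..Suc m} = insert 1 (Suc ` {1..m})" by (auto simp: image_Suc_atLeastAtMost)
      then have "(\<Union>i\<in>{1..Suc m}. H i) = H 1 \<union> (\<Union>i\<in>{1..m}. H (Suc i))"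
        by (simp only: UN_insert image_image)
      also have "\<dots> = A" using A(1) m(3) by (auto simp: H_def)
      finally have h1: "A = (\<Union>i\<in>{1..Suc m}. H i)" by simp
      have h2: "H i \<in> \<F> \<and> H i \<noteq> {}" if "i \<in> {1..Suc m}" for i
      proof (cases "i = 1")
        case True
        then show ?thesis using A(2) False by (simp add: H_def)
      next
        case i1: False
        then have "i - 1 \<in> {1..m}" using that by auto
        then show ?thesis using i1 m(2)[of "i - 1"] by (simp add: H_def)
      qed
      have h3: "Max (H i) < Min (H (i + 1))" if i: "i \<in> {1..<Suc m}" for i
      proof (cases "i = 1")
        case True
        have 1: "1 \<in> {1..m}" using i True by simp
        have "Min (G 1) \<in> G 1" using m(2)[OF 1] fin by (intro Min_in) auto
        then have "Min (G 1) \<in> A2" using 1 unfolding m(3) by blast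
        moreover have "Max A1 \<in> A1" using fin A(2) \<open>A1 \<noteq> {}\<close> by (intro Max_in) auto
        ultimately show ?thesis using A(4) True by (simp add: H_def)
      next
        case False
        then have "i - 1 \<in> {1..<m}" "Suc (i - 1) = i" using i by auto
        then show ?thesis using m(4)[of "i - 1"] False by (simp add: H_def)
      qed
      show ?thesis
        by (intro exI[of _ "Suc m"] exI[of _ H] conjI ballI)
          (use h1 h2 h3 m(1) in \<open>(simp; fail | blast)+\<close>)
    qed
  qed
  then obtain m G where m: "m \<le> n" "\<And>i. i \<in> {1..m} \<Longrightarrow> G i \<in> \<F> \<and> G i \<noteq> {}"
      "A = (\<Union>i\<in>{1..m}. G i)" "\<And>i. i \<in> {1..<m} \<Longrightarrow> Max (G i) < Min (G (i + 1))" by blast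
  show "A \<in> schreier_succ \<F>"
  proof (cases "m = 0")
    case True
    then show ?thesis using m(3) by (simp add: schreier_succ_def)
  next
    case False
    then have 1: "1 \<in> {1..m}" by simp
    then have "Min (G 1) \<in> G 1" using m(2)[OF 1] fin by (intro Min_in) auto
    then have "Min (G 1) \<in> A" using 1 unfolding m(3) by blast
    then have "m \<le> Min (G 1)" using n(2) m(1) order_trans by blast
    moreover have "1 \<le> m" using False by simp
    ultimately show ?thesis unfolding schreier_succ_def using m(2,3,4) by blast
  qed
qed

lemma omega1_cases:
  obtains "\<xi> = 0" | \<zeta> where "\<xi> = osuc \<zeta>" | "is_limit \<xi>"
  by (auto simp: is_limit_def is_succ_def)

lemma omega1_induct [case_names zero succ limit]:
  assumes "P 0" "\<And>\<zeta>. P \<zeta> \<Longrightarrow> P (osuc \<zeta>)" "\<And>\<xi>. is_limit \<xi> \<Longrightarrow> (\<And>\<zeta>. \<zeta> < \<xi> \<Longrightarrow> P \<zeta>) \<Longrightarrow> P \<xi>"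
  shows "P (\<xi> :: omega1)"
proof (induction \<xi> rule: less_induct)
  case (less \<xi>)
  show ?case
    by (cases \<xi> rule: omega1_cases) (use assms less less_osuc in auto)
qed

lemma less_osuc_iff: "\<alpha> < osuc \<beta> \<longleftrightarrow> \<alpha> \<le> \<beta>"
  by (metis less_osuc linorder_not_less order_le_less_trans osuc_le_iff)

locale fundamental_system =
  fixes s :: "omega1 \<Rightarrow> nat \<Rightarrow> omega1"
  assumes fs: "fundamental_sequences s"
begin

lemma schreier_empty: "{} \<in> schreier s \<xi>"
  by (cases \<xi> rule: omega1_cases)
    (auto simp: schreier_zero schreier_osuc schreier_is_limit[OF fs] schreier_succ_def schreier_limit_def)

lemma schreier_finite: "A \<in> schreier s \<xi> \<Longrightarrow> finite A"
proof (induction \<xi> arbitrary: A rule: omega1_induct)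
  case (succ \<zeta>)
  have "schreier s (osuc \<zeta>) = {A. \<exists>n. A \<in> sblocks (schreier s \<zeta>) n \<and> (\<forall>a\<in>A. n \<le> a)}"
    unfolding schreier_osuc by (rule schreier_succ_eq) (use schreier_empty succ.IH in auto)
  then show ?case using succ sblocks_finite[of "schreier s \<zeta>" A] by auto
qed (auto simp: schreier_zero schreier_is_limit[OF fs] schreier_limit_def)

lemma schreier_osuc_eq:
  "schreier s (osuc \<zeta>) = {A. \<exists>n. A \<in> sblocks (schreier s \<zeta>) n \<and> (\<forall>a\<in>A. n \<le> a)}"
  unfolding schreier_osuc by (rule schreier_succ_eq) (use schreier_empty schreier_finite in auto)

lemma schreier_limit_eq:
  assumes "is_limit \<xi>"
  shows "schreier s \<xi> = insert {} {A. \<exists>n\<ge>1. (\<forall>a\<in>A. n \<le> a) \<and> A \<in> schreier s (s \<xi> n)}"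
proof (rule set_eqI)
  fix A
  show "A \<in> schreier s \<xi> \<longleftrightarrow> A \<in> insert {} {A. \<exists>n\<ge>1. (\<forall>a\<in>A. n \<le> a) \<and> A \<in> schreier s (s \<xi> n)}"
  proof (cases "finite A \<and> A \<noteq> {}")
    case True
    then show ?thesis
      by (simp add: schreier_is_limit[OF fs assms] schreier_limit_def)
  next
    case False
    then show ?thesis
      using schreier_finite[of A] by (auto simp: schreier_is_limit[OF fs assms] schreier_limit_def)
  qed
qed

lemma schreier_hereditary: "A \<in> schreier s \<xi> \<Longrightarrow> B \<subseteq> A \<Longrightarrow> B \<in> schreier s \<xi>"
proof (induction \<xi> arbitrary: A B rule: omega1_induct)
  case (succ \<zeta>)
  then obtain n where n: "A \<in> sblocks (schreier s \<zeta>) n" "\<forall>a\<in>A. n \<le> a"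
    unfolding schreier_osuc_eq by blast
  have "B \<in> sblocks (schreier s \<zeta>) n"
    using succ.IH n(1) succ.prems(2) by (rule sblocks_hereditary)
  then show ?case using n(2) succ.prems(2) unfolding schreier_osuc_eq by blast

next
  case (limit \<xi>)
  then show ?case using fundamental_sequences_less[OF fs limit.hyps(1)]
    unfolding schreier_limit_eq[OF limit.hyps(1)] by blast
qed (auto simp: schreier_zero)

text \<open>Admissibility asks the elements to be at least a given bound, and moving them to the
  right preserves this as well as the order of the pieces.\<close>

lemma schreier_spread:
  "A \<in> schreier s \<xi> \<Longrightarrow> strict_mono_on A g \<Longrightarrow> (\<And>a. a \<in> A \<Longrightarrow> a \<le> g a) \<Longrightarrow> g ` A \<in> schreier s \<xi>"
proof (induction \<xi> arbitrary: A rule: omega1_induct)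
  case zero
  then show ?case by (fastforce simp: schreier_zero)
next
  case (succ \<zeta>)
  then obtain n where n: "A \<in> sblocks (schreier s \<zeta>) n" "\<forall>a\<in>A. n \<le> a"
    unfolding schreier_osuc_eq by blast
  have "g ` A \<in> sblocks (schreier s \<zeta>) n"
    using succ.IH n(1) succ.prems(2,3) by (rule sblocks_spread)
  moreover have "\<forall>a\<in>g ` A. n \<le> a" using n(2) succ.prems(3) order_trans by blast
  ultimately show ?case unfolding schreier_osuc_eq by blast
next
  case (limit \<xi>)
  show ?case
  proof (cases "A = {}")
    case True
    then show ?thesis by (simp add: schreier_empty)
  next
    case False
    then obtain n where n: "n \<ge> 1" "\<forall>a\<in>A. n \<le> a" "A \<in> schreier s (s \<xi> n)"
      using limit.prems(1) unfolding schreier_limit_eq[OF limit.hyps(1)] by blast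
    have "g ` A \<in> schreier s (s \<xi> n)"
      using limit.IH fundamental_sequences_less[OF fs limit.hyps(1)] n limit.prems by blast
    moreover have "\<forall>a\<in>g ` A. n \<le> a" using n(2) limit.prems(3) order_trans by blast
    ultimately show ?thesis using n(1) unfolding schreier_limit_eq[OF limit.hyps(1)] by blast
  qed
qed

lemma schreier_pos: "A \<in> schreier s \<xi> \<Longrightarrow> a \<in> A \<Longrightarrow> 1 \<le> a"
proof (induction \<xi> arbitrary: A a rule: omega1_induct)
  case (succ \<zeta>)
  have "1 \<le> a" if "A \<in> sblocks (schreier s \<zeta>) n" "a \<in> A" for n A a
    using that by (induction n arbitrary: A) (use succ.IH in auto)
  then show ?case using succ.prems unfolding schreier_osuc_eq by blast
next
  case (limit \<xi>)
  then show ?case unfolding schreier_limit_eq[OF limit.hyps(1)] using order_trans by blast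
qed (auto simp: schreier_zero)

end

section \<open>First averages and tails\<close>

text \<open>With \<open>v\<close> the first average of a set, this is the tail whose first average
  is average number \<open>k + 1\<close> of \<open>P\<close>.\<close>

fun rest :: "(nat set \<Rightarrow> nat \<Rightarrow> real) \<Rightarrow> nat set \<Rightarrow> nat \<Rightarrow> nat set"
  where
    "rest v P 0 = P"
  | "rest v P (Suc k) = rest v (P - supp (v P)) k"

lemma rest_add: "rest v P (m + n) = rest v (rest v P m) n"
  by (induction m arbitrary: P) auto

lemma rest_Suc_right: "rest v P (Suc k) = rest v P k - supp (v (rest v P k))"
  using rest_add[of v P k 1] by simp

lemma rest_eq: "rest v P m = P - (\<Union>i<m. supp (v (rest v P i)))"
  by (induction m) (auto simp: rest_Suc_right lessThan_Suc simp del: rest.simps(2))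

context fundamental_system
begin

lemma RA_supp_finite: "P \<in> infsets {1..} \<Longrightarrow> n \<ge> 1 \<Longrightarrow> finite (supp (RA s \<xi> P n))"
  using ra_seq_RA[OF fs, of P \<xi>] by (simp add: ra_seq_def)

lemma RA_nonneg: "P \<in> infsets {1..} \<Longrightarrow> n \<ge> 1 \<Longrightarrow> 0 \<le> RA s \<xi> P n j"
  using ra_seq_RA[OF fs, of P \<xi>] by (simp add: ra_seq_def)

lemma infsets_diff_supp:
  "P \<in> infsets {1..} \<Longrightarrow> P - supp (RA s \<xi> P 1) \<in> infsets P"
  using RA_supp_finite[of P 1 \<xi>] by (auto simp: infsets_def)

lemma rest_RA_infsets:
  "P \<in> infsets {1..} \<Longrightarrow> rest (\<lambda>Q. RA s \<xi> Q 1) P k \<in> infsets P"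
proof (induction k arbitrary: P)
  case (Suc k)
  have "P - supp (RA s \<xi> P 1) \<in> infsets P" using Suc.prems by (rule infsets_diff_supp)
  then show ?case
    using Suc.IH[of "P - supp (RA s \<xi> P 1)"] Suc.prems infsets_mono by (metis rest.simps(2))
qed (simp add: infsets_def)

text \<open>The first block starts at offset 0, and nothing cancels in the sum because the
  coefficients are nonnegative.\<close>

lemma supp_ra_succ:
  assumes "P \<in> infsets {1..}"
  shows "supp (ra_succ (RA s \<zeta>) P 1) = (\<Union>i\<in>{1..Min (supp (RA s \<zeta> P 1))}. supp (RA s \<zeta> P i))"
proof -
  let ?m = "Min (supp (RA s \<zeta> P 1))"
  have m: "?m \<ge> 1"
  proof -
    have "?m \<in> supp (RA s \<zeta> P 1)"
      using RA_supp_finite[OF assms] ra_seq_nonempty[OF ra_seq_RA[OF fs assms]] by (intro Min_in) auto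
    then show ?thesis
      using ra_seq_RA[OF fs assms, of \<zeta>] assms unfolding ra_seq_def infsets_def by fastforce
  qed
  have "ra_succ (RA s \<zeta>) P 1 j = 0 \<longleftrightarrow> (\<forall>i\<in>{1..?m}. RA s \<zeta> P i j = 0)" for j
  proof -
    have "(\<Sum>i = 1..?m. RA s \<zeta> P i j) = 0 \<longleftrightarrow> (\<forall>i\<in>{1..?m}. RA s \<zeta> P i j = 0)"
      by (rule sum_nonneg_eq_0_iff) (auto intro: RA_nonneg assms)
    then show ?thesis using m by (simp add: ra_succ_def block_length_def)
  qed
  then show ?thesis by (auto simp: supp_def)
qed

text \<open>Removing the first block shifts the start of every later block by the length of the
  first one. Block lengths are read off from the averages at the block starts and so are
  unchanged.\<close>

lemma block_start_shift:
  assumes "\<And>k. k \<ge> 1 \<Longrightarrow> a (Min (supp (a 1)) + k) = a' k" and "k \<ge> 1"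
  shows "block_start a (Suc k) = Min (supp (a 1)) + block_start a' k"
    and "block_length a (Suc k) = block_length a' k"
proof -
  show *: "block_start a (Suc k) = Min (supp (a 1)) + block_start a' k"
    using \<open>k \<ge> 1\<close>
  proof (induction k rule: dec_induct)
    case base
    then show ?case by simp
  next
    case (step k)
    have "block_start a (Suc (Suc k)) = block_start a (Suc k) + block_length a (Suc k)"
      by (rule block_start_Suc) simp
    also have "block_length a (Suc k) = block_length a' k"
      using assms(1)[of "block_start a' k + 1"] by (simp add: block_length_def step.IH add.assoc)
    also have "block_start a (Suc k) + block_length a' k
        = Min (supp (a 1)) + block_start a' (Suc k)"
      using step by (simp add: block_start_Suc)
    finally show ?case .
  qed
  show "block_length a (Suc k) = block_length a' k"
    using assms(1)[of "block_start a' k + 1"] unfolding block_length_def *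
    by (simp add: add.assoc)
qed

text \<open>This turns the hierarchy into a first-average operation applied to successive tails. At
  a successor the first support uses up exactly the \<zeta>-averages of the first block, and the
  induction hypothesis identifies the remaining ones with those of the tail. At a limit the
  recursion for the remaining sets is just entered one step later.\<close>

lemma RA_shift:
  "P \<in> infsets {1..} \<Longrightarrow> k \<ge> 1 \<Longrightarrow> RA s \<xi> P (Suc k) = RA s \<xi> (P - supp (RA s \<xi> P 1)) k"
proof (induction \<xi> arbitrary: P k rule: omega1_induct)
  case zero
  have "supp (RA s 0 P 1) = {LEAST n. n \<in> P}"
    by (auto simp: RA_zero supp_def enum1_def enumerate_0)
  moreover have "enum1 P (Suc k) = enum1 (P - {LEAST n. n \<in> P}) k"
    using zero.prems(2) by (cases k) (simp_all add: enum1_def enumerate_Suc)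
  ultimately show ?case by (simp add: RA_zero)
next
  case (succ \<zeta>)
  let ?v = "\<lambda>Q. RA s \<zeta> Q 1"
  \<comment> \<open>The induction hypothesis iterated: dropping \<open>m\<close> averages means
    passing to the \<open>m\<close>-th tail.\<close>
  have sh: "RA s \<zeta> Q (m + k) = RA s \<zeta> (rest ?v Q m) k" if "Q \<in> infsets {1..}" "k \<ge> 1" for Q m k
    using that(1)
  proof (induction m arbitrary: Q)
    case (Suc m)
    have "RA s \<zeta> Q (Suc (m + k)) = RA s \<zeta> (Q - supp (RA s \<zeta> Q 1)) (m + k)"
      using Suc.prems that(2) by (intro succ.IH) auto
    then show ?case
      using Suc.IH[OF infsets_mono[OF infsets_diff_supp]] Suc.prems by simp
  qed simp
  let ?m = "Min (supp (RA s \<zeta> P 1))"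
  let ?Q = "rest ?v P ?m"
  have RA_Suc: "RA s \<zeta> P (Suc i) = ?v (rest ?v P i)" for i
    using sh[OF succ.prems(1) order_refl, of i] by (simp only: Suc_eq_plus1)
  have "(\<Union>i\<in>{1..?m}. supp (RA s \<zeta> P i)) = (\<Union>i<?m. supp (RA s \<zeta> P (Suc i)))"
    by (simp only: image_Suc_lessThan[symmetric] image_image)
  also have "\<dots> = (\<Union>i<?m. supp (?v (rest ?v P i)))"
    by (simp only: RA_Suc)
  finally have Q: "P - supp (RA s (osuc \<zeta>) P 1) = ?Q"
    by (simp only: RA_osuc supp_ra_succ[OF succ.prems(1)] rest_eq[of ?v P ?m])
  have a: "RA s \<zeta> P (?m + k) = RA s \<zeta> ?Q k" if "k \<ge> 1" for k
    using succ.prems(1) that by (rule sh)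
  have bs: "block_start (RA s \<zeta> P) (Suc k) = ?m + block_start (RA s \<zeta> ?Q) k"
    "block_length (RA s \<zeta> P) (Suc k) = block_length (RA s \<zeta> ?Q) k"
    using block_start_shift[where a="RA s \<zeta> P" and a'="RA s \<zeta> ?Q"] a succ.prems(2) by simp_all
  have "ra_succ (RA s \<zeta>) P (Suc k) j = ra_succ (RA s \<zeta>) ?Q k j" for j
  proof -
    have "RA s \<zeta> P (?m + block_start (RA s \<zeta> ?Q) k + i) j = RA s \<zeta> ?Q (block_start (RA s \<zeta> ?Q) k + i) j"
      if "i \<in> {1..block_length (RA s \<zeta> ?Q) k}" for i
      using a[of "block_start (RA s \<zeta> ?Q) k + i"] that by (simp add: add.assoc)
    then have "(\<Sum>i = 1..block_length (RA s \<zeta> ?Q) k. RA s \<zeta> P (?m + block_start (RA s \<zeta> ?Q) k + i) j)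
        = (\<Sum>i = 1..block_length (RA s \<zeta> ?Q) k. RA s \<zeta> ?Q (block_start (RA s \<zeta> ?Q) k + i) j)"
      by (rule sum.cong[OF refl])
    then show ?thesis unfolding ra_succ_def bs by (rule arg_cong)
  qed
  then show ?case unfolding Q unfolding RA_osuc by (rule ext)
next
  case (limit \<xi>)
  let ?A = "\<lambda>n. RA s (s \<xi> n)"
  have RA: "RA s \<xi> Q = ra_limit ?A Q" if "Q \<in> infsets {1..}" for Q
    using RA_is_limit[OF fs limit.hyps(1) that] .
  let ?Q = "P - supp (RA s \<xi> P 1)"
  have Q: "?Q \<in> infsets {1..}" using infsets_diff_supp[OF limit.prems(1)] limit.prems(1) by (rule infsets_mono)
  have eq: "ra_rest ?A P (Suc k) = ra_rest ?A ?Q k"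
    using limit.prems(2)
  proof (induction k rule: dec_induct)
    case base
    then show ?case by (simp add: RA[OF limit.prems(1)] ra_limit_def)
  next
    case (step k)
    then show ?case using ra_rest_Suc[of "Suc k" ?A P] ra_rest_Suc[of k ?A ?Q]
      by (simp add: ra_limit_def)
  qed
  have "RA s \<xi> P (Suc k) = ra_limit ?A P (Suc k)" by (rule RA[OF limit.prems(1), THEN fun_cong])
  also have "\<dots> = ra_limit ?A ?Q k" unfolding ra_limit_def eq ..
  also have "\<dots> = RA s \<xi> ?Q k" by (rule RA[OF Q, THEN fun_cong, symmetric])
  finally show ?case .

qed

section \<open>First averages: support, mass, dependence on an initial segment\<close>

definition ra1 :: "omega1 \<Rightarrow> nat set \<Rightarrow> nat \<Rightarrow> real"
  where "ra1 \<xi> P = RA s \<xi> P 1"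

abbreviation ra_tail :: "omega1 \<Rightarrow> nat set \<Rightarrow> nat \<Rightarrow> nat set"
  where "ra_tail \<xi> \<equiv> rest (ra1 \<xi>)"

lemma ra_tail_infsets: "P \<in> infsets {1..} \<Longrightarrow> ra_tail \<xi> P k \<in> infsets P"
  using rest_RA_infsets[of P \<xi> k] by (simp add: ra1_def[abs_def])

lemma ra_tail_infsets_trans:
  "P \<in> infsets L \<Longrightarrow> L \<in> infsets {1..} \<Longrightarrow> ra_tail \<xi> P k \<in> infsets L"
  by (rule infsets_mono[OF ra_tail_infsets]) (auto intro: infsets_mono)

lemma RA_eq:
  assumes "P \<in> infsets {1..}"
  shows "RA s \<xi> P (Suc k) = ra1 \<xi> (ra_tail \<xi> P k)"
  using assms
proof (induction k arbitrary: P)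
  case (Suc k)
  have "RA s \<xi> P (Suc (Suc k)) = RA s \<xi> (P - supp (RA s \<xi> P 1)) (Suc k)"
    using Suc.prems by (rule RA_shift) simp
  also have "\<dots> = ra1 \<xi> (ra_tail \<xi> (P - supp (RA s \<xi> P 1)) k)"
    using infsets_mono[OF infsets_diff_supp[OF Suc.prems] Suc.prems] by (rule Suc.IH)
  also have "RA s \<xi> P 1 = ra1 \<xi> P" by (simp add: ra1_def)
  finally show ?case by simp
qed (simp add: ra1_def)

lemma ra1_nonneg: "P \<in> infsets {1..} \<Longrightarrow> 0 \<le> ra1 \<xi> P j"
  by (simp add: ra1_def RA_nonneg)

lemma ra1_supp_finite: "P \<in> infsets {1..} \<Longrightarrow> finite (supp (ra1 \<xi> P))"
  by (simp add: ra1_def RA_supp_finite)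

lemma ra1_supp_subset: "P \<in> infsets {1..} \<Longrightarrow> supp (ra1 \<xi> P) \<subseteq> P"
  using ra_seq_RA[OF fs, of P \<xi>] by (auto simp: ra1_def ra_seq_def)

text \<open>The supports are successive and exhaust \<open>P\<close>, so a point of \<open>P\<close>
  outside the first support belongs to a later one.\<close>

lemma ra1_supp_initial:
  assumes "P \<in> infsets {1..}" "p \<in> supp (ra1 \<xi> P)" "q \<in> P" "q \<notin> supp (ra1 \<xi> P)"
  shows "p < q"
proof -
  have "ra_seq P (RA s \<xi> P)" using assms(1) by (rule ra_seq_RA[OF fs])
  then obtain n where n: "n \<ge> 1" "q \<in> supp (RA s \<xi> P n)"
    using assms(3) unfolding ra_seq_def by blast
  then have "1 < n" using assms(4) by (cases "n = 1") (auto simp: ra1_def)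
  then show ?thesis using \<open>ra_seq P (RA s \<xi> P)\<close> n(2) assms(2) unfolding ra_seq_def ra1_def by blast
qed

lemma ra1_supp_nonempty: "P \<in> infsets {1..} \<Longrightarrow> supp (ra1 \<xi> P) \<noteq> {}"
  unfolding ra1_def by (rule ra_seq_nonempty[OF ra_seq_RA[OF fs]]) auto

lemma Inf_in_infsets: "P \<in> infsets {1..} \<Longrightarrow> Inf P \<in> P"
  by (simp add: infsets_def Inf_mem)

lemma Inf_in_supp_ra1: "P \<in> infsets {1..} \<Longrightarrow> Inf P \<in> supp (ra1 \<xi> P)"
  using ra1_supp_nonempty[of P \<xi>] ra1_supp_initial[of P _ \<xi> "Inf P"] ra1_supp_subset[of P \<xi>] Inf_le
  by (metis Inf_in_infsets ex_in_conv not_less subsetD)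

lemma Min_supp_ra1: "P \<in> infsets {1..} \<Longrightarrow> Min (supp (ra1 \<xi> P)) = Inf P"
  using Inf_in_supp_ra1[of P \<xi>] ra1_supp_subset[of P \<xi>] Inf_le
  by (intro Min_eqI ra1_supp_finite) auto

lemma ra1_zero:
  assumes "P \<in> infsets {1..}"
  shows "ra1 0 P = (\<lambda>j. if j = Inf P then 1 else 0)"
proof -
  have "enum1 P 1 = Inf P"
    using assms Inf_in_infsets[OF assms] by (auto simp: enum1_def enumerate_0 infsets_def Inf_nat_def)
  then show ?thesis by (simp add: ra1_def RA_zero)
qed

lemma ra1_osuc:
  assumes "P \<in> infsets {1..}"
  shows "ra1 (osuc \<zeta>) P j = 1 / real (Inf P) * (\<Sum>k<Inf P. ra1 \<zeta> (ra_tail \<zeta> P k) j)"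
proof -
  have "block_length (RA s \<zeta> P) 1 = Inf P"
    using Min_supp_ra1[OF assms, of \<zeta>] by (simp add: block_length_def ra1_def)
  then have "ra1 (osuc \<zeta>) P j = 1 / real (Inf P) * (\<Sum>i = 1..Inf P. RA s \<zeta> P i j)"
    by (simp add: ra1_def RA_osuc ra_succ_def)
  also have "(\<Sum>i = 1..Inf P. RA s \<zeta> P i j) = (\<Sum>k<Inf P. RA s \<zeta> P (Suc k) j)"
    by (simp add: sum.atLeast1_atMost_eq)
  finally show ?thesis using RA_eq[OF assms] by simp
qed

lemma ra1_limit:
  assumes "is_limit \<xi>" "P \<in> infsets {1..}"
  shows "ra1 \<xi> P = ra1 (s \<xi> (Inf P)) P"
  by (simp add: ra1_def RA_is_limit[OF fs assms] ra_limit_def)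

lemma sum_ra1_supp:
  assumes "P \<in> infsets {1..}"
  shows "sum (ra1 \<xi> P) (supp (ra1 \<xi> P)) = 1"
proof -
  have "ra1 \<xi> P sums 1" using ra_seq_RA[OF fs assms, of \<xi>] by (simp add: ra_seq_def ra1_def)
  moreover have "ra1 \<xi> P sums sum (ra1 \<xi> P) (supp (ra1 \<xi> P))"
    using ra1_supp_finite[OF assms] by (rule sums_finite) (simp add: supp_def)
  ultimately show ?thesis by (rule sums_unique2[symmetric])
qed

lemma sum_ra1_nonneg: "P \<in> infsets {1..} \<Longrightarrow> 0 \<le> sum (ra1 \<xi> P) F"
  by (intro sum_nonneg ra1_nonneg)

lemma sum_ra1_Int: "finite F \<Longrightarrow> sum (ra1 \<xi> P) F = sum (ra1 \<xi> P) (F \<inter> supp (ra1 \<xi> P))"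
  by (rule sum.mono_neutral_right) (auto simp: supp_def)

lemma sum_ra1_le_1:
  assumes "P \<in> infsets {1..}"
  shows "sum (ra1 \<xi> P) F \<le> 1"
proof (cases "finite F")
  case True
  then show ?thesis
    unfolding sum_ra1_Int[OF True] sum_ra1_supp[OF assms, of \<xi>, symmetric]
    by (intro sum_mono2 ra1_supp_finite ra1_nonneg assms) auto
qed simp

lemma supp_ra1_osuc:
  assumes "P \<in> infsets {1..}"
  shows "supp (ra1 (osuc \<zeta>) P) = (\<Union>k<Inf P. supp (ra1 \<zeta> (ra_tail \<zeta> P k)))"
proof -
  have T: "ra_tail \<zeta> P k \<in> infsets {1..}" for k
    using ra_tail_infsets[OF assms] assms by (rule infsets_mono)
  have "ra1 (osuc \<zeta>) P j = 0 \<longleftrightarrow> (\<forall>k\<in>{..<Inf P}. ra1 \<zeta> (ra_tail \<zeta> P k) j = 0)" for j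
  proof -
    have "(\<Sum>k<Inf P. ra1 \<zeta> (ra_tail \<zeta> P k) j) = 0 \<longleftrightarrow> (\<forall>k\<in>{..<Inf P}. ra1 \<zeta> (ra_tail \<zeta> P k) j = 0)"
      by (rule sum_nonneg_eq_0_iff) (auto intro: ra1_nonneg T)
    moreover have "Inf P \<ge> 1" using assms by (rule Inf_ge_1)
    ultimately show ?thesis by (simp add: ra1_osuc[OF assms])
  qed
  then show ?thesis by (auto simp: supp_def)
qed

lemma sum_ra1_osuc:
  assumes "P \<in> infsets {1..}"
  shows "sum (ra1 (osuc \<zeta>) P) F = 1 / real (Inf P) * (\<Sum>k<Inf P. sum (ra1 \<zeta> (ra_tail \<zeta> P k)) F)"
  unfolding ra1_osuc[OF assms] sum_distrib_left[symmetric] by (subst sum.swap) simp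

text \<open>The recursion reads only the minimum and the supports removed so far. While these stay
  in \<open>{..n}\<close>, the tails of \<open>P\<close> and \<open>Q\<close> agree up to
  \<open>n\<close>, so the averages in the block coincide one after the other. This yields openness
  for the Ramsey argument and permits exchanging the part of a set behind its first support.\<close>

lemma ra1_local:
  "P \<in> infsets {1..} \<Longrightarrow> Q \<in> infsets {1..} \<Longrightarrow> supp (ra1 \<xi> P) \<subseteq> {..n} \<Longrightarrow>
    P \<inter> {..n} = Q \<inter> {..n} \<Longrightarrow> ra1 \<xi> Q = ra1 \<xi> P"
proof (induction \<xi> arbitrary: P Q rule: less_induct)
  case (less \<xi>)
  have in_n: "Inf P \<le> n" using Inf_in_supp_ra1[OF less.prems(1)] less.prems(3) by blast
  have iff: "p \<in> P \<longleftrightarrow> p \<in> Q" if "p \<le> n" for p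
    using less.prems(4) that by (metis IntI IntD1 atMost_iff)
  have "Inf P \<in> Q" using iff[OF in_n] Inf_in_infsets[OF less.prems(1)] by simp
  then have le: "Inf Q \<le> Inf P" by (rule Inf_le)
  then have "Inf Q \<in> P" using iff[of "Inf Q"] Inf_in_infsets[OF less.prems(2)] in_n by simp
  then have Inf: "Inf Q = Inf P" using le Inf_le by (intro antisym) auto
  show ?case
  proof (cases \<xi> rule: omega1_cases)
    case 1
    then show ?thesis using less.prems Inf by (simp add: ra1_zero)
  next
    case (2 \<zeta>)
    have sub: "supp (ra1 \<zeta> (ra_tail \<zeta> P k)) \<subseteq> {..n}" if "k < Inf P" for k
      using less.prems(3) that unfolding 2 supp_ra1_osuc[OF less.prems(1)] by blast
    have step: "ra1 \<zeta> (ra_tail \<zeta> Q k) = ra1 \<zeta> (ra_tail \<zeta> P k)"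
      if "ra_tail \<zeta> P k \<inter> {..n} = ra_tail \<zeta> Q k \<inter> {..n}" "k < Inf P" for k
    proof (rule less.IH)
      show "\<zeta> < \<xi>" using 2 less_osuc by simp
      show "ra_tail \<zeta> P k \<in> infsets {1..}" "ra_tail \<zeta> Q k \<in> infsets {1..}"
        using less.prems(1,2) by (auto intro: infsets_mono[OF ra_tail_infsets])
    qed (use that sub in simp_all)
    have "ra_tail \<zeta> P k \<inter> {..n} = ra_tail \<zeta> Q k \<inter> {..n}" if "k \<le> Inf P" for k
      using that
    proof (induction k)
      case 0
      then show ?case using less.prems(4) by simp
    next
      case (Suc k)
      have "ra_tail \<zeta> R (Suc k) \<inter> {..n} = (ra_tail \<zeta> R k \<inter> {..n}) - supp (ra1 \<zeta> (ra_tail \<zeta> R k))" for R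
        by (auto simp: rest_Suc_right simp del: rest.simps(2))
      then show ?case using Suc step[of k] by simp
    qed
    then have "ra1 \<zeta> (ra_tail \<zeta> Q k) = ra1 \<zeta> (ra_tail \<zeta> P k)" if "k < Inf P" for k
      using step that by simp
    then show ?thesis unfolding 2 by (intro ext) (simp add: ra1_osuc[OF less.prems(1)] ra1_osuc[OF less.prems(2)] Inf)
  next
    case 3
    have "s \<xi> (Inf P) < \<xi>"
      using fundamental_sequences_less[OF fs 3] Inf_ge_1[OF less.prems(1)] by simp
    then show ?thesis
      using less.IH[of "s \<xi> (Inf P)" P Q] less.prems ra1_limit[OF 3] Inf by simp
  qed
qed

end

section \<open>Schreier sets of lower index have small mass\<close>

lemma sparse_subset:
  assumes "infinite (M :: nat set)"
  shows "\<exists>L\<in>infsets M. \<forall>a\<in>L. \<forall>b\<in>L. a < b \<longrightarrow> g a \<le> (b :: nat)"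
proof -
  have "\<exists>L\<in>infsets M. \<forall>n\<in>L. \<forall>l\<in>{l\<in>L. n < l}. g n \<le> l"
  proof (rule diagonal_nat)
    show "\<exists>L\<in>infsets N. \<forall>l\<in>L. g n \<le> l" if "n \<in> M" "N \<in> infsets M" for n N
    proof
      show "{l\<in>N. g n < l} \<in> infsets N" using that by (intro infsets_greater) (simp add: infsets_def)
    qed auto
  qed (use assms in \<open>auto simp: infsets_def\<close>)
  then show ?thesis by blast
qed

lemma sum_lessThan_add:
  "(\<Sum>i<m + n. f i) = (\<Sum>i<m. f i) + (\<Sum>i<n. f (m + i :: nat) :: 'a :: comm_monoid_add)"
  by (induction n) (simp_all add: add.assoc)

lemma sum_Un_le:
  assumes "finite A" "finite B" "\<And>x. 0 \<le> (f x :: real)"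
  shows "sum f (A \<union> B) \<le> sum f A + sum f B"
  using sum.union_inter[OF assms(1,2), of f] sum_nonneg[of "A \<inter> B" f] assms(3) by simp

context fundamental_system
begin

text \<open>
  For \<open>n = min P\<close> the first average at \<open>\<xi> \<noteq> 0\<close> is the one at the successor of \<open>pred_at \<xi> n\<close>.
\<close>

definition pred_at :: "omega1 \<Rightarrow> nat \<Rightarrow> omega1"
  where "pred_at \<xi> n = opred (if is_succ \<xi> then \<xi> else s \<xi> n)"

lemma pred_at_osuc [simp]: "pred_at (osuc \<zeta>) n = \<zeta>"
  by (simp add: pred_at_def)

lemma osuc_pred_at_limit:
  assumes "is_limit \<xi>" "n \<ge> 1"
  shows "osuc (pred_at \<xi> n) = s \<xi> n"
proof -
  have "is_succ (s \<xi> n)" using fs assms unfolding fundamental_sequences_def by blast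
  then show ?thesis using assms(1) by (auto simp: pred_at_def is_limit_def is_succ_def)
qed

lemma pred_at_less:
  assumes "\<xi> \<noteq> 0" "n \<ge> 1"
  shows "pred_at \<xi> n < \<xi>"
proof (cases \<xi> rule: omega1_cases)
  case 3
  then show ?thesis
    using osuc_pred_at_limit[OF 3 assms(2)] fundamental_sequences_less[OF fs 3 assms(2)]
      less_osuc[of "pred_at \<xi> n"] by simp
qed (use assms less_osuc in simp_all)

lemma ra1_pred_at:
  assumes "\<xi> \<noteq> 0" "P \<in> infsets {1..}"
  shows "ra1 \<xi> P = ra1 (osuc (pred_at \<xi> (Inf P))) P"
proof (cases \<xi> rule: omega1_cases)
  case 3
  then show ?thesis
    using ra1_limit[OF 3 assms(2)] osuc_pred_at_limit[OF 3 Inf_ge_1[OF assms(2)]] by simp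
qed (use assms in simp_all)

lemma schreier_pred_at:
  assumes "\<xi> \<noteq> 0" "n \<ge> 1" "F \<in> schreier s (osuc (pred_at \<xi> n))" "\<And>i. i \<in> F \<Longrightarrow> n \<le> i"
  shows "F \<in> schreier s \<xi>"
proof (cases \<xi> rule: omega1_cases)
  case 3
  then show ?thesis
    using assms osuc_pred_at_limit[OF 3 assms(2)] unfolding schreier_limit_eq[OF 3] by auto
qed (use assms in simp_all)

text \<open>At a limit the supremum property puts \<zeta> below some \<open>s \<xi> m\<close>,
  monotonicity keeps it below all later terms, and their predecessors are then at least
  \<zeta>.\<close>

lemma eventually_le_pred_at:
  assumes "\<zeta> < \<xi>"
  shows "\<exists>n0\<ge>1. \<forall>n\<ge>n0. \<zeta> \<le> pred_at \<xi> n"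
proof (cases \<xi> rule: omega1_cases)
  case 1
  then show ?thesis using assms zero_le_omega1[of \<zeta>] by (simp add: not_le[symmetric])
next
  case (2 \<theta>)
  then show ?thesis using assms by (auto simp: less_osuc_iff)
next
  case 3
  have mono: "strict_mono_on {1..} (s \<xi>)" and sup: "\<And>\<eta>. (\<forall>n\<ge>1. s \<xi> n \<le> \<eta>) \<Longrightarrow> \<xi> \<le> \<eta>"
    using fs 3 unfolding fundamental_sequences_def by blast+
  obtain m where m: "m \<ge> 1" "\<zeta> < s \<xi> m" using sup[of \<zeta>] assms by (meson not_le)
  have "\<zeta> \<le> pred_at \<xi> n" if "n \<ge> m" for n
  proof -
    have "s \<xi> m \<le> s \<xi> n"
      using mono m(1) that by (cases "m = n") (auto simp: strict_mono_on_def intro: less_imp_le)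
    then have "\<zeta> < osuc (pred_at \<xi> n)"
      using m that osuc_pred_at_limit[OF 3, of n] by simp
    then show ?thesis by (simp add: less_osuc_iff)
  qed
  then show ?thesis using m(1) by blast
qed

text \<open>The minimum lies in the first support, so all later averages live in \<open>L\<close>
  even if the minimum does not.\<close>

lemma ra_tail_1_infsets:
  assumes "P \<in> infsets {1..}" "P - {Inf P} \<subseteq> L"
  shows "ra_tail \<xi> P 1 \<in> infsets L"
proof -
  have "ra_tail \<xi> P 1 \<subseteq> P - {Inf P}" using Inf_in_supp_ra1[OF assms(1)] by auto
  then show ?thesis using assms ra_tail_infsets[OF assms(1), of \<xi> 1] by (auto simp: infsets_def)
qed

definition lower_small :: "omega1 \<Rightarrow> bool"
  where "lower_small \<xi> \<longleftrightarrow> (\<forall>\<zeta><\<xi>. \<forall>M\<in>infsets {1..}. \<forall>\<epsilon>>0. \<exists>L\<in>infsets M. \<forall>P\<in>infsets L.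
    \<forall>F\<in>schreier s \<zeta>. sum (ra1 \<xi> P) F \<le> \<epsilon>)"

text \<open>Smallness fails at equal index, where one average may be carried almost entirely by a
  member of \<open>schreier s \<xi>\<close>; the substitute is a bound over all averages together.
  The constant is 1 for the first average that is met plus 1 for all later ones.\<close>

definition total_bounded :: "omega1 \<Rightarrow> bool"
  where "total_bounded \<xi> \<longleftrightarrow> (\<forall>M\<in>infsets {1..}. \<exists>L\<in>infsets M. \<forall>P\<in>infsets L.
    \<forall>F\<in>schreier s \<xi>. \<forall>K. (\<Sum>k<K. sum (ra1 \<xi> (ra_tail \<xi> P k)) F) \<le> 2)"

text \<open>The 3 consists of 1 for the first \<theta>-average, which contains \<open>Inf P\<close>
  and need not live in \<open>L\<close>, and of 2 from \<open>total_bounded\<close> if \<zeta> =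
  \<theta>. If \<zeta> < \<theta>, every later average contributes at most \<epsilon> before the
  division. Leaving \<open>Inf P\<close> free lets \<open>L\<close> depend on it in the diagonal
  arguments.\<close>

lemma first_average_small:
  assumes S: "lower_small \<theta>" and T: "total_bounded \<theta>" and "\<zeta> \<le> \<theta>"
    and M: "M \<in> infsets {1..}" and \<epsilon>: "\<epsilon> > 0"
  shows "\<exists>L\<in>infsets M. \<forall>P\<in>infsets {1..}. P - {Inf P} \<subseteq> L \<longrightarrow>
    (\<forall>F\<in>schreier s \<zeta>. sum (ra1 (osuc \<theta>) P) F \<le> \<epsilon> + 3 / real (Inf P))"
proof -
  obtain L where L: "L \<in> infsets M"
    and bound: "\<And>R F K. R \<in> infsets L \<Longrightarrow> F \<in> schreier s \<zeta> \<Longrightarrow>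
      (\<Sum>k<K. sum (ra1 \<theta> (ra_tail \<theta> R k)) F) \<le> 2 + real K * \<epsilon>"
  proof (cases "\<zeta> = \<theta>")
    case True
    obtain L where L: "L \<in> infsets M" "\<forall>P\<in>infsets L. \<forall>F\<in>schreier s \<theta>. \<forall>K.
        (\<Sum>k<K. sum (ra1 \<theta> (ra_tail \<theta> P k)) F) \<le> 2"
      using T M unfolding total_bounded_def by blast
    have "(\<Sum>k<K. sum (ra1 \<theta> (ra_tail \<theta> R k)) F) \<le> 2 + real K * \<epsilon>"
      if "R \<in> infsets L" "F \<in> schreier s \<zeta>" for R F K
    proof -
      have "(\<Sum>k<K. sum (ra1 \<theta> (ra_tail \<theta> R k)) F) \<le> 2" using L(2) that True by blast
      moreover have "0 \<le> real K * \<epsilon>" using \<epsilon> by simp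
      ultimately show ?thesis by linarith
    qed
    then show ?thesis using that L(1) by blast
  next
    case False
    then have "\<zeta> < \<theta>" using assms(3) by simp
    then obtain L where L: "L \<in> infsets M"
      "\<forall>P\<in>infsets L. \<forall>F\<in>schreier s \<zeta>. sum (ra1 \<theta> P) F \<le> \<epsilon>"
      using S M \<epsilon> unfolding lower_small_def by blast
    have "(\<Sum>k<K. sum (ra1 \<theta> (ra_tail \<theta> R k)) F) \<le> 2 + real K * \<epsilon>"
      if "R \<in> infsets L" "F \<in> schreier s \<zeta>" for R F K
    proof -
      have "ra_tail \<theta> R k \<in> infsets L" for k
        using that(1) infsets_mono[OF L(1) M] by (rule ra_tail_infsets_trans)
      then have "(\<Sum>k<K. sum (ra1 \<theta> (ra_tail \<theta> R k)) F) \<le> real (card {..<K}) * \<epsilon>"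
        using L(2) that(2) by (intro sum_bounded_above) blast
      then show ?thesis by simp
    qed
    then show ?thesis using that L(1) by blast
  qed
  have "sum (ra1 (osuc \<theta>) P) F \<le> \<epsilon> + 3 / real (Inf P)"
    if P: "P \<in> infsets {1..}" "P - {Inf P} \<subseteq> L" and F: "F \<in> schreier s \<zeta>" for P F
  proof -
    let ?a = "\<lambda>k. sum (ra1 \<theta> (ra_tail \<theta> P k)) F"
    obtain p where p: "Inf P = Suc p" using Inf_ge_1[OF P(1)] by (cases "Inf P") auto
    have "ra_tail \<theta> P (Suc k) = ra_tail \<theta> (ra_tail \<theta> P 1) k" for k by simp
    then have "(\<Sum>k<p. ?a (Suc k)) \<le> 2 + real p * \<epsilon>"
      using bound[OF ra_tail_1_infsets[OF P] F, of \<theta> p] by simp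
    moreover have "?a 0 \<le> 1" using sum_ra1_le_1[OF P(1)] by simp
    moreover have "(\<Sum>k<Suc p. ?a k) = ?a 0 + (\<Sum>k<p. ?a (Suc k))" by (rule sum.lessThan_Suc_shift)
    ultimately have "(\<Sum>k<Suc p. ?a k) \<le> 3 + real (Suc p) * \<epsilon>"
      using \<epsilon> by (simp add: algebra_simps)
    then have "1 / real (Suc p) * (\<Sum>k<Suc p. ?a k) \<le> 1 / real (Suc p) * (3 + real (Suc p) * \<epsilon>)"
      by (intro mult_left_mono) simp_all
    also have "\<dots> = \<epsilon> + 3 / real (Suc p)" by (simp add: field_simps)
    finally show ?thesis unfolding sum_ra1_osuc[OF P(1)] p .
  qed
  then show ?thesis using L by blast
qed

text \<open>For limit \<xi> the index \<open>pred_at \<xi> n\<close> changes with the minimum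
  \<open>n\<close> of the set, so the sets found for the different \<open>n\<close> are merged by
  diagonalization. Minima below \<open>n0\<close>, where \<zeta> may exceed
  \<open>pred_at \<xi> n\<close>, are discarded at the end.\<close>

lemma lower_small_step:
  assumes "\<xi> \<noteq> 0" and IH: "\<And>\<theta>. \<theta> < \<xi> \<Longrightarrow> lower_small \<theta> \<and> total_bounded \<theta>"
  shows "lower_small \<xi>"
  unfolding lower_small_def
proof (intro allI impI ballI)
  fix \<zeta> M and \<epsilon> :: real
  assume "\<zeta> < \<xi>" and M: "M \<in> infsets {1..}" and \<epsilon>: "\<epsilon> > 0"
  obtain n0 where n0: "n0 \<ge> 1" "\<And>n. n \<ge> n0 \<Longrightarrow> \<zeta> \<le> pred_at \<xi> n"
    using eventually_le_pred_at[OF \<open>\<zeta> < \<xi>\<close>] by blast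
  have "\<exists>L\<in>infsets M. \<forall>n\<in>L. n \<ge> n0 \<longrightarrow> (\<forall>P\<in>infsets {1..}. Inf P = n \<longrightarrow> P - {n} \<subseteq> {l\<in>L. n < l} \<longrightarrow>
      (\<forall>F\<in>schreier s \<zeta>. sum (ra1 (osuc (pred_at \<xi> n)) P) F \<le> \<epsilon> / 2 + 3 / real n))"
  proof (rule diagonal_nat)
    fix n N assume n: "n \<in> M" and N: "N \<in> infsets M"
    show "\<exists>L\<in>infsets N. n \<ge> n0 \<longrightarrow> (\<forall>P\<in>infsets {1..}. Inf P = n \<longrightarrow> P - {n} \<subseteq> L \<longrightarrow>
      (\<forall>F\<in>schreier s \<zeta>. sum (ra1 (osuc (pred_at \<xi> n)) P) F \<le> \<epsilon> / 2 + 3 / real n))"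
    proof (cases "n \<ge> n0")
      case True
      then have "pred_at \<xi> n < \<xi>" using pred_at_less[OF assms(1)] n0(1) by simp
      then have "\<exists>L\<in>infsets N. \<forall>P\<in>infsets {1..}. P - {Inf P} \<subseteq> L \<longrightarrow>
        (\<forall>F\<in>schreier s \<zeta>. sum (ra1 (osuc (pred_at \<xi> n)) P) F \<le> \<epsilon> / 2 + 3 / real (Inf P))"
        using IH True n0(2) infsets_mono[OF N M] \<epsilon> by (intro first_average_small) auto
      then show ?thesis by metis
    next
      case False
      then show ?thesis using N by (auto intro!: bexI[of _ N] infsets_refl simp: infsets_def)
    qed
  next
    show "infinite M" using M by (simp add: infsets_def)
  qed (unfold infsets_def, blast)
  then obtain L where L: "L \<in> infsets M"
    and small': "\<forall>n\<in>L. n \<ge> n0 \<longrightarrow> (\<forall>P\<in>infsets {1..}. Inf P = n \<longrightarrow> P - {n} \<subseteq> {l\<in>L. n < l} \<longrightarrow>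
      (\<forall>F\<in>schreier s \<zeta>. sum (ra1 (osuc (pred_at \<xi> n)) P) F \<le> \<epsilon> / 2 + 3 / real n))"
    by (elim bexE)
  have small: "sum (ra1 (osuc (pred_at \<xi> (Inf P))) P) F \<le> \<epsilon> / 2 + 3 / real (Inf P)"
    if "Inf P \<in> L" "Inf P \<ge> n0" "P \<in> infsets {1..}" "P - {Inf P} \<subseteq> {l\<in>L. Inf P < l}"
      "F \<in> schreier s \<zeta>" for P F
    using small'[rule_format, OF that(1,2,3) refl] that(4,5) by blast
  \<comment> \<open>Minima above \<open>6 / \<epsilon>\<close> bring the error
    \<open>3 / real (Inf P)\<close> below \<open>\<epsilon> / 2\<close>.\<close>
  define m where "m = max n0 (nat \<lceil>6 / \<epsilon>\<rceil>)"
  have m: "n0 \<le> m" "6 / \<epsilon> \<le> real m" unfolding m_def by linarith+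
  let ?L = "{l\<in>L. m < l}"
  have "?L \<in> infsets L" using L by (intro infsets_greater) (simp add: infsets_def)
  then have LM: "?L \<in> infsets M" using L by (rule infsets_mono)
  have "sum (ra1 \<xi> P) F \<le> \<epsilon>" if P: "P \<in> infsets ?L" and F: "F \<in> schreier s \<zeta>" for P F
  proof -
    have P1: "P \<in> infsets {1..}" using P infsets_mono[OF LM M] by (rule infsets_mono)
    have Inf: "Inf P \<in> P" using P1 by (rule Inf_in_infsets)
    then have Inf': "Inf P \<in> L" "m < Inf P" using P by (auto simp: infsets_def)
    have "Inf P < l" if "l \<in> P - {Inf P}" for l using that Inf_le[of l P] by auto
    then have "P - {Inf P} \<subseteq> {l\<in>L. Inf P < l}" using P by (auto simp: infsets_def)
    then have "sum (ra1 \<xi> P) F \<le> \<epsilon> / 2 + 3 / real (Inf P)"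
      unfolding ra1_pred_at[OF assms(1) P1] using Inf' m(1) P1 F by (intro small) auto
    also have "3 / real (Inf P) \<le> \<epsilon> / 2"
    proof -
      have "6 / \<epsilon> \<le> real (Inf P)" using m(2) Inf'(2) by linarith
      then have "6 \<le> \<epsilon> * real (Inf P)" using \<epsilon> by (simp add: field_simps)
      moreover have "0 < real (Inf P)" using Inf'(2) by simp
      ultimately show ?thesis by (simp add: field_simps)
    qed
    finally show ?thesis by simp
  qed
  then show "\<exists>L\<in>infsets M. \<forall>P\<in>infsets L. \<forall>F\<in>schreier s \<zeta>. sum (ra1 \<xi> P) F \<le> \<epsilon>"
    by (intro bexI[OF _ LM] ballI)

qed

text \<open>
  Only the first average meeting \<open>F\<close> can have large mass on \<open>F\<close>, so it suffices to bound the
  averages that come after some element of \<open>F\<close>.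
\<close>

lemma total_boundedI:
  assumes "\<And>M. M \<in> infsets {1..} \<Longrightarrow> \<exists>L\<in>infsets M. \<forall>R\<in>infsets L. \<forall>F\<in>schreier s \<xi>. \<forall>q\<in>F \<inter> L.
    q < Inf R \<longrightarrow> (\<forall>K. (\<Sum>k<K. sum (ra1 \<xi> (ra_tail \<xi> R k)) F) \<le> 1)"
  shows "total_bounded \<xi>"
  unfolding total_bounded_def
proof
  fix M assume M: "M \<in> infsets {1..}"
  from assms[OF M] obtain L where L: "L \<in> infsets M"
    and C: "\<forall>R\<in>infsets L. \<forall>F\<in>schreier s \<xi>. \<forall>q\<in>F \<inter> L.
      q < Inf R \<longrightarrow> (\<forall>K. (\<Sum>k<K. sum (ra1 \<xi> (ra_tail \<xi> R k)) F) \<le> 1)"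
    by (elim bexE)
  have L1: "L \<in> infsets {1..}" using L M by (rule infsets_mono)
  have "(\<Sum>k<K. sum (ra1 \<xi> (ra_tail \<xi> P k)) F) \<le> 2"
    if "P \<in> infsets L" and F: "F \<in> schreier s \<xi>" for P F K
    using that(1)
  proof (induction K arbitrary: P)
    case (Suc K)
    have P1: "P \<in> infsets {1..}" using Suc.prems L1 by (rule infsets_mono)
    let ?R = "P - supp (ra1 \<xi> P)"
    have RP: "?R \<in> infsets P" using ra_tail_infsets[OF P1, of \<xi> 1] by simp
    then have R: "?R \<in> infsets L" using Suc.prems by (rule infsets_mono)
    have eq: "(\<Sum>k<Suc K. sum (ra1 \<xi> (ra_tail \<xi> P k)) F) =
        sum (ra1 \<xi> P) F + (\<Sum>k<K. sum (ra1 \<xi> (ra_tail \<xi> ?R k)) F)"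
      by (subst sum.lessThan_Suc_shift) simp
    show ?case
    proof (cases "F \<inter> supp (ra1 \<xi> P) = {}")
      case True
      have "sum (ra1 \<xi> P) F = 0"
        unfolding sum_ra1_Int[OF schreier_finite[OF F]] True by simp
      then show ?thesis using eq Suc.IH[OF R] by simp
    next
      case False
      then obtain q where q: "q \<in> F" "q \<in> supp (ra1 \<xi> P)" by blast
      then have "q \<in> L" using ra1_supp_subset[OF P1] Suc.prems by (auto simp: infsets_def)
      have "Inf ?R \<in> ?R" using R infsets_mono[OF _ L1] by (intro Inf_in_infsets) blast
      then have "q < Inf ?R" using ra1_supp_initial[OF P1 q(2)] by blast
      then have "(\<Sum>k<K. sum (ra1 \<xi> (ra_tail \<xi> ?R k)) F) \<le> 1"
        by (rule C[rule_format, OF R F IntI[OF q(1) \<open>q \<in> L\<close>]])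
      then show ?thesis using eq sum_ra1_le_1[OF P1, of \<xi> F] by simp
    qed
  qed simp
  then show "\<exists>L\<in>infsets M. \<forall>P\<in>infsets L. \<forall>F\<in>schreier s \<xi>. \<forall>K.
      (\<Sum>k<K. sum (ra1 \<xi> (ra_tail \<xi> P k)) F) \<le> 2"
    using L by blast
qed

text \<open>The set is the singleton of \<open>q\<close>, and the averages are point masses beyond
  \<open>q\<close>.\<close>

lemma total_bounded_zero: "total_bounded 0"
proof (rule total_boundedI)
  fix M :: "nat set" assume M: "M \<in> infsets {1..}"
  have "(\<Sum>k<K. sum (ra1 0 (ra_tail 0 R k)) F) \<le> 1"
    if R: "R \<in> infsets M" and F: "F \<in> schreier s 0" and q: "q \<in> F" "q < Inf R" for R F q K
  proof -
    have Fq: "F = {q}" using F q(1) by (auto simp: schreier_zero)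
    have R1: "R \<in> infsets {1..}" using R M by (rule infsets_mono)
    have "sum (ra1 0 (ra_tail 0 R k)) F = 0" for k
    proof -
      have T: "ra_tail 0 R k \<in> infsets R" using R1 by (rule ra_tail_infsets)
      then have "Inf (ra_tail 0 R k) \<in> R"
        using Inf_in_infsets[OF infsets_mono[OF T R1]] by (auto simp: infsets_def)
      then have "q \<noteq> Inf (ra_tail 0 R k)" using q(2) Inf_le[of _ R] by fastforce
      then show ?thesis using infsets_mono[OF T R1] by (simp add: Fq ra1_zero)
    qed
    then show ?thesis by simp
  qed
  then show "\<exists>L\<in>infsets M. \<forall>R\<in>infsets L. \<forall>F\<in>schreier s 0. \<forall>q\<in>F \<inter> L.
    q < Inf R \<longrightarrow> (\<forall>K. (\<Sum>k<K. sum (ra1 0 (ra_tail 0 R k)) F) \<le> 1)"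
    using M by (intro bexI[of _ M] infsets_refl) (auto simp: infsets_def)
qed

text \<open>A successor average is the mean of as many consecutive \<theta>-averages as its minimum
  says, so weighting by the minima turns the sum over successor averages into a plain sum over
  \<theta>-averages.\<close>

lemma ra_tail_osuc:
  assumes R: "R \<in> infsets {1..}"
  shows "\<exists>I. ra_tail (osuc \<theta>) R K = ra_tail \<theta> R I \<and>
    (\<Sum>k<K. real (Inf (ra_tail (osuc \<theta>) R k)) * sum (ra1 (osuc \<theta>) (ra_tail (osuc \<theta>) R k)) F) =
      (\<Sum>i<I. sum (ra1 \<theta> (ra_tail \<theta> R i)) F)"
proof (induction K)
  case 0
  then show ?case by (auto intro!: exI[of _ 0])
next
  case (Suc K)
  then obtain I where I: "ra_tail (osuc \<theta>) R K = ra_tail \<theta> R I"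
    "(\<Sum>k<K. real (Inf (ra_tail (osuc \<theta>) R k)) * sum (ra1 (osuc \<theta>) (ra_tail (osuc \<theta>) R k)) F) =
      (\<Sum>i<I. sum (ra1 \<theta> (ra_tail \<theta> R i)) F)" by blast
  let ?Q = "ra_tail \<theta> R I"
  have Q: "?Q \<in> infsets {1..}" using ra_tail_infsets[OF R] R by (rule infsets_mono)
  have "ra_tail (osuc \<theta>) R (Suc K) = ?Q - supp (ra1 (osuc \<theta>) ?Q)"
    unfolding rest_Suc_right I(1) ..
  also have "\<dots> = ra_tail \<theta> ?Q (Inf ?Q)"
    unfolding supp_ra1_osuc[OF Q] by (rule rest_eq[symmetric])
  also have "\<dots> = ra_tail \<theta> R (I + Inf ?Q)" by (rule rest_add[symmetric])
  finally have 1: "ra_tail (osuc \<theta>) R (Suc K) = ra_tail \<theta> R (I + Inf ?Q)" .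
  have "real (Inf ?Q) * sum (ra1 (osuc \<theta>) ?Q) F = (\<Sum>i<Inf ?Q. sum (ra1 \<theta> (ra_tail \<theta> ?Q i)) F)"
    unfolding sum_ra1_osuc[OF Q] using Inf_ge_1[OF Q] by simp
  also have "\<dots> = (\<Sum>i<Inf ?Q. sum (ra1 \<theta> (ra_tail \<theta> R (I + i))) F)" by (simp only: rest_add)
  finally have "(\<Sum>k<Suc K. real (Inf (ra_tail (osuc \<theta>) R k)) * sum (ra1 (osuc \<theta>) (ra_tail (osuc \<theta>) R k)) F) =
      (\<Sum>i<I + Inf ?Q. sum (ra1 \<theta> (ra_tail \<theta> R i)) F)"
    unfolding sum_lessThan_add lessThan_Suc by (simp add: I add.commute)
  then show ?case using 1 by blast
qed

text \<open>A member of \<open>schreier s (osuc \<theta>)\<close> containing \<open>q\<close>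
  consists of at most \<open>q\<close> pieces, each of total mass at most 2 over the
  \<theta>-averages. Passing to successor averages divides by at least \<open>Inf R\<close>, and
  sparseness gives \<open>2 * q \<le> Inf R\<close>.\<close>

lemma total_bounded_osuc:
  assumes T: "total_bounded \<theta>"
  shows "total_bounded (osuc \<theta>)"
proof (rule total_boundedI)
  fix M :: "nat set" assume M: "M \<in> infsets {1..}"
  obtain L0 where L0: "L0 \<in> infsets M"
    and bound: "\<And>P F K. P \<in> infsets L0 \<Longrightarrow> F \<in> schreier s \<theta> \<Longrightarrow>
      (\<Sum>k<K. sum (ra1 \<theta> (ra_tail \<theta> P k)) F) \<le> 2"
    using T M unfolding total_bounded_def by blast
  obtain L where L: "L \<in> infsets L0" and sparse: "\<And>a b. a \<in> L \<Longrightarrow> b \<in> L \<Longrightarrow> a < b \<Longrightarrow> 2 * a \<le> b"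
    using sparse_subset[of L0 "\<lambda>a. 2 * a"] L0 by (auto simp: infsets_def)
  have "(\<Sum>k<K. sum (ra1 (osuc \<theta>) (ra_tail (osuc \<theta>) R k)) F) \<le> 1"
    if R: "R \<in> infsets L" and F: "F \<in> schreier s (osuc \<theta>)" and q: "q \<in> F" "q \<in> L" "q < Inf R" for R F q K
  proof -
    have RL0: "R \<in> infsets L0" using R L by (rule infsets_mono)
    have R1: "R \<in> infsets {1..}" using RL0 infsets_mono[OF L0 M] by (rule infsets_mono)
    have T1: "ra_tail \<eta> R k \<in> infsets {1..}" for \<eta> k
      using ra_tail_infsets[OF R1] R1 by (rule infsets_mono)
    have nn: "0 \<le> sum (ra1 \<eta> (ra_tail \<eta> R k)) A" for \<eta> k A using T1 by (rule sum_ra1_nonneg)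
    obtain n where n: "F \<in> sblocks (schreier s \<theta>) n" "\<And>i. i \<in> F \<Longrightarrow> n \<le> i"
      using F unfolding schreier_osuc_eq by blast
    have blocks: "(\<Sum>i<I. sum (ra1 \<theta> (ra_tail \<theta> R i)) A) \<le> 2 * real n"
      if "A \<in> sblocks (schreier s \<theta>) n" for I n A
      using that
    proof (induction n arbitrary: A)
      case (Suc n)
      then obtain A1 A2 where A: "A = A1 \<union> A2" "A1 \<in> schreier s \<theta>" "A2 \<in> sblocks (schreier s \<theta>) n"
        by auto
      have fin: "finite A1" "finite A2"
        using A(2,3) schreier_finite sblocks_finite[of "schreier s \<theta>"] by blast+
      have "(\<Sum>i<I. sum (ra1 \<theta> (ra_tail \<theta> R i)) A) \<le>
          (\<Sum>i<I. sum (ra1 \<theta> (ra_tail \<theta> R i)) A1 + sum (ra1 \<theta> (ra_tail \<theta> R i)) A2)"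
        unfolding A(1) by (intro sum_mono sum_Un_le fin ra1_nonneg T1)
      also have "\<dots> \<le> 2 + 2 * real n"
        unfolding sum.distrib using bound[OF RL0 A(2)] Suc.IH[OF A(3)] by (intro add_mono)
      finally show ?case by simp
    qed simp
    have "2 * q \<le> Inf R"
      using sparse[OF q(2) _ q(3)] Inf_in_infsets[OF R1] R by (auto simp: infsets_def)
    then have n': "2 * real n \<le> real (Inf R)" using n(2)[OF q(1)] by linarith
    let ?T = "\<lambda>k. ra_tail (osuc \<theta>) R k"
    obtain I where I: "(\<Sum>k<K. real (Inf (?T k)) * sum (ra1 (osuc \<theta>) (?T k)) F) =
      (\<Sum>i<I. sum (ra1 \<theta> (ra_tail \<theta> R i)) F)" using ra_tail_osuc[OF R1] by blast
    have "real (Inf R) * (\<Sum>k<K. sum (ra1 (osuc \<theta>) (?T k)) F) =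
        (\<Sum>k<K. real (Inf R) * sum (ra1 (osuc \<theta>) (?T k)) F)"
      by (rule sum_distrib_left)
    also have "\<dots> \<le> (\<Sum>k<K. real (Inf (?T k)) * sum (ra1 (osuc \<theta>) (?T k)) F)"
    proof (intro sum_mono mult_right_mono)
      fix k
      show "0 \<le> sum (ra1 (osuc \<theta>) (?T k)) F" by (rule nn)
      have "Inf (?T k) \<in> R"
        using Inf_in_infsets[OF T1[of "osuc \<theta>" k]] ra_tail_infsets[OF R1, of "osuc \<theta>" k]
        by (auto simp: infsets_def)
      then show "real (Inf R) \<le> real (Inf (?T k))" using Inf_le by simp
    qed
    also have "\<dots> \<le> real (Inf R)" unfolding I using blocks[OF n(1)] n' by (rule order_trans)
    finally show ?thesis using Inf_ge_1[OF R1] by simp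
  qed
  then show "\<exists>L\<in>infsets M. \<forall>R\<in>infsets L. \<forall>F\<in>schreier s (osuc \<theta>). \<forall>q\<in>F \<inter> L.
    q < Inf R \<longrightarrow> (\<forall>K. (\<Sum>k<K. sum (ra1 (osuc \<theta>) (ra_tail (osuc \<theta>) R k)) F) \<le> 1)"
    using infsets_mono[OF L L0] by blast
qed

text \<open>A set containing \<open>q\<close> lies in some \<open>schreier s (s \<xi> j)\<close>
  with \<open>j \<le> q\<close>, hence has lower index than every average that starts beyond
  \<open>q\<close>. An average with minimum \<open>n\<close> thus has mass at most
  \<open>4 / n\<close> on it, and the minima at least double from one average to the next, so a
  geometric series bounds the total.\<close>

lemma total_bounded_limit:
  assumes lim: "is_limit \<xi>" and IH: "\<And>\<theta>. \<theta> < \<xi> \<Longrightarrow> lower_small \<theta> \<and> total_bounded \<theta>"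
  shows "total_bounded \<xi>"
proof (rule total_boundedI)
  fix M :: "nat set" assume M: "M \<in> infsets {1..}"
  have ne: "\<xi> \<noteq> 0" using lim by (simp add: is_limit_def)
  have mono: "strict_mono_on {1..} (s \<xi>)" using fs lim unfolding fundamental_sequences_def by blast
  have "\<exists>L\<in>infsets M. \<forall>n\<in>L. \<forall>j\<in>{1..<n}. \<forall>P\<in>infsets {1..}. Inf P = n \<longrightarrow> P - {n} \<subseteq> {l\<in>L. n < l} \<longrightarrow>
      (\<forall>F\<in>schreier s (s \<xi> j). sum (ra1 (osuc (pred_at \<xi> n)) P) F \<le> 4 / real n)"
  proof (rule diagonal_nat)
    fix n N assume n: "n \<in> M" and N: "N \<in> infsets M"
    have n1: "n \<ge> 1" using n M by (auto simp: infsets_def)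
    show "\<exists>L\<in>infsets N. \<forall>j\<in>{1..<n}. \<forall>P\<in>infsets {1..}. Inf P = n \<longrightarrow> P - {n} \<subseteq> L \<longrightarrow>
      (\<forall>F\<in>schreier s (s \<xi> j). sum (ra1 (osuc (pred_at \<xi> n)) P) F \<le> 4 / real n)"
    \<comment> \<open>Only finitely many \<open>j\<close> lie below \<open>n\<close>, so one set
      works for all of them.\<close>
    proof (rule dense_finite)
      fix j N' assume j: "j \<in> {1..<n}" and N': "N' \<in> infsets M"
      have "s \<xi> j < s \<xi> n" using mono j by (auto simp: strict_mono_on_def)
      then have "s \<xi> j \<le> pred_at \<xi> n"
        using osuc_pred_at_limit[OF lim n1] by (simp add: less_osuc_iff[symmetric])
      then have "\<exists>L\<in>infsets N'. \<forall>P\<in>infsets {1..}. P - {Inf P} \<subseteq> L \<longrightarrow>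
        (\<forall>F\<in>schreier s (s \<xi> j). sum (ra1 (osuc (pred_at \<xi> n)) P) F \<le> 1 / real n + 3 / real (Inf P))"
        using IH[OF pred_at_less[OF ne n1]] infsets_mono[OF N' M] n1
        by (intro first_average_small) auto
      then obtain L where L: "L \<in> infsets N'" "\<forall>P\<in>infsets {1..}. P - {Inf P} \<subseteq> L \<longrightarrow>
        (\<forall>F\<in>schreier s (s \<xi> j). sum (ra1 (osuc (pred_at \<xi> n)) P) F \<le> 1 / real n + 3 / real (Inf P))"
        by blast
      have "sum (ra1 (osuc (pred_at \<xi> n)) P) F \<le> 4 / real n"
        if "P \<in> infsets {1..}" "Inf P = n" "P - {n} \<subseteq> L" "F \<in> schreier s (s \<xi> j)" for P F
      proof -
        have "sum (ra1 (osuc (pred_at \<xi> n)) P) F \<le> 1 / real n + 3 / real n"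
          using L(2) that by blast
        then show ?thesis by (simp add: add_divide_distrib[symmetric])
      qed
      then show "\<exists>L\<in>infsets N'. \<forall>P\<in>infsets {1..}. Inf P = n \<longrightarrow> P - {n} \<subseteq> L \<longrightarrow>
        (\<forall>F\<in>schreier s (s \<xi> j). sum (ra1 (osuc (pred_at \<xi> n)) P) F \<le> 4 / real n)"
        using L(1) by blast
    qed (use N in \<open>unfold infsets_def, blast+\<close>)
  next
    show "infinite M" using M by (simp add: infsets_def)
  qed (unfold infsets_def, blast)
  then obtain L0 where L0: "L0 \<in> infsets M"
    and small': "\<forall>n\<in>L0. \<forall>j\<in>{1..<n}. \<forall>P\<in>infsets {1..}. Inf P = n \<longrightarrow> P - {n} \<subseteq> {l\<in>L0. n < l} \<longrightarrow>
      (\<forall>F\<in>schreier s (s \<xi> j). sum (ra1 (osuc (pred_at \<xi> n)) P) F \<le> 4 / real n)"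
    by (elim bexE)
  have small: "sum (ra1 (osuc (pred_at \<xi> (Inf P))) P) F \<le> 4 / real (Inf P)"
    if "Inf P \<in> L0" "j \<in> {1..<Inf P}" "P \<in> infsets {1..}" "P - {Inf P} \<subseteq> {l\<in>L0. Inf P < l}"
      "F \<in> schreier s (s \<xi> j)" for P F j
    using small'[rule_format, OF that(1,2,3) refl] that(4,5) by blast
  \<comment> \<open>The cut at 8 makes the final bound \<open>8 / real (Inf R)\<close> at most
    1.\<close>
  have gt8: "{l\<in>L0. 8 < l} \<in> infsets L0" using L0 by (intro infsets_greater) (simp add: infsets_def)
  obtain L where L: "L \<in> infsets {l\<in>L0. 8 < l}"
    and sparse: "\<And>a b. a \<in> L \<Longrightarrow> b \<in> L \<Longrightarrow> a < b \<Longrightarrow> 2 * a \<le> b"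
    using sparse_subset[of "{l\<in>L0. 8 < l}" "\<lambda>a. 2 * a"] gt8 by (auto simp: infsets_def)
  have LL0: "L \<in> infsets L0" using L gt8 by (rule infsets_mono)
  then
 have LM: "L \<in> infsets M" using L0 by (rule infsets_mono)
  then have L1: "L \<in> infsets {1..}" using M by (rule infsets_mono)
  \<comment> \<open>The induction splits off the first average and uses
    \<open>4 / n + 8 / (2 * n) = 8 / n\<close>.\<close>
  have "(\<Sum>k<K. sum (ra1 \<xi> (ra_tail \<xi> R k)) F) \<le> 8 / real (Inf R)"
    if "R \<in> infsets L" "j \<ge> 1" "F \<in> schreier s (s \<xi> j)" "j < Inf R" for R F j K
    using that(1,4)
  proof (induction K arbitrary: R)
    case (Suc K)
    have R1: "R \<in> infsets {1..}" using Suc.prems(1) L1 by (rule infsets_mono)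
    have Inf: "Inf R \<in> R" using R1 by (rule Inf_in_infsets)
    let ?R = "R - supp (ra1 \<xi> R)"
    have RR: "?R \<in> infsets R" using ra_tail_infsets[OF R1, of \<xi> 1] by simp
    have R'1: "?R \<in> infsets {1..}" using RR R1 by (rule infsets_mono)
    have R'L: "?R \<in> infsets L" using RR Suc.prems(1) by (rule infsets_mono)
    have Inf': "Inf ?R \<in> ?R" using R'1 by (rule Inf_in_infsets)
    have less: "Inf R < Inf ?R"
      using ra1_supp_initial[OF R1 Inf_in_supp_ra1[OF R1]] Inf' by blast
    have two: "2 * Inf R \<le> Inf ?R"
      using sparse[OF _ _ less] Inf Inf' Suc.prems(1) by (auto simp: infsets_def)
    have "Inf R < l" if "l \<in> R - {Inf R}" for l using that Inf_le[of l R] by auto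
    then have "R - {Inf R} \<subseteq> {l\<in>L0. Inf R < l}" using Suc.prems(1) LL0 by (auto simp: infsets_def)
    moreover have "Inf R \<in> L0" using Inf Suc.prems(1) LL0 by (auto simp: infsets_def)
    ultimately have "sum (ra1 \<xi> R) F \<le> 4 / real (Inf R)"
      unfolding ra1_pred_at[OF ne R1] using that(2,3) Suc.prems(2) R1 by (intro small[of R j]) auto
    moreover have "(\<Sum>k<K. sum (ra1 \<xi> (ra_tail \<xi> ?R k)) F) \<le> 8 / real (Inf ?R)"
      using less Suc.prems(2) by (intro Suc.IH R'L) simp
    moreover have "8 / real (Inf ?R) \<le> 8 / (2 * real (Inf R))"
      using two Inf_ge_1[OF R1] by (intro divide_left_mono) auto
    moreover have "(\<Sum>k<Suc K. sum (ra1 \<xi> (ra_tail \<xi> R k)) F) =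
        sum (ra1 \<xi> R) F + (\<Sum>k<K. sum (ra1 \<xi> (ra_tail \<xi> ?R k)) F)"
      by (subst sum.lessThan_Suc_shift) simp
    moreover have "8 / (2 * real (Inf R)) = 4 / real (Inf R)" "8 / real (Inf R) = 4 / real (Inf R) + 4 / real (Inf R)"
      by simp_all
    ultimately show ?case by linarith
  qed simp
  note sum8 = this
  have "8 / real (Inf R) \<le> 1" if "R \<in> infsets L" for R
  proof -
    have "Inf R \<in> {l\<in>L0. 8 < l}"
      using Inf_in_infsets[OF infsets_mono[OF that L1]] that L by (auto simp: infsets_def)
    then show ?thesis by simp
  qed
  moreover have "\<exists>j\<ge>1. F \<in> schreier s (s \<xi> j) \<and> j \<le> q" if "F \<in> schreier s \<xi>" "q \<in> F" for F q
    using that unfolding schreier_limit_eq[OF lim] by blast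
  ultimately have "(\<Sum>k<K. sum (ra1 \<xi> (ra_tail \<xi> R k)) F) \<le> 1"
    if R: "R \<in> infsets L" and "F \<in> schreier s \<xi>" "q \<in> F" "q < Inf R" for R F q K
    using sum8[OF R, of _ F K] that by (meson order_trans order_le_less_trans)
  then show "\<exists>L\<in>infsets M. \<forall>R\<in>infsets L. \<forall>F\<in>schreier s \<xi>. \<forall>q\<in>F \<inter> L.
    q < Inf R \<longrightarrow> (\<forall>K. (\<Sum>k<K. sum (ra1 \<xi> (ra_tail \<xi> R k)) F) \<le> 1)"
    using LM by blast
qed

lemma lower_small_total_bounded: "lower_small \<xi> \<and> total_bounded \<xi>"
proof (induction \<xi> rule: less_induct)
  case (less \<xi>)
  show ?case
  proof (cases \<xi> rule: omega1_cases)
    case 1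
    have "\<not> \<zeta> < 0" for \<zeta> :: omega1 by (simp add: not_less)
    then show ?thesis using total_bounded_zero by (simp add: lower_small_def 1)
  next
    case (2 \<zeta>)
    then show ?thesis
      using lower_small_step[OF _ less] total_bounded_osuc[of \<zeta>] less[of \<zeta>] less_osuc[of \<zeta>] by simp
  next
    case 3
    then show ?thesis using lower_small_step[OF _ less] total_bounded_limit[OF 3 less]
      by (simp add: is_limit_def)
  qed
qed

lemma ra1_small_on_lower:
  assumes "\<zeta> < \<xi>" "M \<in> infsets {1..}" "\<epsilon> > 0"
  obtains L where "L \<in> infsets M" "\<And>P F. P \<in> infsets L \<Longrightarrow> F \<in> schreier s \<zeta> \<Longrightarrow> sum (ra1 \<xi> P) F \<le> \<epsilon>"
  using lower_small_total_bounded[of \<xi>] assms unfolding lower_small_def by blast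

end

section \<open>Large families contain Schreier families\<close>

lemma enum1_strict_mono: "infinite M \<Longrightarrow> 1 \<le> i \<Longrightarrow> i < j \<Longrightarrow> enum1 M i < enum1 M j"
  by (simp add: enum1_def)

lemma enum1_less_iff: "infinite M \<Longrightarrow> 1 \<le> i \<Longrightarrow> 1 \<le> j \<Longrightarrow> enum1 M i < enum1 M j \<longleftrightarrow> i < j"
  using enum1_strict_mono[of M i j] enum1_strict_mono[of M j i] by (metis linorder_neqE_nat order_less_asym)

lemma enum1_in: "infinite M \<Longrightarrow> enum1 M i \<in> M"
  by (simp add: enum1_def enumerate_in_set)

lemma enum1_surj: "infinite M \<Longrightarrow> p \<in> M \<Longrightarrow> \<exists>i\<ge>1. enum1 M i = p"
proof -
  assume "infinite M" "p \<in> M"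
  then obtain n where "enumerate M n = p" using enumerate_Ex by blast
  then have "enum1 M (Suc n) = p" by (simp add: enum1_def)
  then show ?thesis by (intro exI[of _ "Suc n"]) simp
qed

lemma strict_mono_from_1_ge:
  fixes g :: "nat \<Rightarrow> nat"
  assumes "\<And>i j. 1 \<le> i \<Longrightarrow> i < j \<Longrightarrow> g i < g j" "1 \<le> g 1" "1 \<le> i"
  shows "i \<le> g i"
  using assms(3)
proof (induction i rule: dec_induct)
  case (step n)
  then show ?case using assms(1)[of n "Suc n"] by simp
qed (use assms(2) in simp)

lemma enum1_ge:
  assumes "M \<in> infsets {1..}" "1 \<le> i"
  shows "i \<le> enum1 M i"
proof (rule strict_mono_from_1_ge[OF _ _ assms(2)])
  have M: "infinite M" "M \<subseteq> {1..}" using assms(1) by (auto simp: infsets_def)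
  show "enum1 M i < enum1 M j" if "1 \<le> i" "i < j" for i j using M(1) that by (rule enum1_strict_mono)
  show "1 \<le> enum1 M 1" using enum1_in[OF M(1), of 1] M(2) by auto
qed

lemma enum1_remove_Inf:
  assumes "infinite M" "1 \<le> i"
  shows "enum1 (M - {Inf M}) i = enum1 M (Suc i)"
proof -
  obtain j where "i = Suc j" using assms(2) by (cases i) auto
  moreover have "Inf M = (LEAST n. n \<in> M)" by (simp add: Inf_nat_def)
  ultimately show ?thesis by (simp add: enum1_def enumerate_Suc)
qed

text \<open>Writes the enumeration of \<open>N\<close> as that of \<open>M\<close> after a spread
  \<open>g\<close>, the form in which \<open>schreier_spread\<close> applies.\<close>

lemma enum1_subset:
  assumes "infinite M" "N \<in> infsets M"
  obtains g where "strict_mono_on {1..} g" "\<And>i. 1 \<le> i \<Longrightarrow> i \<le> g i"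
    "\<And>i. 1 \<le> i \<Longrightarrow> enum1 N i = enum1 M (g i)"
proof -
  have N: "infinite N" "N \<subseteq> M" using assms(2) by (auto simp: infsets_def)
  have "\<forall>i. \<exists>j\<ge>1. enum1 M j = enum1 N i"
    using enum1_surj[OF assms(1)] enum1_in[OF N(1)] N(2) by (meson subsetD)
  then obtain g where g: "\<And>i. 1 \<le> g i" "\<And>i. enum1 M (g i) = enum1 N i" by metis
  have mono: "g i < g j" if "1 \<le> i" "i < j" for i j
    using enum1_strict_mono[OF N(1) that] enum1_less_iff[OF assms(1) g(1) g(1)] g(2) by simp
  show ?thesis
  proof (rule that[of g])
    show "strict_mono_on {1..} g" using mono by (simp add: strict_mono_on_def)
    show "i \<le> g i" if "1 \<le> i" for i by (rule strict_mono_from_1_ge[OF mono g(1) that])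
    show "enum1 N i = enum1 M (g i)" for i by (simp add: g(2))
  qed
qed

context fundamental_system
begin

lemma strict_mono_on_enum1: "infinite M \<Longrightarrow> A \<in> schreier s \<xi> \<Longrightarrow> strict_mono_on A (enum1 M)"
  using schreier_pos by (auto simp: strict_mono_on_def enum1_strict_mono)

text \<open>Treats successors and limits alike: the number of pieces and the parameter of
  \<open>pred_at\<close> are both bounded by any chosen element \<open>q\<close>. At a successor
  \<open>pred_at\<close> is constant in \<open>n\<close>, and 1 is taken.\<close>

lemma schreier_sblocks:
  assumes "\<xi> \<noteq> 0" "F \<in> schreier s \<xi>" "q \<in> F"
  shows "\<exists>n m. 1 \<le> n \<and> n \<le> q \<and> m \<le> q \<and> F \<in> sblocks (schreier s (pred_at \<xi> n)) m"
proof (cases \<xi> rule: omega1_cases)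
  case (2 \<zeta>)
  then obtain m where "F \<in> sblocks (schreier s \<zeta>) m" "\<forall>a\<in>F. m \<le> a"
    using assms(2) unfolding 2 schreier_osuc_eq by blast
  then show ?thesis using assms(3) schreier_pos[OF assms(2,3)] 2 by (intro exI[of _ 1] exI[of _ m]) auto
next
  case 3
  then obtain n where n: "n \<ge> 1" "\<forall>a\<in>F. n \<le> a" "F \<in> schreier s (s \<xi> n)"
    using assms(2,3) unfolding schreier_limit_eq[OF 3] by blast
  then obtain m where "F \<in> sblocks (schreier s (pred_at \<xi> n)) m" "\<forall>a\<in>F. m \<le> a"
    unfolding osuc_pred_at_limit[OF 3 n(1), symmetric] schreier_osuc_eq by blast
  then show ?thesis using assms(3) n by blast
qed (use assms in simp)

text \<open>The pieces may overlap, since only masses are added; mere inclusion in the union makes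
  heredity immediate, as the dichotomy requires.\<close>

definition nfold :: "nat \<Rightarrow> omega1 \<Rightarrow> nat set set"
  where "nfold n \<zeta> = {A. \<exists>G. (\<forall>i<n. G i \<in> schreier s \<zeta>) \<and> A \<subseteq> (\<Union>i<n. G i)}"

lemma nfoldI: "(\<And>i. i < n \<Longrightarrow> G i \<in> schreier s \<zeta>) \<Longrightarrow> A \<subseteq> (\<Union>i<n. G i) \<Longrightarrow> A \<in> nfold n \<zeta>"
  unfolding nfold_def by (intro CollectI exI[of _ G]) simp

lemma nfold_mono: "A \<in> nfold m \<zeta> \<Longrightarrow> m \<le> n \<Longrightarrow> A \<in> nfold n \<zeta>"
proof -
  assume "A \<in> nfold m \<zeta>" "m \<le> n"
  then obtain G where G: "\<And>i. i < m \<Longrightarrow> G i \<in> schreier s \<zeta>" "A \<subseteq> (\<Union>i<m. G i)"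
    unfolding nfold_def by blast
  let ?G = "\<lambda>i. if i < m then G i else {}"
  have "(\<Union>i<m. G i) \<subseteq> (\<Union>i<n. ?G i)" using \<open>m \<le> n\<close> by fastforce
  then have "A \<subseteq> (\<Union>i<n. ?G i)" using G(2) by (rule order_trans[rotated])
  then show "A \<in> nfold n \<zeta>" by (intro nfoldI[of n ?G]) (use G(1) schreier_empty in simp_all)
qed

lemma sblocks_nfold: "A \<in> sblocks (schreier s \<zeta>) n \<Longrightarrow> A \<in> nfold n \<zeta>"
proof (induction n arbitrary: A)
  case (Suc n)
  then obtain A1 A2 where A: "A = A1 \<union> A2" "A1 \<in> schreier s \<zeta>" "A2 \<in> sblocks (schreier s \<zeta>) n"
    by auto
  obtain G where G: "\<forall>i<n. G i \<in> schreier s \<zeta>" "A2 \<subseteq> (\<Union>i<n. G i)"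
    using Suc.IH[OF A(3)] unfolding nfold_def by blast
  let ?G = "\<lambda>i. if i < n then G i else A1"
  have "(\<Union>i<Suc n. ?G i) = A1 \<union> (\<Union>i<n. G i)"
    by (auto simp: less_Suc_eq split: if_splits)
  then have "A \<subseteq> (\<Union>i<Suc n. ?G i)" using G(2) A(1) by auto
  then show ?case by (intro nfoldI[of "Suc n" ?G]) (use G(1) A(2) in simp_all)

qed (simp add: nfold_def)

lemma nfold_finite: "A \<in> nfold n \<zeta> \<Longrightarrow> finite A"
proof -
  assume "A \<in> nfold n \<zeta>"
  then obtain G where G: "\<forall>i<n. G i \<in> schreier s \<zeta>" "A \<subseteq> (\<Union>i<n. G i)"
    unfolding nfold_def by blast
  have "finite (\<Union>i<n. G i)" using G(1) schreier_finite by blast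
  then show ?thesis using G(2) by (rule finite_subset[rotated])
qed

lemma nfold_hereditary: "A \<in> nfold n \<zeta> \<Longrightarrow> B \<subseteq> A \<Longrightarrow> B \<in> nfold n \<zeta>"
  unfolding nfold_def by (blast intro: order_trans)

lemma sum_ra1_nfold_le:
  assumes "A \<in> nfold n \<zeta>" "P \<in> infsets {1..}" "\<And>F. F \<in> schreier s \<zeta> \<Longrightarrow> sum (ra1 \<xi> P) F \<le> \<epsilon>"
  shows "sum (ra1 \<xi> P) A \<le> real n * \<epsilon>"
proof -
  obtain G where G: "\<And>i. i < n \<Longrightarrow> G i \<in> schreier s \<zeta>" "A \<subseteq> (\<Union>i<n. G i)"
    using assms(1) unfolding nfold_def by blast
  have fin: "finite (G i)" if "i < n" for i using schreier_finite G(1) that by blast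
  have "sum (ra1 \<xi> P) (\<Union>i<k. G i) \<le> real k * \<epsilon>" if "k \<le> n" for k
    using that
  proof (induction k)
    case (Suc k)
    have "sum (ra1 \<xi> P) (\<Union>i<Suc k. G i) \<le> sum (ra1 \<xi> P) (G k) + sum (ra1 \<xi> P) (\<Union>i<k. G i)"
      unfolding lessThan_Suc UN_insert using Suc.prems fin ra1_nonneg[OF assms(2)]
      by (intro sum_Un_le) auto
    also have "\<dots> \<le> \<epsilon> + real k * \<epsilon>" using Suc G(1)[of k] by (intro add_mono assms(3)) auto
    finally show ?case by (simp add: algebra_simps)
  qed simp
  moreover have "sum (ra1 \<xi> P) A \<le> sum (ra1 \<xi> P) (\<Union>i<n. G i)"
    using G(2) fin by (intro sum_mono2 ra1_nonneg assms(2)) auto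
  ultimately show ?thesis using order_trans by blast
qed

definition large :: "omega1 \<Rightarrow> nat set \<Rightarrow> real \<Rightarrow> nat set set \<Rightarrow> bool"
  where "large \<xi> M \<epsilon> \<G> \<longleftrightarrow> (\<forall>P\<in>infsets M. \<exists>G\<in>\<G>. \<epsilon> \<le> sum (ra1 \<xi> P) G)"

text \<open>In the other alternative of the dichotomy, the members of \<open>\<G>\<close> inside
  \<open>L\<close> are covered by \<open>n\<close> sets of index \<zeta>. On a \<open>P\<close>
  where each of these has mass at most \<open>\<epsilon> / (2 * real (Suc n))\<close>, no such
  member reaches mass \<epsilon>, against largeness.\<close>

lemma large_contains_nfold:
  assumes G: "\<And>A B. A \<in> \<G> \<Longrightarrow> B \<subseteq> A \<Longrightarrow> B \<in> \<G>" "\<And>A. A \<in> \<G> \<Longrightarrow> finite A"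
    and M: "M \<in> infsets {1..}" and lg: "large \<xi> M \<epsilon> \<G>" and \<epsilon>: "\<epsilon> > 0" and "\<zeta> < \<xi>"
    and N: "N \<in> infsets M"
  shows "\<exists>L\<in>infsets N. \<forall>A\<in>nfold n \<zeta>. A \<subseteq> L \<longrightarrow> A \<in> \<G>"
proof -
  have "infinite N" using N by (simp add: infsets_def)
  then have "\<exists>L\<in>infsets N. (\<forall>A\<in>nfold n \<zeta>. A \<subseteq> L \<longrightarrow> A \<in> \<G>) \<or> (\<forall>A\<in>\<G>. A \<subseteq> L \<longrightarrow> A \<in> nfold n \<zeta>)"
  proof (rule gasparis_dichotomy[rotated 4])
    show "B \<in> nfold n \<zeta>" if "A \<in> nfold n \<zeta>" "B \<subseteq> A" for A B using that by (rule nfold_hereditary)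
    show "finite A" if "A \<in> nfold n \<zeta>" for A using that by (rule nfold_finite)
  qed (fact G)+
  then obtain L where L: "L \<in> infsets N"
    "(\<forall>A\<in>nfold n \<zeta>. A \<subseteq> L \<longrightarrow> A \<in> \<G>) \<or> (\<forall>A\<in>\<G>. A \<subseteq> L \<longrightarrow> A \<in> nfold n \<zeta>)"
    by (elim bexE)
  have LM: "L \<in> infsets M" using L(1) N by (rule infsets_mono)
  have "\<not> (\<forall>A\<in>\<G>. A \<subseteq> L \<longrightarrow> A \<in> nfold n \<zeta>)"
  proof
    assume *: "\<forall>A\<in>\<G>. A \<subseteq> L \<longrightarrow> A \<in> nfold n \<zeta>"
    obtain P where P: "P \<in> infsets L"
      "\<And>R F. R \<in> infsets P \<Longrightarrow> F \<in> schreier s \<zeta> \<Longrightarrow> sum (ra1 \<xi> R) F \<le> \<epsilon> / (2 * real (Suc n))"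
      using ra1_small_on_lower[OF \<open>\<zeta> < \<xi>\<close> infsets_mono[OF LM M], of "\<epsilon> / (2 * real (Suc n))"] \<epsilon> by auto
    have PM: "P \<in> infsets M" using P(1) LM by (rule infsets_mono)
    have P1: "P \<in> infsets {1..}" using PM M by (rule infsets_mono)
    obtain A where A: "A \<in> \<G>" "\<epsilon> \<le> sum (ra1 \<xi> P) A" using lg PM unfolding large_def by blast
    \<comment> \<open>A member of \<open>\<G>\<close> need not lie in \<open>L\<close>; cutting it
      down to the support moves it into \<open>L\<close> and keeps its mass.\<close>
    have "sum (ra1 \<xi> P) A = sum (ra1 \<xi> P) (A \<inter> supp (ra1 \<xi> P))"
      using G(2)[OF A(1)] by (rule sum_ra1_Int)
    also have "\<dots> \<le> real n * (\<epsilon> / (2 * real (Suc n)))"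
    proof (rule sum_ra1_nfold_le[OF _ P1])
      have "A \<inter> supp (ra1 \<xi> P) \<in> \<G>" using G(1)[OF A(1)] by simp
      moreover have "A \<inter> supp (ra1 \<xi> P) \<subseteq> L"
        using ra1_supp_subset[OF P1] P(1) by (auto simp: infsets_def)
      ultimately show "A \<inter> supp (ra1 \<xi> P) \<in> nfold n \<zeta>" using * by blast
      show "sum (ra1 \<xi> P) F \<le> \<epsilon> / (2 * real (Suc n))" if "F \<in> schreier s \<zeta>" for F
        using P(2) infsets_refl P1 that by (simp add: infsets_def)
    qed
    also have "\<dots> < \<epsilon>"
    proof -
      have "real n * \<epsilon> < \<epsilon> * (2 * real (Suc n))" using \<epsilon> by (simp add: algebra_simps add_nonneg_pos)
      then show ?thesis by (simp add: divide_less_eq)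
    qed
    finally show False using A(2) by simp
  qed
  then show ?thesis using L by blast
qed

text \<open>On a diagonal set \<open>L\<close>, everything covered by \<open>l\<close> sets of index
  \<open>pred_at \<xi> n\<close> with \<open>n \<le> l\<close> and lying in \<open>L\<close> beyond
  its point \<open>l\<close> is in \<open>\<G>\<close>. A member of \<open>schreier s \<xi>\<close>
  with minimum \<open>q\<close> has at most \<open>q\<close> pieces, so its image belongs to
  \<open>\<G>\<close> as soon as it lies beyond the \<open>q\<close>-th element of \<open>L\<close>,
  which is at least \<open>q\<close>.\<close>

theorem large_contains_schreier:
  assumes G: "\<And>A B. A \<in> \<G> \<Longrightarrow> B \<subseteq> A \<Longrightarrow> B \<in> \<G>" "\<And>A. A \<in> \<G> \<Longrightarrow> finite A"
    and M: "M \<in> infsets {1..}" and lg: "large \<xi> M \<epsilon> \<G>" and \<epsilon>: "\<epsilon> > 0"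
  shows "\<exists>L\<in>infsets M. \<forall>F\<in>schreier s \<xi>. enum1 L ` F \<in> \<G>"
proof (cases "\<xi> = 0")
  case True
  have Minf: "infinite M" using M by (simp add: infsets_def)
  have single: "{p} \<in> \<G>" if "p \<in> M" for p
  proof -
    \<comment> \<open>The minimum of this set is \<open>p\<close>, so its first average of index 0
      is the point mass at \<open>p\<close>.\<close>
    let ?P = "insert p {l\<in>M. p < l}"
    have P: "?P \<in> infsets M" using infsets_greater[OF Minf, of p] that by (auto simp: infsets_def)
    have P1: "?P \<in> infsets {1..}" using P M by (rule infsets_mono)
    have "Inf ?P = p" by (intro antisym Inf_le cInf_greatest) auto
    moreover obtain A where "A \<in> \<G>" "\<epsilon> \<le> sum (ra1 0 ?P) A"
      using lg P unfolding large_def True by blast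
    ultimately have "p \<in> A" using \<epsilon> G(2)[of A] by (auto simp: ra1_zero[OF P1] split: if_splits)
    then show ?thesis using G(1)[OF \<open>A \<in> \<G>\<close>, of "{p}"] by simp
  qed
  have "{} \<in> \<G>" using single[OF Inf_mem[OF Minf]] G(1) by blast
  then have "\<forall>F\<in>schreier s \<xi>. enum1 M ` F \<in> \<G>"
    using single enum1_in[OF Minf] by (auto simp: True schreier_zero)
  then show ?thesis using infsets_refl[OF Minf] by blast
next
  case False
  have Minf: "infinite M" using M by (simp add: infsets_def)
  have "\<exists>L\<in>infsets M. \<forall>l\<in>L. \<forall>n\<in>{1..l}. \<forall>A\<in>nfold l (pred_at \<xi> n). A \<subseteq> {x\<in>L. l < x} \<longrightarrow> A \<in> \<G>"
  proof (rule diagonal_nat)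
    fix l N assume N: "N \<in> infsets M"
    show "\<exists>L\<in>infsets N. \<forall>n\<in>{1..l}. \<forall>A\<in>nfold l (pred_at \<xi> n). A \<subseteq> L \<longrightarrow> A \<in> \<G>"
    proof (rule dense_finite)
      fix n N' assume n: "n \<in> {1..l}" "N' \<in> infsets M"
      have "pred_at \<xi> n < \<xi>" using pred_at_less[OF False] n(1) by simp
      with G M lg \<epsilon> show "\<exists>L\<in>infsets N'. \<forall>A\<in>nfold l (pred_at \<xi> n). A \<subseteq> L \<longrightarrow> A \<in> \<G>"
        using n(2) by (rule large_contains_nfold)
    qed (use N in \<open>unfold infsets_def, blast+\<close>)
  qed (use Minf in \<open>unfold infsets_def, blast+\<close>)
  then obtain L where L: "L \<in> infsets M"
    and cont: "\<forall>l\<in>L. \<forall>n\<in>{1..l}. \<forall>A\<in>nfold l (pred_at \<xi> n). A \<subseteq> {x\<in>L. l < x} \<longrightarrow> A \<in> \<G>"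
    by (elim bexE)
  have L1: "L \<in> infsets {1..}" using L M by (rule infsets_mono)
  have Linf: "infinite L" using L by (simp add: infsets_def)
  \<comment> \<open>Dropping the least element shifts the enumeration by one, so that the image of
    \<open>F\<close> starts strictly beyond \<open>enum1 L (Min F)\<close>.\<close>
  let ?L = "L - {Inf L}"
  have L'M: "?L \<in> infsets M" using L by (auto simp: infsets_def)
  have L'1: "?L \<in> infsets {1..}" using L'M M by (rule infsets_mono)
  have "enum1 ?L ` F \<in> \<G>" if F: "F \<in> schreier s \<xi>" for F
  proof (cases "F = {}")
    case True
    have "{} \<in> nfold 1 (pred_at \<xi> 1)" by (auto simp: nfold_def schreier_empty intro!: exI[of _ "\<lambda>_. {}"])
    then have "{} \<in> nfold (Inf L) (pred_at \<xi> 1)" using Inf_ge_1[OF L1] by (rule nfold_mono)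
    then show ?thesis using cont Inf_mem[OF Linf] Inf_ge_1[OF L1] True by fastforce
  next
    case ne: False
    let ?q = "Min F"
    have q: "?q \<in> F" "\<And>i. i \<in> F \<Longrightarrow> ?q \<le> i" using schreier_finite[OF F] ne by auto
    have q1: "1 \<le> ?q" using schreier_pos[OF F q(1)] .
    obtain n m where nm: "1 \<le> n" "n \<le> ?q" "m \<le> ?q" "F \<in> sblocks (schreier s (pred_at \<xi> n)) m"
      using schreier_sblocks[OF False F q(1)] by blast
    let ?l = "enum1 L ?q"
    have l: "?l \<in> L" "?q \<le> ?l" using enum1_in[OF Linf] enum1_ge[OF L1 q1] by auto
    have "enum1 ?L ` F \<in> sblocks (schreier s (pred_at \<xi> n)) m"
      using schreier_spread nm(4)
    proof (rule sblocks_spread)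
      show "strict_mono_on F (enum1 ?L)" using L'1 F by (intro strict_mono_on_enum1) (auto simp: infsets_def)
      show "a \<le> enum1 ?L a" if "a \<in> F" for a using enum1_ge[OF L'1] schreier_pos[OF F that] .
    qed
    then have "enum1 ?L ` F \<in> nfold ?l (pred_at \<xi> n)"
      using order_trans[OF nm(3) l(2)] by (rule nfold_mono[OF sblocks_nfold])
    moreover have "enum1 ?L ` F \<subseteq> {x\<in>L. ?l < x}"
    proof
      fix x assume "x \<in> enum1 ?L ` F"
      then obtain i where i: "i \<in> F" "x = enum1 ?L i" by blast
      then have "x = enum1 L (Suc i)" using enum1_remove_Inf[OF Linf] schreier_pos[OF F i(1)] by simp
      then show "x \<in> {x\<in>L. ?l < x}"
        using q(2)[OF i(1)] q1 enum1_in[OF Linf] enum1_strict_mono[OF Linf, of ?q "Suc i"] by simp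
    qed
    moreover have "n \<in> {1..?l}" using nm(1,2) l(2) by simp
    ultimately show ?thesis using cont l(1) by blast
  qed
  then show ?thesis using L'M by blast
qed

end

section \<open>Averages almost supported on Schreier sets\<close>

context fundamental_system
begin

text \<open>The enumeration is that of the fixed set \<open>M\<close> carrying the spreading model,
  while \<open>L\<close> is sought in an arbitrary \<open>N\<close>; the diagonalization needs this
  freedom.\<close>

definition near_full :: "omega1 \<Rightarrow> bool"
  where "near_full \<xi> \<longleftrightarrow> (\<forall>M\<in>infsets {1..}. \<forall>N\<in>infsets M. \<forall>\<delta>>0. \<exists>L\<in>infsets N. \<forall>P\<in>infsets L.
    \<exists>F\<in>schreier s \<xi>. 1 - \<delta> \<le> sum (ra1 \<xi> P) (enum1 M ` F))"

text \<open>The first of the \<open>Inf P\<close> averages is given up at the cost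
  \<open>1 / real (Inf P)\<close>: it contains \<open>Inf P\<close>, whose index in \<open>M\<close>
  may be small. The other \<open>Inf P - 1\<close> averages yield successive pieces with indices at
  least \<open>Inf P\<close>, so their union is admissible.\<close>

lemma first_average_near_full:
  assumes A: "near_full \<theta>" and M: "M \<in> infsets {1..}" and N: "N \<in> infsets M" and \<delta>: "\<delta> > 0"
  shows "\<exists>L\<in>infsets N. \<forall>P\<in>infsets M. P - {Inf P} \<subseteq> L \<longrightarrow>
    (\<forall>i\<ge>1. enum1 M i \<in> P - {Inf P} \<longrightarrow> Inf P \<le> i) \<longrightarrow>
    (\<exists>F\<in>schreier s (osuc \<theta>). (\<forall>i\<in>F. Inf P \<le> i) \<and>
      1 - \<delta> - 1 / real (Inf P) \<le> sum (ra1 (osuc \<theta>) P) (enum1 M ` F))"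
proof -
  from A[unfolded near_full_def, rule_format, OF M N \<delta>]
  obtain L where L: "L \<in> infsets N"
    and full: "\<forall>P\<in>infsets L. \<exists>F\<in>schreier s \<theta>. 1 - \<delta> \<le> sum (ra1 \<theta> P) (enum1 M ` F)"
    by (elim bexE)
  have LM: "L \<in> infsets M" using L N by (rule infsets_mono)
  have L1: "L \<in> infsets {1..}" using LM M by (rule infsets_mono)
  have Minf: "infinite M" using M by (simp add: infsets_def)
  have "\<exists>F\<in>schreier s (osuc \<theta>). (\<forall>i\<in>F. Inf P \<le> i) \<and>
      1 - \<delta> - 1 / real (Inf P) \<le> sum (ra1 (osuc \<theta>) P) (enum1 M ` F)"
    if PM: "P \<in> infsets M" and PL: "P - {Inf P} \<subseteq> L"
      and idx: "\<And>i. 1 \<le> i \<Longrightarrow> enum1 M i \<in> P - {Inf P} \<Longrightarrow> Inf P \<le> i" for P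
  proof -
    have P1: "P \<in> infsets {1..}" using PM M by (rule infsets_mono)
    obtain p where p: "Inf P = Suc p" using Inf_ge_1[OF P1] by (cases "Inf P") auto
    define Q where "Q k = ra_tail \<theta> P (Suc k)" for k
    have T1: "ra_tail \<theta> P k \<in> infsets {1..}" for k using ra_tail_infsets[OF P1] P1 by (rule infsets_mono)
    have Q_eq: "Q k = ra_tail \<theta> (ra_tail \<theta> P 1) k" for k by (simp add: Q_def)
    have R: "ra_tail \<theta> P 1 \<in> infsets L" using P1 PL by (rule ra_tail_1_infsets)
    have QL: "Q k \<in> infsets L" for k unfolding Q_eq using R L1 by (rule ra_tail_infsets_trans)
    have Q1: "Q k \<in> infsets {1..}" for k using QL L1 by (rule infsets_mono)
    have "Inf P \<notin> ra_tail \<theta> P 1" using Inf_in_supp_ra1[OF P1] by simp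
    moreover have QR: "Q k \<subseteq> ra_tail \<theta> P 1" for k
      unfolding Q_eq using ra_tail_infsets[OF infsets_mono[OF R L1], of \<theta> k] by (simp add: infsets_def)
    moreover have "ra_tail \<theta> P 1 \<subseteq> P" by auto
    ultimately have QP: "Q k \<subseteq> P - {Inf P}" for k by blast
    have "\<exists>F. F \<in> schreier s \<theta> \<and> enum1 M ` F \<subseteq> supp (ra1 \<theta> (Q k)) \<and>
        1 - \<delta> \<le> sum (ra1 \<theta> (Q k)) (enum1 M ` F)" for k
    proof -
      obtain F where F: "F \<in> schreier s \<theta>" "1 - \<delta> \<le> sum (ra1 \<theta> (Q k)) (enum1 M ` F)"
        using full QL by blast
      \<comment> \<open>Indices of points off the support are removed, so that the pieces for
        different \<open>k\<close> become successive.\<close>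
      let ?F = "{i\<in>F. enum1 M i \<in> supp (ra1 \<theta> (Q k))}"
      have "sum (ra1 \<theta> (Q k)) (enum1 M ` F) = sum (ra1 \<theta> (Q k)) (enum1 M ` F \<inter> supp (ra1 \<theta> (Q k)))"
        using schreier_finite[OF F(1)] by (intro sum_ra1_Int) simp
      also have "enum1 M ` F \<inter> supp (ra1 \<theta> (Q k)) = enum1 M ` ?F" by auto
      finally show ?thesis using F schreier_hereditary[OF F(1), of ?F] by (intro exI[of _ ?F]) auto
    qed
    then have "\<exists>F. \<forall>k. F k \<in> schreier s \<theta> \<and> enum1 M ` F k \<subseteq> supp (ra1 \<theta> (Q k)) \<and>
        1 - \<delta> \<le> sum (ra1 \<theta> (Q k)) (enum1 M ` F k)" by (intro choice allI)
    then obtain F where F: "\<And>k. F k \<in> schreier s \<theta>"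
      and F_supp: "\<And>k i. i \<in> F k \<Longrightarrow> enum1 M i \<in> supp (ra1 \<theta> (Q k))"
      and F_sum: "\<And>k. 1 - \<delta> \<le> sum (ra1 \<theta> (Q k)) (enum1 M ` F k)" by blast
    have less: "i < j" if "k < l" "i \<in> F k" "j \<in> F l" for i j k l
    proof -
      obtain d where d: "l = Suc k + d" using \<open>k < l\<close> less_iff_Suc_add by auto
      have "Q l = ra_tail \<theta> (Q k - supp (ra1 \<theta> (Q k))) d"
      proof -
        have "Q l = ra_tail \<theta> (Q k) (Suc d)" unfolding Q_def rest_add[symmetric] d by simp
        then show ?thesis by simp
      qed
      also have "\<dots> \<subseteq> Q k - supp (ra1 \<theta> (Q k))"
        using ra_tail_infsets[of "Q k - supp (ra1 \<theta> (Q k))" \<theta> d]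
          infsets_mono[OF infsets_diff_supp[OF Q1] Q1, of k \<theta>] by (simp add: infsets_def ra1_def)
      finally have "enum1 M j \<in> Q k - supp (ra1 \<theta> (Q k))"
        using F_supp[OF that(3)] ra1_supp_subset[OF Q1[of l], of \<theta>] by blast
      then have "enum1 M i < enum1 M j"
        using ra1_supp_initial[OF Q1 F_supp[OF that(2)]] by blast
      then show ?thesis using enum1_less_iff[OF Minf] schreier_pos[OF F] that by blast
    qed
    let ?F = "\<Union>k<p. F k"
    have ge: "Inf P \<le> i" if i: "i \<in> ?F" for i
    proof -
      from i obtain k where k: "i \<in> F k" by blast
      then have "enum1 M i \<in> P - {Inf P}" using F_supp[OF k] ra1_supp_subset[OF Q1[of k], of \<theta>] QP by blast
      then show ?thesis using idx schreier_pos[OF F k] by blast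
    qed
    have "?F \<in> sblocks (schreier s \<theta>) p" using F less by (intro sblocks_UN) blast+
    moreover have "\<forall>i\<in>?F. p \<le> i" using ge p by fastforce
    ultimately have F_in: "?F \<in> schreier s (osuc \<theta>)" unfolding schreier_osuc_eq by blast
    let ?a = "\<lambda>k. sum (ra1 \<theta> (ra_tail \<theta> P k)) (enum1 M ` ?F)"
    have "1 - \<delta> \<le> ?a (Suc k)" if "k < p" for k
    proof -
      have "sum (ra1 \<theta> (Q k)) (enum1 M ` F k) \<le> sum (ra1 \<theta> (Q k)) (enum1 M ` ?F)"
        using that schreier_finite[OF F] by (intro sum_mono2 ra1_nonneg Q1) auto
      then show ?thesis using F_sum[of k] by (simp add: Q_def)
    qed
    then have "(\<Sum>k<p. 1 - \<delta>) \<le> (\<Sum>k<p. ?a (Suc k))" by (intro sum_mono) simp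
    moreover have "0 \<le> ?a 0" using P1 by (simp add: sum_ra1_nonneg)
    moreover have "(\<Sum>k<Suc p. ?a k) = ?a 0 + (\<Sum>k<p. ?a (Suc k))" by (rule sum.lessThan_Suc_shift)
    ultimately have "real p * (1 - \<delta>) \<le> (\<Sum>k<Suc p. ?a k)" by simp
    then have "1 / real (Suc p) * (real p * (1 - \<delta>)) \<le> 1 / real (Suc p) * (\<Sum>k<Suc p. ?a k)"
      by (intro mult_left_mono) simp_all
    moreover have "1 - \<delta> - 1 / real (Suc p) \<le> 1 / real (Suc p) * (real p * (1 - \<delta>))"
      using \<delta> by (simp add: field_simps)
    ultimately have "1 - \<delta> - 1 / real (Inf P) \<le> sum (ra1 (osuc \<theta>) P) (enum1 M ` ?F)"
      unfolding sum_ra1_osuc[OF P1] p by linarith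
    then show ?thesis using F_in ge by blast
  qed
  note concl = this
  show ?thesis
  proof (intro bexI[OF _ L] ballI impI)
    fix P assume "P \<in> infsets M" "P - {Inf P} \<subseteq> L" "\<forall>i\<ge>1. enum1 M i \<in> P - {Inf P} \<longrightarrow> Inf P \<le> i"
    then show "\<exists>F\<in>schreier s (osuc \<theta>). (\<forall>i\<in>F. Inf P \<le> i) \<and>
      1 - \<delta> - 1 / real (Inf P) \<le> sum (ra1 (osuc \<theta>) P) (enum1 M ` F)" using concl by blast
  qed
qed

text \<open>The points of \<open>P\<close> after its minimum \<open>n\<close> are taken beyond
  \<open>enum1 M n\<close>, which forces their indices in \<open>M\<close> above \<open>n\<close>,
  as the admissibility of the union demands.\<close>

lemma near_full: "near_full \<xi>"
proof (induction \<xi> rule: less_induct)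
  case (less \<xi>)
  show ?case
  proof (cases "\<xi> = 0")
    case True
    show ?thesis
      unfolding near_full_def
    proof (intro ballI allI impI)
      fix M N :: "nat set" and \<delta> :: real
      assume M: "M \<in> infsets {1..}" and N: "N \<in> infsets M" and \<delta>: "\<delta> > 0"
      have "\<exists>F\<in>schreier s \<xi>. 1 - \<delta> \<le> sum (ra1 \<xi> P) (enum1 M ` F)" if P: "P \<in> infsets N" for P
      proof -
        have PM: "P \<in> infsets M" using P N by (rule infsets_mono)
        have P1: "P \<in> infsets {1..}" using PM M by (rule infsets_mono)
        have "Inf P \<in> M" using Inf_in_infsets[OF P1] PM by (auto simp: infsets_def)
        moreover have "infinite M" using M by (simp add: infsets_def)
        ultimately obtain i where i: "1 \<le> i" "enum1 M i = Inf P" using enum1_surj by blast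
        then have "{i} \<in> schreier s \<xi>" by (simp add: True schreier_zero)
        moreover have "1 - \<delta> \<le> sum (ra1 \<xi> P) (enum1 M ` {i})"
          using \<delta> i(2) by (simp add: True ra1_zero[OF P1])
        ultimately show ?thesis by blast
      qed
      then show "\<exists>L\<in>infsets N. \<forall>P\<in>infsets L. \<exists>F\<in>schreier s \<xi>. 1 - \<delta> \<le> sum (ra1 \<xi> P) (enum1 M ` F)"
        using N by (intro bexI[of _ N] infsets_refl) (auto simp: infsets_def)
    qed
  next
    case False
    show ?thesis
      unfolding near_full_def
    proof (intro ballI allI impI)
      fix M N :: "nat set" and \<delta> :: real
      assume M: "M \<in> infsets {1..}" and N: "N \<in> infsets M" and \<delta>: "\<delta> > 0"
      have N1: "N \<in> infsets {1..}" using N M by (rule infsets_mono)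
      have Ninf: "infinite N" using N by (simp add: infsets_def)
      have Minf: "infinite M" using M by (simp add: infsets_def)
      have "\<exists>L\<in>infsets N. \<forall>n\<in>L. \<forall>P\<in>infsets M. Inf P = n \<longrightarrow> P - {n} \<subseteq> {l\<in>L. n < l} \<longrightarrow>
        (\<exists>F\<in>schreier s \<xi>. 1 - \<delta> / 2 - 1 / real n \<le> sum (ra1 \<xi> P) (enum1 M ` F))"
      proof (rule diagonal_nat)
        fix n N' assume n: "n \<in> N" and N': "N' \<in> infsets N"
        have n1: "n \<ge> 1" using n N1 by (auto simp: infsets_def)
        let ?N = "{l\<in>N'. enum1 M n < l}"
        have N'N: "?N \<in> infsets N'" using N' by (intro infsets_greater) (simp add: infsets_def)
        have "?N \<in> infsets M" using N'N infsets_mono[OF N' N] by (rule infsets_mono)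
        from first_average_near_full[OF less[OF pred_at_less[OF False n1]] M this half_gt_zero[OF \<delta>]]
        obtain L where L: "L \<in> infsets ?N"
          and full: "\<forall>P\<in>infsets M. P - {Inf P} \<subseteq> L \<longrightarrow>
            (\<forall>i\<ge>1. enum1 M i \<in> P - {Inf P} \<longrightarrow> Inf P \<le> i) \<longrightarrow>
            (\<exists>F\<in>schreier s (osuc (pred_at \<xi> n)). (\<forall>i\<in>F. Inf P \<le> i) \<and>
              1 - \<delta> / 2 - 1 / real (Inf P) \<le> sum (ra1 (osuc (pred_at \<xi> n)) P) (enum1 M ` F))"
          by (elim bexE)
        have "\<exists>F\<in>schreier s \<xi>. 1 - \<delta> / 2 - 1 / real n \<le> sum (ra1 \<xi> P) (enum1 M ` F)"
          if P: "P \<in> infsets M" "Inf P = n" "P - {n} \<subseteq> L" for P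
        proof -
          have P1: "P \<in> infsets {1..}" using P(1) M by (rule infsets_mono)
          have "Inf P \<le> i" if i: "1 \<le> i" "enum1 M i \<in> P - {Inf P}" for i
          proof -
            have "enum1 M n < enum1 M i" using i(2) P(2,3) L by (auto simp: infsets_def)
            then show ?thesis using enum1_less_iff[OF Minf n1 i(1)] P(2) by simp
          qed
          then obtain F where F: "F \<in> schreier s (osuc (pred_at \<xi> n))" "\<And>i. i \<in> F \<Longrightarrow> n \<le> i"
            "1 - \<delta> / 2 - 1 / real n \<le> sum (ra1 (osuc (pred_at \<xi> n)) P) (enum1 M ` F)"
            using full[rule_format, OF P(1), unfolded P(2), OF P(3)] P(2) by auto
          moreover have "F \<in> schreier s \<xi>" using False n1 F(1,2) by (rule schreier_pred_at)
          ultimately show ?thesis using ra1_pred_at[OF False P1] P(2) by auto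
        qed
        moreover have "L \<in> infsets N'" using L N'N by (rule infsets_mono)
        ultimately show "\<exists>L\<in>infsets N'. \<forall>P\<in>infsets M. Inf P = n \<longrightarrow> P - {n} \<subseteq> L \<longrightarrow>
          (\<exists>F\<in>schreier s \<xi>. 1 - \<delta> / 2 - 1 / real n \<le> sum (ra1 \<xi> P) (enum1 M ` F))"
          by (intro bexI[of _ L]) simp_all
      next
        fix n L L' assume *: "\<forall>P\<in>infsets M. Inf P = n \<longrightarrow> P - {n} \<subseteq> L \<longrightarrow>
          (\<exists>F\<in>schreier s \<xi>. 1 - \<delta> / 2 - 1 / real n \<le> sum (ra1 \<xi> P) (enum1 M ` F))" "L' \<in> infsets L"
        then have "L' \<subseteq> L" by (simp add: infsets_def)
        then show "\<forall>P\<in>infsets M. Inf P = n \<longrightarrow> P - {n} \<subseteq> L' \<longrightarrow>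
          (\<exists>F\<in>schreier s \<xi>. 1 - \<delta> / 2 - 1 / real n \<le> sum (ra1 \<xi> P) (enum1 M ` F))"
          by (intro ballI impI *(1)[rule_format]) auto
      qed (rule Ninf)
      then obtain L where L: "L \<in> infsets N"
        and full: "\<forall>n\<in>L. \<forall>P\<in>infsets M. Inf P = n \<longrightarrow> P - {n} \<subseteq> {l\<in>L. n < l} \<longrightarrow>
        (\<exists>F\<in>schreier s \<xi>. 1 - \<delta> / 2 - 1 / real n \<le> sum (ra1 \<xi> P) (enum1 M ` F))"
        by (elim bexE)
      define m where "m = nat \<lceil>2 / \<delta>\<rceil>"
      have m: "2 / \<delta> \<le> real m" unfolding m_def by linarith
      let ?L = "{l\<in>L. m < l}"
      have L'L: "?L \<in> infsets L" using L by (intro infsets_greater) (simp add: infsets_def)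
      have L'N: "?L \<in> infsets N" using L'L L by (rule infsets_mono)
      have "\<exists>F\<in>schreier s \<xi>. 1 - \<delta> \<le> sum (ra1 \<xi> P) (enum1 M ` F)" if P: "P \<in> infsets ?L" for P
      proof -
        have PM: "P \<in> infsets M" using P infsets_mono[OF L'N N] by (rule infsets_mono)
        have P1: "P \<in> infsets {1..}" using PM M by (rule infsets_mono)
        have Inf: "Inf P \<in> L" "m < Inf P" using Inf_in_infsets[OF P1] P by (auto simp: infsets_def)
        have "Inf P < l" if "l \<in> P - {Inf P}" for l using that Inf_le[of l P] by auto
        then have "P - {Inf P} \<subseteq> {l\<in>L. Inf P < l}" using P by (auto simp: infsets_def)
        then obtain F where F: "F \<in> schreier s \<xi>"
          "1 - \<delta> / 2 - 1 / real (Inf P) \<le> sum (ra1 \<xi> P) (enum1 M ` F)"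
          using full[rule_format, OF Inf(1) PM refl] by blast
        have "1 / real (Inf P) \<le> \<delta> / 2"
        proof -
          have "2 / \<delta> \<le> real (Inf P)" using m Inf(2) by linarith
          then have "2 \<le> \<delta> * real (Inf P)" using \<delta> by (simp add: field_simps)
          moreover have "0 < real (Inf P)" using Inf(2) by simp
          ultimately show ?thesis by (simp add: field_simps)
        qed
        then show ?thesis using F by (intro bexI[of _ F]) simp_all
      qed
      then show "\<exists>L\<in>infsets N. \<forall>P\<in>infsets L. \<exists>F\<in>schreier s \<xi>. 1 - \<delta> \<le> sum (ra1 \<xi> P) (enum1 M ` F)"
        by (intro bexI[OF _ L'N] ballI)
    qed
  qed
qed

end

section \<open>Functionals of norm at most one\<close>

definition sublinear :: "('a::real_vector \<Rightarrow> real) \<Rightarrow> bool"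
  where "sublinear q \<longleftrightarrow> q 0 = 0 \<and> (\<forall>x y. q (x + y) \<le> q x + q y) \<and> (\<forall>c>0. \<forall>x. q (c *\<^sub>R x) = c * q x)"

text \<open>A pair \<open>(v, t)\<close> stands for the constraint \<open>t \<le> g v\<close> on a
  linear functional \<open>g\<close>; sums and positive multiples of constraints are again
  constraints.\<close>

definition pair_cone :: "('a::real_vector \<times> real) set \<Rightarrow> bool"
  where "pair_cone D \<longleftrightarrow> (0, 0) \<in> D \<and>
    (\<forall>v t w u. (v, t) \<in> D \<longrightarrow> (w, u) \<in> D \<longrightarrow> (v + w, t + u) \<in> D) \<and>
    (\<forall>c>0. \<forall>v t. (v, t) \<in> D \<longrightarrow> (c *\<^sub>R v, c * t) \<in> D)"

lemma pair_cone_ray: "pair_cone {(c *\<^sub>R v, c * r) | c. c \<ge> 0}" (is "pair_cone ?D")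
  unfolding pair_cone_def
proof (intro conjI allI impI)
  show "(0, 0) \<in> ?D" by (auto intro!: exI[of _ 0])
  show "(a + b, t + u) \<in> ?D" if "(a, t) \<in> ?D" "(b, u) \<in> ?D" for a t b u
  proof -
    obtain c d where "a = c *\<^sub>R v" "t = c * r" "b = d *\<^sub>R v" "u = d * r" "c \<ge> 0" "d \<ge> 0"
      using \<open>(a, t) \<in> ?D\<close> \<open>(b, u) \<in> ?D\<close> by blast
    then show ?thesis by (auto intro!: exI[of _ "c + d"] simp: algebra_simps)
  qed
  show "(q *\<^sub>R a, q * t) \<in> ?D" if "q > 0" "(a, t) \<in> ?D" for q a t
  proof -
    obtain c where "a = c *\<^sub>R v" "t = c * r" "c \<ge> 0" using \<open>(a, t) \<in> ?D\<close> by blast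
    then show ?thesis using \<open>q > 0\<close> by (auto intro!: exI[of _ "q * c"])
  qed
qed

text \<open>\<open>p\<close> is the infimal convolution of \<open>q\<close> with the constraints.
  The bound \<open>t \<le> q v\<close> keeps the infimum finite, and a linear \<open>g\<close> below
  \<open>p\<close> satisfies all constraints because
  \<open>g (- v) \<le> p (- v) \<le> - t\<close>.\<close>

lemma sublinear_cone_minorant:
  assumes q: "sublinear q" and D: "pair_cone D" and le: "\<And>v t. (v, t) \<in> D \<Longrightarrow> t \<le> q v"
  obtains p where "sublinear p" "\<And>x. p x \<le> q x" "\<And>v t. (v, t) \<in> D \<Longrightarrow> p (- v) \<le> - t"
proof -
  have q0: "q 0 = 0" and qadd: "\<And>x y. q (x + y) \<le> q x + q y" and qs: "\<And>c x. c > 0 \<Longrightarrow> q (c *\<^sub>R x) = c * q x"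
    using q by (auto simp: sublinear_def)
  have D0: "(0, 0) \<in> D" and Dadd: "\<And>v t w u. (v, t) \<in> D \<Longrightarrow> (w, u) \<in> D \<Longrightarrow> (v + w, t + u) \<in> D"
    and Ds: "\<And>c v t. c > 0 \<Longrightarrow> (v, t) \<in> D \<Longrightarrow> (c *\<^sub>R v, c * t) \<in> D"
    using D by (auto simp: pair_cone_def)
  define p where "p x = (INF (v, t)\<in>D. q (x + v) - t)" for x
  have bdd: "bdd_below ((\<lambda>(v, t). q (x + v) - t) ` D)" for x
  proof (rule bdd_belowI2[of _ "- q (- x)"])
    fix d assume d: "d \<in> D"
    obtain v t where vt: "d = (v, t)" by force
    have "q v \<le> q (x + v) + q (- x)" using qadd[of "x + v" "- x"] by simp
    then show "- q (- x) \<le> (case d of (v, t) \<Rightarrow> q (x + v) - t)" using le[of v t] d vt by simp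
  qed
  have lower: "p x \<le> q (x + v) - t" if "(v, t) \<in> D" for x v t
    using cINF_lower[OF bdd[of x] that] by (simp add: p_def)
  have greatest: "b \<le> p x" if "\<And>v t. (v, t) \<in> D \<Longrightarrow> b \<le> q (x + v) - t" for b x
    unfolding p_def using that D0 by (intro cINF_greatest) auto
  have p_neg: "p (- v) \<le> - t" if "(v, t) \<in> D" for v t using lower[OF that, of "- v"] q0 by simp
  have p_le: "p x \<le> q x" for x using lower[OF D0, of x] by simp
  have padd: "p (x + y) \<le> p x + p y" for x y
  proof -
    have "p (x + y) - (q (x + v) - t) \<le> p y" if vt: "(v, t) \<in> D" for v t
    proof (rule greatest)
      fix w u assume wu: "(w, u) \<in> D"
      have "p (x + y) \<le> q ((x + v) + (y + w)) - (t + u)"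
        using lower[OF Dadd[OF vt wu], of "x + y"] by (simp add: algebra_simps)
      also have "\<dots> \<le> q (x + v) + q (y + w) - (t + u)" using qadd[of "x + v" "y + w"] by simp
      finally show "p (x + y) - (q (x + v) - t) \<le> q (y + w) - u" by simp
    qed
    then have "p (x + y) - p y \<le> p x" by (intro greatest) (simp add: algebra_simps)
    then show ?thesis by simp
  qed
  have ps_le: "c * p x \<le> p (c *\<^sub>R x)" if c: "c > 0" for c x
  proof (rule greatest)
    fix v t assume vt: "(v, t) \<in> D"
    have "p x \<le> q (x + inverse c *\<^sub>R v) - inverse c * t"
      using c vt by (intro lower Ds) simp_all
    then have "c * p x \<le> c * (q (x + inverse c *\<^sub>R v) - inverse c * t)" using c by simp
    also have "\<dots> = q (c *\<^sub>R (x + inverse c *\<^sub>R v)) - t" using c by (simp add: qs right_diff_distrib)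
    finally show "c * p x \<le> q (c *\<^sub>R x + v) - t" using c by (simp add: scaleR_right_distrib)
  qed
  have ps: "p (c *\<^sub>R x) = c * p x" if c: "c > 0" for c x
  proof (rule antisym[OF _ ps_le[OF c]])
    have "inverse c * p (c *\<^sub>R x) \<le> p x" using ps_le[of "inverse c" "c *\<^sub>R x"] c by simp
    then show "p (c *\<^sub>R x) \<le> c * p x" using c by (simp add: field_simps)
  qed
  have "p 0 = 0" using ps[of 2 0] by simp
  then have "sublinear p" using padd ps by (simp add: sublinear_def)
  then show ?thesis using that p_le p_neg by blast
qed

text \<open>Zorn gives a minimal sublinear function \<open>m\<close> below \<open>q\<close>.
  Imposing the constraint \<open>m v \<le> g v\<close> produces a sublinear function below
  \<open>m\<close>, equal to \<open>m\<close> by minimality; this forces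
  \<open>m (- v) \<le> - m v\<close>, hence linearity.\<close>

theorem ex_linear_minorant:
  fixes q :: "'a::real_vector \<Rightarrow> real"
  assumes q: "sublinear q"
  obtains g where "linear g" "\<And>x. g x \<le> q x"
proof -
  define \<A> where "\<A> = {p. sublinear p \<and> (\<forall>x. p x \<le> q x)}"
  \<comment> \<open>This pointwise bound makes infima over chains finite.\<close>
  have lower: "- q (- x) \<le> p x" if "p \<in> \<A>" for p x
  proof -
    have p: "p 0 = 0" "\<And>y z. p (y + z) \<le> p y + p z" "p (- x) \<le> q (- x)"
      using that by (auto simp: \<A>_def sublinear_def)
    show ?thesis using p(2)[of x "- x"] p(1,3) by simp
  qed
  have "\<exists>m\<in>\<A>. \<forall>a\<in>\<A>. a \<le> m \<longrightarrow> a = m"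
  proof (rule predicate_Zorn[where P="\<lambda>a b. b \<le> a"])
    show "partial_order_on \<A> (relation_of (\<lambda>a b. b \<le> a) \<A>)"
      by (rule partial_order_on_relation_ofI) auto
    fix C assume C: "C \<in> Chains (relation_of (\<lambda>a b. b \<le> a) \<A>)"
    have CA: "C \<subseteq> \<A>" and chain: "a \<le> b \<or> b \<le> a" if "a \<in> C" "b \<in> C" for a b
      using C that by (auto simp: Chains_def relation_of_def)
    then have CA: "C \<subseteq> \<A>" by blast
    show "\<exists>u\<in>\<A>. \<forall>a\<in>C. u \<le> a"
    proof (cases "C = {}")
      case True
      then show ?thesis using q by (auto simp: \<A>_def)
    next
      case False
      define u where "u x = (INF a\<in>C. a x)" for x
      have bdd: "bdd_below ((\<lambda>a. a x) ` C)" for x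
        using CA lower by (intro bdd_belowI2[of _ "- q (- x)"]) auto
      have u_le: "u x \<le> a x" if "a \<in> C" for a x
        unfolding u_def using bdd that by (rule cINF_lower)
      have u_ge: "b \<le> u x" if "\<And>a. a \<in> C \<Longrightarrow> b \<le> a x" for b x
        unfolding u_def using False that by (rule cINF_greatest)
      have C_sub: "a 0 = 0" "a (x + y) \<le> a x + a y" "c > 0 \<Longrightarrow> a (c *\<^sub>R x) = c * a x" "a x \<le> q x"
        if "a \<in> C" for a x y c
        using CA that by (auto simp: \<A>_def sublinear_def)
      have "u (x + y) \<le> u x + u y" for x y
      proof -
        have "u (x + y) \<le> a x + b y" if ab: "a \<in> C" "b \<in> C" for a b
        proof -
          \<comment> \<open>The smaller of \<open>a\<close> and \<open>b\<close> serves both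
            summands at once.\<close>
          obtain c where c: "c \<in> C" "c \<le> a" "c \<le> b" using chain[OF ab] ab by blast
          have "u (x + y) \<le> c x + c y" using u_le[OF c(1), of "x + y"] C_sub(2)[OF c(1), of x y] by linarith
          also have "\<dots> \<le> a x + b y" using c(2,3) by (intro add_mono) (auto simp: le_fun_def)
          finally show ?thesis .
        qed
        note le = this
        have le': "u (x + y) - a x \<le> u y" if a: "a \<in> C" for a
        proof (rule u_ge)
          fix b assume "b \<in> C"
          then show "u (x + y) - a x \<le> b y" using le[OF a, of b] by linarith
        qed
        have "u (x + y) - u y \<le> u x"
        proof (rule u_ge)
          fix a assume "a \<in> C"
          then show "u (x + y) - u y \<le> a x" using le'[of a] by linarith
        qed
        then show ?thesis by simp
      qed
      moreover have us_le: "c * u x \<le> u (c *\<^sub>R x)" if "c > 0" for c x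
        using that by (intro u_ge) (simp add: C_sub(3) u_le)
      have "u (c *\<^sub>R x) = c * u x" if c: "c > 0" for c x
      proof (rule antisym[OF _ us_le[OF c]])
        have "inverse c * u (c *\<^sub>R x) \<le> u x" using us_le[of "inverse c" "c *\<^sub>R x"] c by simp
        then show "u (c *\<^sub>R x) \<le> c * u x" using c by (simp add: field_simps)
      qed
      moreover from this[of 2 0] have "u 0 = 0" by simp
      moreover have "u x \<le> q x" for x using False u_le C_sub(4) order_trans by (metis ex_in_conv)
      ultimately have "u \<in> \<A>" by (simp add: \<A>_def sublinear_def)
      then show ?thesis using u_le by (auto simp: le_fun_def intro!: bexI[of _ u])
    qed
  qed
  then obtain m where m: "m \<in> \<A>" and min: "\<And>a. a \<in> \<A> \<Longrightarrow> a \<le> m \<Longrightarrow> a = m" by blast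
  have sub: "sublinear m" and mq: "\<And>x. m x \<le> q x" using m by (auto simp: \<A>_def)
  have m0: "m 0 = 0" and madd: "\<And>x y. m (x + y) \<le> m x + m y" and ms: "\<And>c x. c > 0 \<Longrightarrow> m (c *\<^sub>R x) = c * m x"
    using sub by (auto simp: sublinear_def)
  have neg_le: "m (- v) \<le> - m v" for v
  proof -
    let ?D = "{(c *\<^sub>R v, c * m v) | c. c \<ge> 0}"
    have "pair_cone ?D" by (rule pair_cone_ray)
    moreover have "t \<le> m w" if wt: "(w, t) \<in> ?D" for w t
    proof -
      obtain c where c: "w = c *\<^sub>R v" "t = c * m v" "c \<ge> 0" using wt by blast
      then show ?thesis using ms[of c v] m0 by (cases "c = 0") auto
    qed
    ultimately obtain p where p: "sublinear p" "\<And>x. p x \<le> m x" "\<And>w t. (w, t) \<in> ?D \<Longrightarrow> p (- w) \<le> - t"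
      using sublinear_cone_minorant[OF sub] by blast
    have "p \<in> \<A>" using p(1) order_trans[OF p(2) mq] by (simp add: \<A>_def)
    then have "p = m" using p(2) by (intro min) (auto simp: le_fun_def)
    moreover have "(v, m v) \<in> ?D" by (auto intro!: exI[of _ 1])
    ultimately show ?thesis using p(3) by blast
  qed
  have neg: "m (- v) = - m v" for v
    using neg_le[of v] madd[of v "- v"] m0 by simp
  have add: "m (x + y) = m x + m y" for x y
    using madd[of x y] madd[of "x + y" "- y"] neg[of y] by simp
  have "m (c *\<^sub>R x) = c * m x" for c x
  proof -
    consider "c > 0" | "c = 0" | "c < 0" by linarith
    then show ?thesis
    proof cases
      case 3
      then show ?thesis using ms[of "- c" x] neg[of "(- c) *\<^sub>R x"] by simp
    qed (simp_all add: ms m0)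
  qed
  then have "linear m" using add by (intro linearI) simp_all
  then show ?thesis using that mq by blast
qed

section \<open>The dual unit ball, cluster functionals, boundedness of weakly null sequences\<close>

definition dual_ball :: "('a::real_normed_vector \<Rightarrow> real) set"
  where "dual_ball = {g. linear g \<and> (\<forall>x. g x \<le> norm x)}"

lemma dual_ball_le: "g \<in> dual_ball \<Longrightarrow> g x \<le> norm x"
  by (simp add: dual_ball_def)

lemma dual_ball_linear: "g \<in> dual_ball \<Longrightarrow> linear g"
  by (simp add: dual_ball_def)

lemma dual_ball_abs_le:
  assumes "g \<in> dual_ball"
  shows "\<bar>g x\<bar> \<le> norm x"
  using dual_ball_le[OF assms, of x] dual_ball_le[OF assms, of "- x"]
  by (simp add: linear_neg[OF dual_ball_linear[OF assms]] abs_le_iff)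

lemma dual_ball_bounded_linear: "g \<in> dual_ball \<Longrightarrow> bounded_linear g"
  using dual_ball_abs_le[of g] dual_ball_linear[of g]
  by (intro bounded_linear_intro[where K=1]) (auto simp: linear_add linear_scale)

lemma sublinear_norm: "sublinear norm"
  by (auto simp: sublinear_def norm_triangle_ineq)

lemma dual_ball_above_cone:
  assumes "pair_cone D" "\<And>v t. (v, t) \<in> D \<Longrightarrow> t \<le> norm v"
  obtains g where "g \<in> dual_ball" "\<And>v t. (v, t) \<in> D \<Longrightarrow> t \<le> g v"
proof -
  obtain p where p: "sublinear p" "\<And>x. p x \<le> norm x" "\<And>v t. (v, t) \<in> D \<Longrightarrow> p (- v) \<le> - t"
    using sublinear_cone_minorant[OF sublinear_norm assms] by blast
  obtain g where g: "linear g" "\<And>x. g x \<le> p x" using ex_linear_minorant[OF p(1)] by blast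
  have "g \<in> dual_ball" using g(1) order_trans[OF g(2) p(2)] by (simp add: dual_ball_def)
  moreover have "t \<le> g v" if "(v, t) \<in> D" for v t
    using order_trans[OF g(2) p(3)[OF that]] by (simp add: linear_neg[OF g(1)])
  ultimately show ?thesis using that by blast
qed

lemma norming_functional:
  obtains g where "g \<in> dual_ball" "g v = norm v"
proof -
  let ?D = "{(c *\<^sub>R v, c * norm v) | c. c \<ge> 0}"
  have "pair_cone ?D" by (rule pair_cone_ray)
  moreover have "t \<le> norm w" if "(w, t) \<in> ?D" for w t using that by auto
  ultimately obtain g where g: "g \<in> dual_ball" "\<And>w t. (w, t) \<in> ?D \<Longrightarrow> t \<le> g w"
    using dual_ball_above_cone[of ?D] by blast
  have "(v, norm v) \<in> ?D" by (auto intro!: exI[of _ 1])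
  then have "g v = norm v" using g(2) dual_ball_le[OF g(1), of v] by fastforce
  then show ?thesis using that g(1) by blast
qed

text \<open>A substitute for weak* compactness.\<close>

lemma dual_ball_cluster:
  fixes f :: "nat \<Rightarrow> 'a::real_normed_vector \<Rightarrow> real"
  assumes f: "\<And>k. f k \<in> dual_ball"
  shows "\<exists>g\<in>dual_ball. \<forall>v t j. (\<forall>k\<ge>j. t \<le> f k v) \<longrightarrow> t \<le> g v"
proof -
  \<comment> \<open>Eventual lower bounds form a cone of constraints, and each is dominated by the
    norm because it holds for some \<open>f j\<close>.\<close>
  let ?D = "{(v, t). \<exists>j. \<forall>k\<ge>j. t \<le> f k v}"
  note lin = dual_ball_linear[OF f]
  have "pair_cone ?D"
    unfolding pair_cone_def
  proof (intro conjI allI impI)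
    show "(0, 0) \<in> ?D" by (simp add: linear_0[OF lin])
    show "(a + b, t + u) \<in> ?D" if "(a, t) \<in> ?D" "(b, u) \<in> ?D" for a t b u
    proof -
      obtain i j where "\<forall>k\<ge>i. t \<le> f k a" "\<forall>k\<ge>j. u \<le> f k b" using \<open>(a, t) \<in> ?D\<close> \<open>(b, u) \<in> ?D\<close> by blast
      then have "\<forall>k\<ge>max i j. t + u \<le> f k (a + b)" by (auto simp: linear_add[OF lin] intro: add_mono)
      then show ?thesis by blast
    qed
    show "(r *\<^sub>R a, r * t) \<in> ?D" if "r > 0" "(a, t) \<in> ?D" for r a t
    proof -
      obtain i where "\<forall>k\<ge>i. t \<le> f k a" using \<open>(a, t) \<in> ?D\<close> by blast
      then have "\<forall>k\<ge>i. r * t \<le> f k (r *\<^sub>R a)" using \<open>r > 0\<close> by (simp add: linear_scale[OF lin])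
      then show ?thesis by blast
    qed
  qed
  moreover have "t \<le> norm w" if "(w, t) \<in> ?D" for w t
  proof -
    obtain j where "t \<le> f j w" using \<open>(w, t) \<in> ?D\<close> by blast
    then show ?thesis using dual_ball_le[OF f] order_trans by blast
  qed
  ultimately obtain g where g: "g \<in> dual_ball" "\<And>w t. (w, t) \<in> ?D \<Longrightarrow> t \<le> g w"
    using dual_ball_above_cone[of ?D] by blast
  show ?thesis
  proof (intro bexI[OF _ g(1)] allI impI)
    fix v t j assume "\<forall>k\<ge>j. t \<le> f k v"
    then show "t \<le> g v" by (intro g(2)) blast
  qed

qed

text \<open>Uniform boundedness by construction. If norms exceed \<open>4 ^ k\<close> along
  \<open>m\<close>, let \<open>F\<close> be the sum of norming functionals weighted by
  \<open>(1 / 3) ^ k\<close>, with signs that prevent cancellation against the previous terms. The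
  terms after number \<open>k\<close> amount to at most half of term \<open>k\<close> at
  \<open>x (m k)\<close>, so \<open>F\<close> is unbounded along \<open>x\<close>, although its
  values must tend to 0.\<close>

theorem weakly_null_bounded:
  fixes x :: "nat \<Rightarrow> 'a::real_normed_vector"
  assumes x: "weakly_null x"
  obtains C where "\<And>n. norm (x n) \<le> C"
proof (rule ccontr)
  assume "\<not> thesis"
  then have "\<exists>n. r < norm (x n)" for r using that by (meson not_le)
  then have "\<forall>k. \<exists>n. 4 ^ k < norm (x n)" by blast
  then obtain m where m: "\<And>k. 4 ^ k < norm (x (m k))" by metis
  have "\<forall>k. \<exists>g. g \<in> dual_ball \<and> g (x (m k)) = norm (x (m k))" using norming_functional by metis
  then obtain g where g: "\<And>k. g k \<in> dual_ball" "\<And>k. g k (x (m k)) = norm (x (m k))" by metis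
  \<comment> \<open>The sign copies that of the partial sum at \<open>x (m k)\<close>, so the
    absolute values add up there.\<close>
  define f where "f = rec_nat (\<lambda>_. 0) (\<lambda>k h y. h y + (if h (x (m k)) \<ge> 0 then 1 else -1) * (1 / 3) ^ k * g k y)"
  define \<sigma> :: "nat \<Rightarrow> real" where "\<sigma> k = (if f k (x (m k)) \<ge> 0 then 1 else -1)" for k
  have f0: "f 0 y = 0" and fS: "f (Suc k) y = f k y + \<sigma> k * (1 / 3) ^ k * g k y" for k y
    by (simp_all add: f_def \<sigma>_def)
  have f_sum: "f k y = (\<Sum>j<k. \<sigma> j * (1 / 3) ^ j * g j y)" for k y
    by (induction k) (simp_all add: f0 fS)
  have term_le: "\<bar>\<sigma> k * (1 / 3) ^ k * g k y\<bar> \<le> (1 / 3) ^ k * norm y" for k y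
    using dual_ball_abs_le[OF g(1)] by (simp add: \<sigma>_def abs_mult power_divide divide_right_mono)
  have geo: "summable (\<lambda>k. (1 / 3 :: real) ^ k * norm y)" for y :: 'a
    by (intro summable_mult2 summable_geometric) simp
  have summ: "summable (\<lambda>k. \<sigma> k * (1 / 3) ^ k * g k y)" for y
    using term_le by (intro summable_comparison_test'[OF geo, of 0]) simp
  define F where "F y = (\<Sum>k. \<sigma> k * (1 / 3) ^ k * g k y)" for y
  have tail: "\<bar>F y - f k y\<bar> \<le> (\<Sum>j. (1 / 3) ^ (j + k) * norm y)" for y k
  proof -
    have "F y - f k y = (\<Sum>j. \<sigma> (j + k) * (1 / 3) ^ (j + k) * g (j + k) y)"
      unfolding F_def f_sum using suminf_split_initial_segment[OF summ, of y k] by simp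
    also have "\<bar>\<dots>\<bar> \<le> (\<Sum>j. (1 / 3) ^ (j + k) * norm y)"
    proof -
      have "summable (\<lambda>j. (1 / 3 :: real) ^ (j + k) * norm y)"
        using geo[of y] by (subst summable_iff_shift)
      then show ?thesis
        using norm_suminf_le[of "\<lambda>j. \<sigma> (j + k) * (1 / 3) ^ (j + k) * g (j + k) y"
            "\<lambda>j. (1 / 3) ^ (j + k) * norm y"] term_le by simp
    qed
    finally show ?thesis .
  qed
  have geo_sum: "(\<Sum>j. (1 / 3) ^ (j + k) * norm y) = (1 / 3) ^ k * (3 / 2 * norm y)" for k and y :: 'a
  proof -
    have "(\<lambda>j. (1 / 3 :: real) ^ j) sums (1 / (1 - 1 / 3))" by (rule geometric_sums) simp
    then have "(\<lambda>j. (1 / 3) ^ j * ((1 / 3) ^ k * norm y)) sums (3 / 2 * ((1 / 3) ^ k * norm y))"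
      using sums_mult2 by fastforce
    then have "(\<Sum>j. (1 / 3) ^ j * ((1 / 3) ^ k * norm y)) = 3 / 2 * ((1 / 3) ^ k * norm y)"
      by (rule sums_unique[symmetric])
    then show ?thesis by (simp add: power_add mult.assoc)
  qed
  have "bounded_linear F"
  proof (rule bounded_linear_intro[where K="3 / 2"])
    note lin = dual_ball_linear[OF g(1)]
    show "F (y + z) = F y + F z" for y z
      unfolding F_def by (subst suminf_add[OF summ summ]) (simp add: linear_add[OF lin] algebra_simps)
    show "F (r *\<^sub>R y) = r *\<^sub>R F y" for r y
    proof -
      have "F (r *\<^sub>R y) = (\<Sum>k. r * (\<sigma> k * (1 / 3) ^ k * g k y))"
        unfolding F_def by (simp add: linear_scale[OF lin] algebra_simps)
      then show ?thesis unfolding F_def using suminf_mult[OF summ] by simp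
    qed
    show "norm (F y) \<le> norm y * (3 / 2)" for y
      using tail[of y 0] geo_sum[of 0 y] by (simp add: f0)
  qed
  then have "(\<lambda>n. F (x n)) \<longlonglongrightarrow> 0" using x by (simp add: weakly_null_def)
  then have "Bseq (\<lambda>n. F (x n))" by (intro convergent_imp_Bseq convergentI)
  then obtain B where B: "\<And>n. \<bar>F (x n)\<bar> \<le> B" by (auto simp: Bseq_def)
  have aux: "b \<le> \<bar>a + (if 0 \<le> a then 1 else -1) * b\<bar>" if "0 \<le> b" for a b :: real
  proof (cases "0 \<le> a")
    case False
    then have "b \<le> \<bar>a - b\<bar>" using that by linarith
    then show ?thesis using False by simp
  qed (use that in simp)
  have big: "1 / 2 * (4 / 3) ^ k \<le> B" for k
  proof -
    let ?y = "x (m k)"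
    have "f (Suc k) ?y = f k ?y + \<sigma> k * ((1 / 3) ^ k * norm ?y)"
      by (simp add: fS g(2) mult.assoc)
    moreover have "0 \<le> (1 / 3) ^ k * norm ?y" by simp
    ultimately have "(1 / 3) ^ k * norm ?y \<le> \<bar>f (Suc k) ?y\<bar>"
      using aux[of "(1 / 3) ^ k * norm ?y" "f k ?y"] by (simp only: \<sigma>_def)
    moreover have "\<bar>F ?y - f (Suc k) ?y\<bar> \<le> (1 / 3) ^ k * (1 / 2 * norm ?y)"
      using tail[of ?y "Suc k"] geo_sum[of "Suc k" ?y] by simp
    moreover have "(1 / 3) ^ k * (1 / 2 * norm ?y) = (1 / 3) ^ k * norm ?y / 2" by simp
    ultimately have "(1 / 3) ^ k * (1 / 2 * norm ?y) \<le> \<bar>F ?y\<bar>" by linarith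
    moreover have "(1 / 3) ^ k * (1 / 2 * 4 ^ k) \<le> (1 / 3) ^ k * (1 / 2 * norm ?y)"
      using m[of k] by (intro mult_left_mono) simp_all
    moreover have "(1 / 3) ^ k * (1 / 2 * 4 ^ k) = 1 / 2 * (4 / 3 :: real) ^ k"
      by (simp add: power_divide)
    ultimately show ?thesis using B[of "m k"] by linarith
  qed
  obtain k where "2 * B < (4 / 3) ^ k" using real_arch_pow[of "4 / 3" "2 * B"] by auto
  then show False using big[of k] by simp
qed

section \<open>Near unconditionality and the theorem\<close>

text \<open>Large negative values are allowed on \<open>B\<close>: in
  \<open>l1_lower_estimate\<close> the coefficients there are at most 0, so an upper bound
  suffices.\<close>

definition functionals :: "(nat \<Rightarrow> 'a::real_normed_vector) \<Rightarrow> real \<Rightarrow> real \<Rightarrow> nat set \<Rightarrow> nat set \<Rightarrow> ('a \<Rightarrow> real) set"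
  where "functionals x d e A B = {f \<in> dual_ball. (\<forall>i\<in>A. d \<le> f (x i)) \<and> (\<forall>i\<in>B. f (x i) \<le> e)}"

text \<open>In use, \<open>A\<close> and \<open>B\<close> are the parts of a pattern fixed before
  \<open>p\<close>, and \<open>A'\<close> is the part of it beyond \<open>p\<close>.\<close>

definition can_lower :: "(nat \<Rightarrow> 'a::real_normed_vector) \<Rightarrow> real \<Rightarrow> real \<Rightarrow> nat set \<Rightarrow> nat set \<Rightarrow> nat set \<Rightarrow> bool"
  where "can_lower x d e A B L \<longleftrightarrow> (\<forall>p\<in>L. \<forall>A'. finite A' \<longrightarrow> A' \<subseteq> {l\<in>L. p < l} \<longrightarrow>
    functionals x d e (A \<union> A') B \<noteq> {} \<longrightarrow> functionals x d e (A \<union> A') (insert p B) \<noteq> {})"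

lemma can_lower_mono: "can_lower x d e A B L \<Longrightarrow> L' \<subseteq> L \<Longrightarrow> can_lower x d e A B L'"
  unfolding can_lower_def
proof (intro ballI allI impI)
  fix p A'
  assume *: "\<forall>p\<in>L. \<forall>A'. finite A' \<longrightarrow> A' \<subseteq> {l\<in>L. p < l} \<longrightarrow>
      functionals x d e (A \<union> A') B \<noteq> {} \<longrightarrow> functionals x d e (A \<union> A') (insert p B) \<noteq> {}"
    and L': "L' \<subseteq> L" and p: "p \<in> L'" and A': "finite A'" "A' \<subseteq> {l\<in>L'. p < l}"
    and ne: "functionals x d e (A \<union> A') B \<noteq> {}"
  have "p \<in> L" "A' \<subseteq> {l\<in>L. p < l}" using L' p A'(2) by auto
  then show "functionals x d e (A \<union> A') (insert p B) \<noteq> {}" using * A'(1) ne by simp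
qed

lemma functionals_antimono: "A \<subseteq> A' \<Longrightarrow> B \<subseteq> B' \<Longrightarrow> functionals x d e A' B' \<subseteq> functionals x d e A B"
  unfolding functionals_def by blast

text \<open>Ramsey applies to an infinite set read as a point \<open>p\<close> followed by a set
  with initial segment \<open>A'\<close>. If all subsets of \<open>L\<close> were bad, then for
  every \<open>j\<close> the first \<open>j + 1\<close> points of \<open>L\<close> would be bad
  before a common tail, and one functional would exceed \<open>e\<close> at all of them. A cluster
  functional would then be at least \<open>e\<close> along \<open>L\<close>, against weak
  nullity.\<close>

lemma ex_can_lower:
  fixes x :: "nat \<Rightarrow> 'a::real_normed_vector"
  assumes x: "weakly_null x" and e: "e > 0" and N: "infinite N"
  shows "\<exists>L\<in>infsets N. can_lower x d e A B L"
proof -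
  define bad where "bad p A' \<longleftrightarrow>
    functionals x d e (A \<union> A') B \<noteq> {} \<and> functionals x d e (A \<union> A') (insert p B) = {}" for p A'
  define U where "U P \<longleftrightarrow> (\<exists>n. bad (Inf P) {a\<in>P. Inf P < a \<and> a \<le> n})" for P
  have "open_family U"
    unfolding open_family_def
  proof (intro allI impI)
    fix P :: "nat set" assume P: "infinite P" "U P"
    then obtain n where n: "bad (Inf P) {a\<in>P. Inf P < a \<and> a \<le> n}" by (auto simp: U_def)
    let ?m = "max n (Inf P)"
    have "U Q" if Q: "infinite Q" "Q \<inter> {..?m} = P \<inter> {..?m}" for Q
    proof -
      have iff: "a \<in> P \<longleftrightarrow> a \<in> Q" if "a \<le> ?m" for a
        using Q(2) that by (metis IntI IntD1 atMost_iff)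
      have "Inf P \<in> Q" using iff[of "Inf P"] Inf_mem[OF P(1)] by simp
      then have le: "Inf Q \<le> Inf P" by (rule Inf_le)
      then have "Inf Q \<in> P" using iff[of "Inf Q"] Inf_mem[OF Q(1)] by simp
      then have Inf: "Inf Q = Inf P" using le Inf_le by (intro antisym) auto
      have "{a\<in>Q. Inf P < a \<and> a \<le> n} = {a\<in>P. Inf P < a \<and> a \<le> n}" using iff by auto
      then show ?thesis using n unfolding U_def Inf by (intro exI[of _ n]) simp
    qed
    then show "\<exists>m. \<forall>Q. infinite Q \<longrightarrow> Q \<inter> {..m} = P \<inter> {..m} \<longrightarrow> U Q" by blast
  qed
  from ramsey_open[OF this N] obtain L where L: "L \<in> infsets N"
    "(\<forall>P\<in>infsets L. U P) \<or> (\<forall>P\<in>infsets L. \<not> U P)" by (elim bexE)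
  have Linf: "infinite L" using L by (simp add: infsets_def)
  have Inf_insert: "Inf (insert p T) = p" if "\<And>t. t \<in> T \<Longrightarrow> p < t" for p :: nat and T
    using that by (intro antisym Inf_le cInf_greatest) (auto intro: less_imp_le)
  have "\<not> (\<forall>P\<in>infsets L. U P)"
  proof
    assume all: "\<forall>P\<in>infsets L. U P"
    let ?q = "enumerate L"
    have q_mono: "?q i < ?q j" if "i < j" for i j using that Linf by simp
    have q_le: "?q i \<le> ?q j" if "i \<le> j" for i j using that q_mono[of i j] by (cases "i = j") auto
    have "\<exists>f. f \<in> dual_ball \<and> (\<forall>i\<le>j. e < f (x (?q i)))" for j
    proof -
      \<comment> \<open>One tail for all \<open>i \<le> j\<close> makes their bad segments
        nested.\<close>
      let ?T = "{l\<in>L. ?q j < l}"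
      have "\<exists>n. bad (?q i) {a\<in>?T. a \<le> n}" if "i \<le> j" for i
      proof -
        have "?T \<in> infsets L" using Linf by (rule infsets_greater)
        then have "insert (?q i) ?T \<in> infsets L"
          using enumerate_in_set[OF Linf] by (auto simp: infsets_def)
        then obtain n where n: "bad (Inf (insert (?q i) ?T)) {a\<in>insert (?q i) ?T. Inf (insert (?q i) ?T) < a \<and> a \<le> n}"
          using all unfolding U_def by blast
        have Inf: "Inf (insert (?q i) ?T) = ?q i"
          using q_le[OF \<open>i \<le> j\<close>] by (intro Inf_insert) auto
        have eq: "{a\<in>insert (?q i) ?T. ?q i < a \<and> a \<le> n} = {a\<in>?T. a \<le> n}"
          using q_le[OF \<open>i \<le> j\<close>] by auto
        show ?thesis using n unfolding Inf eq by (rule exI)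
      qed
      then obtain n where n: "\<And>i. i \<le> j \<Longrightarrow> bad (?q i) {a\<in>?T. a \<le> n i}" by metis
      \<comment> \<open>A functional for the longest segment also serves the shorter ones; a value
        of at most \<open>e\<close> at \<open>?q i\<close> would refute the badness of
        \<open>?q i\<close>.\<close>
      define m where "m = Max (n ` {..j})"
      have m_ge: "n i \<le> m" if "i \<le> j" for i using that by (auto simp: m_def)
      have "m \<in> n ` {..j}" unfolding m_def by (intro Max_in) auto
      then obtain i0 where "i0 \<le> j" "m = n i0" by auto
      then have "functionals x d e (A \<union> {a\<in>?T. a \<le> m}) B \<noteq> {}" using n by (auto simp: bad_def)
      then obtain f where f: "f \<in> functionals x d e (A \<union> {a\<in>?T. a \<le> m}) B" by blast
      have "e < f (x (?q i))" if "i \<le> j" for i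
      proof (rule ccontr)
        assume "\<not> ?thesis"
        moreover have "A \<union> {a\<in>?T. a \<le> n i} \<subseteq> A \<union> {a\<in>?T. a \<le> m}" using m_ge[OF that] by auto
        then have "f \<in> functionals x d e (A \<union> {a\<in>?T. a \<le> n i}) B" using f functionals_antimono by blast
        ultimately have "f \<in> functionals x d e (A \<union> {a\<in>?T. a \<le> n i}) (insert (?q i) B)"
          by (auto simp: functionals_def)
        then show False using n[OF that] by (auto simp: bad_def)
      qed
      then show ?thesis using f by (auto simp: functionals_def)
    qed
    then obtain f where f: "\<And>j. f j \<in> dual_ball" "\<And>i j. i \<le> j \<Longrightarrow> e < f j (x (?q i))" by metis
    from dual_ball_cluster[of f, OF f(1)] obtain g where g: "g \<in> dual_ball"
      and g_ge: "\<forall>v t j. (\<forall>k\<ge>j. t \<le> f k v) \<longrightarrow> t \<le> g v" by (elim bexE)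
    have "e \<le> g (x (?q i))" for i
      using f(2) by (intro g_ge[rule_format, of i]) (simp add: less_imp_le)
    moreover have "(\<lambda>i. g (x (?q i))) \<longlonglongrightarrow> 0"
    proof -
      have "strict_mono ?q" using q_mono by (simp add: strict_mono_def)
      moreover have "(\<lambda>n. g (x n)) \<longlonglongrightarrow> 0"
        using x dual_ball_bounded_linear[OF g] by (simp add: weakly_null_def)
      ultimately show ?thesis using LIMSEQ_subseq_LIMSEQ by (fastforce simp: o_def)
    qed
    ultimately have "e \<le> 0" by (intro LIMSEQ_le_const) auto
    then show False using e by simp
  qed
  then have none: "\<not> U P" if "P \<in> infsets L" for P using L(2) that by blast
  have "can_lower x d e A B L"
    unfolding can_lower_def
  proof (intro ballI allI impI)
    fix p A' assume p: "p \<in> L" and A': "finite A'" "A' \<subseteq> {l\<in>L. p < l}"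
      and ne: "functionals x d e (A \<union> A') B \<noteq> {}"
    define n where "n = Max (insert p A')"
    have n: "p \<le> n" "\<And>a. a \<in> A' \<Longrightarrow> a \<le> n" using A'(1) by (auto simp: n_def)
    \<comment> \<open>Continuing beyond \<open>n\<close> makes \<open>A'\<close> an initial segment
      of an infinite set, to which the Ramsey alternative applies.\<close>
    let ?T = "A' \<union> {l\<in>L. n < l}"
    have "{l\<in>L. n < l} \<in> infsets L" using Linf by (rule infsets_greater)
    then have P: "insert p ?T \<in> infsets L" using p A' by (auto simp: infsets_def)
    have gt: "p < t" if "t \<in> ?T" for t using that A'(2) n(1) by auto
    have Inf: "Inf (insert p ?T) = p" by (intro Inf_insert gt)
    have eq: "{a\<in>insert p ?T. p < a \<and> a \<le> n} = A'"
    proof (intro equalityI subsetI)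
      fix a assume "a \<in> A'"
      then show "a \<in> {a\<in>insert p ?T. p < a \<and> a \<le> n}" using gt[of a] n(2)[of a] by simp
    next
      fix a assume "a \<in> {a\<in>insert p ?T. p < a \<and> a \<le> n}"
      then show "a \<in> A'" by auto
    qed
    have "\<not> bad p {a\<in>insert p ?T. p < a \<and> a \<le> n}" using none[OF P] unfolding U_def Inf by blast
    then have "\<not> bad p A'" unfolding eq .
    then show "functionals x d e (A \<union> A') (insert p B) \<noteq> {}" using ne unfolding bad_def by blast
  qed
  then show ?thesis using L(1) by blast
qed

text \<open>The points of \<open>B\<close> are inserted in increasing order. When \<open>b\<close>
  is treated, the earlier points of \<open>B\<close> and the points of \<open>A\<close> below
  \<open>b\<close> are fixed, and the points of \<open>A\<close> above \<open>b\<close> play the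
  role of \<open>A'\<close> in \<open>can_lower\<close>.\<close>

theorem near_unconditionality:
  fixes x :: "nat \<Rightarrow> 'a::real_normed_vector"
  assumes x: "weakly_null x" and e: "e > 0" and M: "infinite M"
  shows "\<exists>L\<in>infsets M. \<forall>A B. finite A \<longrightarrow> finite B \<longrightarrow> A \<union> B \<subseteq> L \<longrightarrow> A \<inter> B = {} \<longrightarrow>
    functionals x d e A {} \<noteq> {} \<longrightarrow> functionals x d e A B \<noteq> {}"
proof -
  have "\<exists>L\<in>infsets M. \<forall>S. finite S \<longrightarrow> S \<subseteq> L \<longrightarrow>
      (\<forall>(A, B)\<in>Pow S \<times> Pow S. can_lower x d e A B {l\<in>L. \<forall>a\<in>S. a < l})"
  proof (rule diagonal)
    fix S :: "nat set" and N assume S: "finite S" and N: "N \<in> infsets M"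
    show "\<exists>L\<in>infsets N. \<forall>(A, B)\<in>Pow S \<times> Pow S. can_lower x d e A B L"
    proof (rule dense_finite)
      show "\<exists>L\<in>infsets N'. case c of (A, B) \<Rightarrow> can_lower x d e A B L" if "N' \<in> infsets M" for c N'
        using ex_can_lower[OF x e, of N'] that by (cases c) (auto simp: infsets_def)
      show "case c of (A, B) \<Rightarrow> can_lower x d e A B L'"
        if "case c of (A, B) \<Rightarrow> can_lower x d e A B L" "L' \<in> infsets L" for c L L'
        using that can_lower_mono by (cases c) (auto simp: infsets_def)
    qed (use S N in simp_all)
  next
    fix S L L' assume *: "\<forall>(A, B)\<in>Pow S \<times> Pow S. can_lower x d e A B L" and "L' \<in> infsets L"
    then have "L' \<subseteq> L" by (simp add: infsets_def)
    note mono = can_lower_mono[OF _ this]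
    show "\<forall>(A, B)\<in>Pow S \<times> Pow S. can_lower x d e A B L'"
    proof
      fix c assume c: "c \<in> Pow S \<times> Pow S"
      obtain A B where "c = (A, B)" by (cases c)
      then show "case c of (A, B) \<Rightarrow> can_lower x d e A B L'" using *[rule_format, OF c] mono by simp
    qed
  qed (rule M)
  then obtain L where L: "L \<in> infsets M"
    and low': "\<forall>S. finite S \<longrightarrow> S \<subseteq> L \<longrightarrow>
      (\<forall>(A, B)\<in>Pow S \<times> Pow S. can_lower x d e A B {l\<in>L. \<forall>a\<in>S. a < l})"
    by (elim bexE)
  have low: "can_lower x d e A B {l\<in>L. \<forall>a\<in>A \<union> B. a < l}" if "finite (A \<union> B)" "A \<union> B \<subseteq> L" for A B
    using low'[rule_format, OF that, of "(A, B)"] by simp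
  have "functionals x d e A B \<noteq> {}"
    if A: "finite A" "A \<subseteq> L" and ne: "functionals x d e A {} \<noteq> {}" and "finite B" "B \<subseteq> L" "A \<inter> B = {}" for A B
    using that(4-)
  proof (induction B rule: finite_linorder_max_induct)
    case empty
    then show ?case using ne by simp
  next
    case (insert b B)
    let ?A0 = "{a\<in>A. a < b}" and ?A1 = "{a\<in>A. b < a}"
    have "b \<notin> A" using insert.prems by auto
    then have A01: "?A0 \<union> ?A1 = A" by (auto simp: not_less le_less)
    have "can_lower x d e ?A0 B {l\<in>L. \<forall>a\<in>?A0 \<union> B. a < l}"
      using A insert by (intro low) auto
    moreover have "b \<in> {l\<in>L. \<forall>a\<in>?A0 \<union> B. a < l}" using insert by auto
    moreover have "?A1 \<subseteq> {l\<in>{l\<in>L. \<forall>a\<in>?A0 \<union> B. a < l}. b < l}"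
      using A(2) insert.hyps by (auto intro: less_trans)
    moreover have "finite ?A1" using A(1) by simp
    moreover have "functionals x d e (?A0 \<union> ?A1) B \<noteq> {}" unfolding A01 using insert by auto
    ultimately have "functionals x d e (?A0 \<union> ?A1) (insert b B) \<noteq> {}"
      unfolding can_lower_def by blast
    then show ?case unfolding A01 .
  qed
  note concl = this
  show ?thesis
  proof (intro bexI[OF _ L] allI impI)
    fix A B assume "finite A" "finite B" "A \<union> B \<subseteq> L" "A \<inter> B = {}" "functionals x d e A {} \<noteq> {}"
    then show "functionals x d e A B \<noteq> {}" using concl[of A B] by simp
  qed
qed

text \<open>After a change of sign the positive coefficients carry at least half of the sum. A
  functional separating their index set from the rest gains \<open>d\<close> times the positive part
  and loses at most \<open>d / 2\<close> times the rest, which leaves at least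
  \<open>d / 2 - d / 4\<close> of the total.\<close>

lemma l1_lower_estimate:
  fixes y :: "nat \<Rightarrow> 'a::real_normed_vector" and a :: "nat \<Rightarrow> real"
  assumes F: "finite F" and d: "d > 0"
    and sep: "\<And>A. A \<subseteq> F \<Longrightarrow> \<exists>g\<in>dual_ball. (\<forall>i\<in>A. d \<le> g (y i)) \<and> (\<forall>i\<in>F - A. g (y i) \<le> d / 2)"
  shows "d / 4 * (\<Sum>i\<in>F. \<bar>a i\<bar>) \<le> norm (\<Sum>i\<in>F. a i *\<^sub>R y i)"
proof -
  have main: "d / 4 * (\<Sum>i\<in>F. \<bar>a i\<bar>) \<le> norm (\<Sum>i\<in>F. a i *\<^sub>R y i)"
    if half: "(\<Sum>i\<in>F. \<bar>a i\<bar>) \<le> 2 * (\<Sum>i\<in>{i\<in>F. 0 < a i}. \<bar>a i\<bar>)" for a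
  proof -
    let ?A = "{i\<in>F. 0 < a i}"
    obtain g where g: "g \<in> dual_ball" "\<forall>i\<in>?A. d \<le> g (y i)" "\<forall>i\<in>F - ?A. g (y i) \<le> d / 2"
      using sep[of ?A] by auto
    have split: "(\<Sum>i\<in>F. h i) = (\<Sum>i\<in>F - ?A. h i) + (\<Sum>i\<in>?A. h i)" for h :: "nat \<Rightarrow> real"
      using F by (intro sum.subset_diff) auto
    have "d * (\<Sum>i\<in>?A. \<bar>a i\<bar>) \<le> (\<Sum>i\<in>?A. a i * g (y i))"
      unfolding sum_distrib_left using g(2) by (intro sum_mono) (simp add: mult.commute[of d] mult_left_mono)
    moreover have "- (d / 2) * (\<Sum>i\<in>F - ?A. \<bar>a i\<bar>) \<le> (\<Sum>i\<in>F - ?A. a i * g (y i))"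
      unfolding sum_distrib_left
    proof (rule sum_mono)
      fix i assume i: "i \<in> F - ?A"
      then have "a i \<le> 0" "g (y i) \<le> d / 2" using g(3) by auto
      then have "a i * (d / 2) \<le> a i * g (y i)" by (intro mult_left_mono_neg)
      then show "- (d / 2) * \<bar>a i\<bar> \<le> a i * g (y i)" using \<open>a i \<le> 0\<close> by (simp add: mult.commute)
    qed
    ultimately have "d * (\<Sum>i\<in>?A. \<bar>a i\<bar>) - d / 2 * (\<Sum>i\<in>F - ?A. \<bar>a i\<bar>) \<le> (\<Sum>i\<in>F. a i * g (y i))"
      unfolding split[of "\<lambda>i. a i * g (y i)"] by simp
    also have "(\<Sum>i\<in>F. a i * g (y i)) = g (\<Sum>i\<in>F. a i *\<^sub>R y i)"
      using dual_ball_linear[OF g(1)] by (simp add: linear_sum linear_scale)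
    also have "\<dots> \<le> norm (\<Sum>i\<in>F. a i *\<^sub>R y i)" using g(1) by (rule dual_ball_le)
    finally have *: "d * (\<Sum>i\<in>?A. \<bar>a i\<bar>) - d / 2 * (\<Sum>i\<in>F - ?A. \<bar>a i\<bar>) \<le> norm (\<Sum>i\<in>F. a i *\<^sub>R y i)" .
    have "d * ((\<Sum>i\<in>F - ?A. \<bar>a i\<bar>) - (\<Sum>i\<in>?A. \<bar>a i\<bar>)) \<le> 0"
      using half d unfolding split[of "\<lambda>i. \<bar>a i\<bar>"] by (intro mult_nonneg_nonpos) auto
    then have "d / 4 * (\<Sum>i\<in>F. \<bar>a i\<bar>) \<le> d * (\<Sum>i\<in>?A. \<bar>a i\<bar>) - d / 2 * (\<Sum>i\<in>F - ?A. \<bar>a i\<bar>)"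
      unfolding split[of "\<lambda>i. \<bar>a i\<bar>"] by (simp add: algebra_simps)
    then show ?thesis using * by linarith
  qed
  show ?thesis
  proof (cases "(\<Sum>i\<in>F. \<bar>a i\<bar>) \<le> 2 * (\<Sum>i\<in>{i\<in>F. 0 < a i}. \<bar>a i\<bar>)")
    case True
    then show ?thesis by (rule main)
  next
    case False
    let ?A = "{i\<in>F. 0 < a i}" and ?B = "{i\<in>F. 0 < - a i}"
    have "(\<Sum>i\<in>F. \<bar>a i\<bar>) = (\<Sum>i\<in>F - ?A. \<bar>a i\<bar>) + (\<Sum>i\<in>?A. \<bar>a i\<bar>)"
      using F by (intro sum.subset_diff) auto
    moreover have "(\<Sum>i\<in>F - ?A. \<bar>a i\<bar>) = (\<Sum>i\<in>?B. \<bar>a i\<bar>)"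
      using F by (intro sum.mono_neutral_right) auto
    ultimately have "(\<Sum>i\<in>F. \<bar>- a i\<bar>) \<le> 2 * (\<Sum>i\<in>?B. \<bar>- a i\<bar>)" using False by simp
    from main[OF this] show ?thesis by (simp add: sum_negf)
  qed
qed

lemma dot_eq_sum:
  assumes "finite S" "supp a \<subseteq> S"
  shows "dot a x = (\<Sum>i\<in>S. a i *\<^sub>R x i)"
  unfolding dot_def using assms by (intro suminf_finite) (auto simp: supp_def)

text \<open>Cut off blocks of length \<open>m\<close> from the end until fewer than
  \<open>k0 + m\<close> terms remain, and estimate those by \<open>C\<close>.\<close>

lemma chunk_sum_bound:
  fixes y :: "nat \<Rightarrow> 'a::real_normed_vector"
  assumes C: "\<And>k. norm (y k) \<le> C" and "c \<ge> 0"
    and chunk: "\<And>k. k \<ge> k0 \<Longrightarrow> norm (\<Sum>j<m. y (k + j)) \<le> real m * c" and "m \<ge> 1"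
  shows "norm (\<Sum>k<n. y k) \<le> real n * c + real (k0 + m) * C"
proof (induction n rule: less_induct)
  case (less n)
  have C0: "0 \<le> C" using C[of 0] norm_ge_zero order_trans by blast
  show ?case
  proof (cases "n < k0 + m")
    case True
    have "norm (\<Sum>k<n. y k) \<le> real (card {..<n}) * C"
      using C by (intro order_trans[OF norm_sum] sum_bounded_above) simp
    also have "\<dots> \<le> real (k0 + m) * C" using True C0 by (intro mult_right_mono) auto
    finally show ?thesis using \<open>c \<ge> 0\<close> by (simp add: add_increasing)
  next
    case False
    define n' where "n' = n - m"
    have n: "n = n' + m" "k0 \<le> n'" "n' < n" using False \<open>m \<ge> 1\<close> by (auto simp: n'_def)
    have "(\<Sum>k<n. y k) = (\<Sum>k<n'. y k) + (\<Sum>j<m. y (n' + j))"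
      unfolding n(1) by (rule sum_lessThan_add)
    then have "norm (\<Sum>k<n. y k) \<le> norm (\<Sum>k<n'. y k) + norm (\<Sum>j<m. y (n' + j))"
      by (simp add: norm_triangle_ineq)
    also have "\<dots> \<le> (real n' * c + real (k0 + m) * C) + real m * c"
      using less[OF n(3)] chunk[OF n(2)] by (rule add_mono)
    finally show ?thesis by (simp add: n(1) algebra_simps)
  qed
qed

section \<open>Norms of averages and the characterization of the index\<close>

context fundamental_system
begin

lemma ra_tail_Inf_ge:
  assumes "P \<in> infsets {1..}"
  shows "k \<le> Inf (ra_tail \<xi> P k)"
proof (induction k)
  case (Suc k)
  have T: "ra_tail \<xi> P k \<in> infsets {1..}" for k
    using ra_tail_infsets[OF assms] assms by (rule infsets_mono)
  have "Inf (ra_tail \<xi> P (Suc k)) \<in> ra_tail \<xi> P k - supp (ra1 \<xi> (ra_tail \<xi> P k))"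
    using Inf_in_infsets[OF T[of "Suc k"]] unfolding rest_Suc_right .
  then have "Inf (ra_tail \<xi> P k) < Inf (ra_tail \<xi> P (Suc k))"
    using ra1_supp_initial[OF T Inf_in_supp_ra1[OF T]] by blast
  then show ?case using Suc by simp
qed simp

lemma dot_ra1: "P \<in> infsets {1..} \<Longrightarrow> dot (ra1 \<xi> P) x = (\<Sum>j\<in>supp (ra1 \<xi> P). ra1 \<xi> P j *\<^sub>R x j)"
  by (intro dot_eq_sum ra1_supp_finite) auto

lemma norm_dot_ra1_le:
  fixes x :: "nat \<Rightarrow> 'a::real_normed_vector"
  assumes P: "P \<in> infsets {1..}" and C: "\<And>n. norm (x n) \<le> C"
  shows "norm (dot (ra1 \<xi> P) x) \<le> C"
proof -
  have "norm (dot (ra1 \<xi> P) x) \<le> (\<Sum>j\<in>supp (ra1 \<xi> P). ra1 \<xi> P j * C)"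
    unfolding dot_ra1[OF P] using ra1_nonneg[OF P] C
    by (intro order_trans[OF norm_sum] sum_mono) (simp add: mult_left_mono)
  also have "\<dots> = C" using sum_ra1_supp[OF P, of \<xi>] by (simp add: sum_distrib_right[symmetric])
  finally show ?thesis .
qed

lemma dot_ra1_osuc:
  fixes x :: "nat \<Rightarrow> 'a::real_normed_vector"
  assumes P: "P \<in> infsets {1..}"
  shows "dot (ra1 (osuc \<zeta>) P) x = (1 / real (Inf P)) *\<^sub>R (\<Sum>k<Inf P. dot (ra1 \<zeta> (ra_tail \<zeta> P k)) x)"
proof -
  let ?S = "supp (ra1 (osuc \<zeta>) P)"
  have fin: "finite ?S" using P by (rule ra1_supp_finite)
  have "dot (ra1 \<zeta> (ra_tail \<zeta> P k)) x = (\<Sum>j\<in>?S. ra1 \<zeta> (ra_tail \<zeta> P k) j *\<^sub>R x j)" if "k < Inf P" for k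
    using that by (intro dot_eq_sum fin) (auto simp: supp_ra1_osuc[OF P])
  then have "(\<Sum>k<Inf P. dot (ra1 \<zeta> (ra_tail \<zeta> P k)) x) =
      (\<Sum>k<Inf P. \<Sum>j\<in>?S. ra1 \<zeta> (ra_tail \<zeta> P k) j *\<^sub>R x j)"
    by (intro sum.cong) auto
  also have "\<dots> = (\<Sum>j\<in>?S. (\<Sum>k<Inf P. ra1 \<zeta> (ra_tail \<zeta> P k) j) *\<^sub>R x j)"
    by (subst sum.swap) (simp add: scaleR_sum_left)
  finally show ?thesis
    unfolding dot_ra1[OF P] by (simp add: scaleR_sum_right ra1_osuc[OF P])
qed

text \<open>Openness is the locality of the first average. Membership in
  \<open>infsets {1..}\<close> is built in because \<open>ra1_local\<close> requires it; for
  infinite sets it is decided by whether 0 is an element.\<close>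

lemma open_family_ra1: "open_family (\<lambda>P. P \<in> infsets {1..} \<and> Q (ra1 \<xi> P))"
  unfolding open_family_def
proof (intro allI impI)
  fix P assume P: "P \<in> infsets {1..} \<and> Q (ra1 \<xi> P)"
  obtain n where n: "supp (ra1 \<xi> P) \<subseteq> {..n}"
    using finite_nat_iff_bounded_le[THEN iffD1, OF ra1_supp_finite[of P \<xi>]] P by blast
  have "R \<in> infsets {1..} \<and> Q (ra1 \<xi> R)" if R: "infinite R" "R \<inter> {..n} = P \<inter> {..n}" for R
  proof -
    have "0 \<notin> P" using P by (auto simp: infsets_def)
    then have "0 \<notin> R" using R(2) by (metis IntD1 IntI atMost_iff le0)
    then have "r \<ge> 1" if "r \<in> R" for r using that by (cases r) auto
    then have R1: "R \<in> infsets {1..}" using R(1) by (auto simp: infsets_def)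
    then have "ra1 \<xi> R = ra1 \<xi> P" using P n R(2) by (intro ra1_local) auto
    then show ?thesis using P R1 by simp
  qed
  then show "\<exists>n. \<forall>R. infinite R \<longrightarrow> R \<inter> {..n} = P \<inter> {..n} \<longrightarrow> R \<in> infsets {1..} \<and> Q (ra1 \<xi> R)"
    by blast
qed

lemma l1_subsequence_of_large:
  fixes x :: "nat \<Rightarrow> 'a::real_normed_vector"
  assumes x: "weakly_null x" and M: "M \<in> infsets {1..}" and \<epsilon>: "\<epsilon> > 0"
    and big: "\<And>P. P \<in> infsets M \<Longrightarrow> \<epsilon> < norm (dot (ra1 \<xi> P) x)"
  shows "\<exists>L\<in>infsets M. l1_spreading_model s \<xi> (\<lambda>i. x (enum1 L i))"
proof -
  obtain C0 where C0: "\<And>n. norm (x n) \<le> C0" using weakly_null_bounded[OF x] by blast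
  \<comment> \<open>The maximum with 1 makes \<open>C\<close> a positive divisor.\<close>
  define C where "C = max C0 1"
  have C: "C > 0" "\<And>n. norm (x n) \<le> C" using C0 by (auto simp: C_def le_max_iff_disj)
  \<comment> \<open>Points where the norming functional is below \<open>d\<close> contribute at most
    \<open>\<epsilon> / 2\<close>. The others contribute at least \<open>\<epsilon> / 2\<close> and,
    values being at most \<open>C\<close>, have mass at least
    \<open>\<epsilon> / (2 * C)\<close>.\<close>
  define d where "d = \<epsilon> / 2"
  have d: "d > 0" using \<epsilon> by (simp add: d_def)
  define \<G> where "\<G> = {A. finite A \<and> functionals x d (d / 2) A {} \<noteq> {}}"
  have G_her: "B \<in> \<G>" if "A \<in> \<G>" "B \<subseteq> A" for A B
    using that functionals_antimono[of B A "{}" "{}" x d "d / 2"] finite_subset[of B A]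
    by (auto simp: \<G>_def)
  have G_fin: "finite A" if "A \<in> \<G>" for A using that by (simp add: \<G>_def)
  have "large \<xi> M (\<epsilon> / (2 * C)) \<G>"
    unfolding large_def
  proof
    fix P assume P: "P \<in> infsets M"
    have P1: "P \<in> infsets {1..}" using P M by (rule infsets_mono)
    let ?u = "ra1 \<xi> P" and ?v = "dot (ra1 \<xi> P) x"
    let ?S = "supp ?u"
    have fin: "finite ?S" using P1 by (rule ra1_supp_finite)
    have u0: "0 \<le> ?u j" for j using P1 by (rule ra1_nonneg)
    obtain g where g: "g \<in> dual_ball" "g ?v = norm ?v" using norming_functional by blast
    let ?G = "{j\<in>?S. d \<le> g (x j)}"
    have "\<epsilon> < g ?v" using big[OF P] g(2) by simp
    also have "g ?v = (\<Sum>j\<in>?S. ?u j * g (x j))"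
      unfolding dot_ra1[OF P1] using dual_ball_linear[OF g(1)] by (simp add: linear_sum linear_scale)
    also have "\<dots> = (\<Sum>j\<in>?S - ?G. ?u j * g (x j)) + (\<Sum>j\<in>?G. ?u j * g (x j))"
      using fin by (intro sum.subset_diff) auto
    also have "(\<Sum>j\<in>?S - ?G. ?u j * g (x j)) \<le> (\<Sum>j\<in>?S - ?G. ?u j * d)"
      using u0 by (intro sum_mono mult_left_mono) auto
    also have "\<dots> \<le> d"
      using sum_ra1_le_1[OF P1, of \<xi> "?S - ?G"] d
      by (simp add: sum_distrib_right[symmetric] mult_left_le_one_le sum_ra1_nonneg[OF P1])
    also have "(\<Sum>j\<in>?G. ?u j * g (x j)) \<le> (\<Sum>j\<in>?G. ?u j * C)"
      using u0 dual_ball_le[OF g(1)] C(2) by (intro sum_mono mult_left_mono) (blast intro: order_trans)+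
    also have "\<dots> = sum ?u ?G * C" by (simp add: sum_distrib_right)
    finally have "\<epsilon> / (2 * C) \<le> sum ?u ?G" using C(1) by (simp add: d_def field_simps)
    moreover have "?G \<in> \<G>"
      using fin g(1) by (auto simp: \<G>_def functionals_def)
    ultimately show "\<exists>G\<in>\<G>. \<epsilon> / (2 * C) \<le> sum ?u G" by blast
  qed
  moreover have "\<epsilon> / (2 * C) > 0" using \<epsilon> C(1) by simp
  ultimately obtain L where L: "L \<in> infsets M" "\<And>F. F \<in> schreier s \<xi> \<Longrightarrow> enum1 L ` F \<in> \<G>"
    using large_contains_schreier[of \<G> M \<xi> "\<epsilon> / (2 * C)"] G_her G_fin M by blast
  have Linf: "infinite L" using L(1) by (simp add: infsets_def)
  have "d / 2 > 0" using d by simp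
  from near_unconditionality[OF x this Linf, of d] obtain N where N: "N \<in> infsets L"
    and sep: "\<forall>A B. finite A \<longrightarrow> finite B \<longrightarrow> A \<union> B \<subseteq> N \<longrightarrow> A \<inter> B = {} \<longrightarrow>
      functionals x d (d / 2) A {} \<noteq> {} \<longrightarrow> functionals x d (d / 2) A B \<noteq> {}" by (elim bexE)
  have Ninf: "infinite N" using N by (simp add: infsets_def)
  \<comment> \<open>The enumeration of \<open>N\<close> is a spread of that of \<open>L\<close>, so
    images of Schreier sets stay in \<open>\<G>\<close> after this second refinement.\<close>
  obtain h where h: "strict_mono_on {1..} h" "\<And>i. 1 \<le> i \<Longrightarrow> i \<le> h i" "\<And>i. 1 \<le> i \<Longrightarrow> enum1 N i = enum1 L (h i)"
    using enum1_subset[OF Linf N] by blast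
  have in_G: "enum1 N ` A \<in> \<G>" if A: "A \<in> schreier s \<xi>" for A
  proof -
    have ge1: "1 \<le> a" if "a \<in> A" for a using schreier_pos[OF A that] .
    have "h ` A \<in> schreier s \<xi>"
      using A
    proof (rule schreier_spread)
      show "strict_mono_on A h" using h(1) ge1 by (auto simp: strict_mono_on_def)
      show "a \<le> h a" if "a \<in> A" for a using h(2) ge1[OF that] .
    qed
    then have "enum1 L ` (h ` A) \<in> \<G>" by (rule L(2))
    moreover have "enum1 N ` A = enum1 L ` (h ` A)"
      unfolding image_image using h(3) ge1 by (intro image_cong) auto
    ultimately show ?thesis by simp
  qed
  have "d / 4 * (\<Sum>i\<in>F. \<bar>a i\<bar>) \<le> norm (\<Sum>i\<in>F. a i *\<^sub>R x (enum1 N i))"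
    if F: "F \<in> schreier s \<xi>" for F and a :: "nat \<Rightarrow> real"
  proof (rule l1_lower_estimate[OF schreier_finite[OF F] d])
    fix A assume A: "A \<subseteq> F"
    have fin: "finite F" using F by (rule schreier_finite)
    have inj: "inj_on (enum1 N) F"
      using strict_mono_on_enum1[OF Ninf F] by (rule strict_mono_on_imp_inj_on)
    have "enum1 N ` A \<in> \<G>" using schreier_hereditary[OF F A] by (rule in_G)
    then have "functionals x d (d / 2) (enum1 N ` A) {} \<noteq> {}" by (simp add: \<G>_def)
    moreover have "enum1 N ` A \<inter> enum1 N ` (F - A) = {}"
      using inj A by (auto simp: inj_on_def)
    moreover have "enum1 N ` A \<union> enum1 N ` (F - A) \<subseteq> N" using enum1_in[OF Ninf] by auto
    moreover have "finite (enum1 N ` A)" "finite (enum1 N ` (F - A))"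
      using fin finite_subset[OF A] by auto
    ultimately have "functionals x d (d / 2) (enum1 N ` A) (enum1 N ` (F - A)) \<noteq> {}"
      using sep by blast
    then show "\<exists>g\<in>dual_ball. (\<forall>i\<in>A. d \<le> g (x (enum1 N i))) \<and> (\<forall>i\<in>F - A. g (x (enum1 N i)) \<le> d / 2)"
      by (auto simp: functionals_def)
  qed
  then have "l1_spreading_model s \<xi> (\<lambda>i. x (enum1 N i))"
    unfolding l1_spreading_model_def using d by (intro exI[of _ "d / 4"]) auto
  then show ?thesis using infsets_mono[OF N L(1)] by blast
qed

text \<open>For each \<epsilon> the Ramsey alternative of large norms would produce a forbidden
  subsequence; diagonalization merges the different \<epsilon>. The threshold \<open>l\<close> is
  common to all \<open>P\<close> in \<open>infsets L\<close>, which the Cesaro argument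
  requires.\<close>

lemma uniformly_small_ra1:
  fixes x :: "nat \<Rightarrow> 'a::real_normed_vector"
  assumes x: "weakly_null x" and no: "no_l1_subsequence s x \<xi>" and M: "M \<in> infsets {1..}"
  shows "\<exists>L\<in>infsets M. \<forall>\<epsilon>>0. \<exists>l. \<forall>P\<in>infsets L. l \<le> Inf P \<longrightarrow> norm (dot (ra1 \<xi> P) x) \<le> \<epsilon>"
proof -
  have small: "\<exists>L\<in>infsets N. \<forall>P\<in>infsets L. norm (dot (ra1 \<xi> P) x) \<le> \<epsilon>"
    if N: "N \<in> infsets M" and \<epsilon>: "\<epsilon> > 0" for N \<epsilon>
  proof -
    let ?U = "\<lambda>P. P \<in> infsets {1..} \<and> \<epsilon> < norm (dot (ra1 \<xi> P) x)"
    have N1: "N \<in> infsets {1..}" using N M by (rule infsets_mono)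
    have "infinite N" using N by (simp add: infsets_def)
    from ramsey_open[OF open_family_ra1[where \<xi>=\<xi> and Q="\<lambda>u. \<epsilon> < norm (dot u x)"] this]
    obtain L where L: "L \<in> infsets N" "(\<forall>P\<in>infsets L. ?U P) \<or> (\<forall>P\<in>infsets L. \<not> ?U P)"
      by (elim bexE)
    have L1: "L \<in> infsets {1..}" using L(1) N1 by (rule infsets_mono)
    have "\<not> (\<forall>P\<in>infsets L. ?U P)"
    proof
      assume "\<forall>P\<in>infsets L. ?U P"
      then have "\<exists>L'\<in>infsets L. l1_spreading_model s \<xi> (\<lambda>i. x (enum1 L' i))"
        by (intro l1_subsequence_of_large[OF x L1 \<epsilon>]) simp
      then show False using no infsets_mono[OF _ L1] unfolding no_l1_subsequence_def by blast
    qed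
    then have "norm (dot (ra1 \<xi> P) x) \<le> \<epsilon>" if "P \<in> infsets L" for P
      using L(2) that infsets_mono[OF that L1] by (auto simp: not_less)
    then show ?thesis by (intro bexI[OF _ L(1)] ballI)
  qed
  have "\<exists>L\<in>infsets M. \<forall>n\<in>L. \<forall>P\<in>infsets {l\<in>L. n < l}. norm (dot (ra1 \<xi> P) x) \<le> 1 / real n"
  proof (rule diagonal_nat)
    show "\<exists>L\<in>infsets N. \<forall>P\<in>infsets L. norm (dot (ra1 \<xi> P) x) \<le> 1 / real n"
      if "n \<in> M" "N \<in> infsets M" for n N
    proof -
      have "n \<ge> 1" using that(1) M by (auto simp: infsets_def)
      then show ?thesis using small[OF that(2), of "1 / real n"] by simp
    qed
    show "\<forall>P\<in>infsets L'. norm (dot (ra1 \<xi> P) x) \<le> 1 / real n"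
      if "\<forall>P\<in>infsets L. norm (dot (ra1 \<xi> P) x) \<le> 1 / real n" "L' \<in> infsets L" for n L L'
      using that infsets_mono by blast
    show "infinite M" using M by (simp add: infsets_def)
  qed
  then obtain L where L: "L \<in> infsets M"
    and bound: "\<forall>n\<in>L. \<forall>P\<in>infsets {l\<in>L. n < l}. norm (dot (ra1 \<xi> P) x) \<le> 1 / real n"
    by (elim bexE)
  have "\<exists>l. \<forall>P\<in>infsets L. l \<le> Inf P \<longrightarrow> norm (dot (ra1 \<xi> P) x) \<le> \<epsilon>" if \<epsilon>: "\<epsilon> > 0" for \<epsilon>
  proof -
    define m where "m = nat \<lceil>1 / \<epsilon>\<rceil>"
    have m: "1 / \<epsilon> \<le> real m" unfolding m_def by linarith
    have "{l\<in>L. m < l} \<in> infsets L" using L by (intro infsets_greater) (simp add: infsets_def)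
    then have "infinite {l\<in>L. m < l}" by (simp add: infsets_def)
    then obtain n where n: "n \<in> L" "m < n" using Inf_mem by blast
    have "norm (dot (ra1 \<xi> P) x) \<le> \<epsilon>" if P: "P \<in> infsets L" "Suc n \<le> Inf P" for P
    proof -
      have "n < p" if "p \<in> P" for p using Inf_le[OF that] P(2) by simp
      then have "P \<in> infsets {l\<in>L. n < l}" using P(1) by (auto simp: infsets_def)
      then have "norm (dot (ra1 \<xi> P) x) \<le> 1 / real n" using bound n(1) by blast
      also have "\<dots> \<le> \<epsilon>"
      proof -
        have "1 / \<epsilon> \<le> real n" using m n(2) by linarith
        then show ?thesis using \<epsilon> n(2) by (simp add: field_simps)
      qed
      finally show ?thesis .
    qed
    then show ?thesis by blast
  qed
  then show ?thesis using L by blast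
qed

text \<open>The \<open>k\<close>-th tail has minimum at least \<open>k\<close>, so the uniform bound
  reaches it.\<close>

lemma RA_tendsto_zero:
  fixes x :: "nat \<Rightarrow> 'a::real_normed_vector"
  assumes unif: "\<And>\<epsilon>. \<epsilon> > 0 \<Longrightarrow> \<exists>l. \<forall>P\<in>infsets L. l \<le> Inf P \<longrightarrow> norm (dot (ra1 \<xi> P) x) \<le> \<epsilon>"
    and L: "L \<in> infsets {1..}" and P: "P \<in> infsets L"
  shows "(\<lambda>n. norm (dot (RA s \<xi> P n) x)) \<longlonglongrightarrow> 0"
proof (rule LIMSEQ_I)
  fix r :: real assume r: "r > 0"
  have P1: "P \<in> infsets {1..}" using P L by (rule infsets_mono)
  obtain l where l: "\<And>Q. Q \<in> infsets L \<Longrightarrow> l \<le> Inf Q \<Longrightarrow> norm (dot (ra1 \<xi> Q) x) \<le> r / 2"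
    using unif[of "r / 2"] r by auto
  have "norm (dot (RA s \<xi> P n) x) < r" if n: "n \<ge> Suc l" for n
  proof -
    obtain k where k: "n = Suc k" "l \<le> k" using n by (cases n) auto
    have "ra_tail \<xi> P k \<in> infsets L" using P L by (rule ra_tail_infsets_trans)
    moreover have "l \<le> Inf (ra_tail \<xi> P k)" using k(2) ra_tail_Inf_ge[OF P1] order_trans by blast
    ultimately have "norm (dot (ra1 \<xi> (ra_tail \<xi> P k)) x) \<le> r / 2" by (rule l)
    then show ?thesis using r by (simp add: k(1) RA_eq[OF P1])
  qed
  then show "\<exists>no. \<forall>n\<ge>no. norm (norm (dot (RA s \<xi> P n) x) - 0) < r" by auto
qed

lemma l1_lower_ra1:
  fixes x :: "nat \<Rightarrow> 'a::real_normed_vector"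
  assumes M: "M \<in> infsets {1..}" and l1: "l1_spreading_model s \<zeta> (\<lambda>i. x (enum1 M i))"
    and C: "\<And>n. norm (x n) \<le> C"
  shows "\<exists>\<epsilon>>0. \<exists>L\<in>infsets M. \<forall>P\<in>infsets L. \<epsilon> < norm (dot (ra1 \<zeta> P) x)"
proof -
  from l1[unfolded l1_spreading_model_def] obtain \<epsilon> where \<epsilon>: "\<epsilon> > 0"
    and low': "\<forall>F\<in>schreier s \<zeta>. \<forall>a :: nat \<Rightarrow> real.
      norm (\<Sum>i\<in>F. a i *\<^sub>R x (enum1 M i)) \<ge> \<epsilon> * (\<Sum>i\<in>F. \<bar>a i\<bar>)"
    by (elim exE conjE)
  note low = low'[rule_format]
  have C0: "0 \<le> C" using C[of 0] norm_ge_zero order_trans by blast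
  have Minf: "infinite M" using M by (simp add: infsets_def)
  \<comment> \<open>Solves
    \<open>\<epsilon> * (1 - \<delta>) - \<delta> * C = \<epsilon> / 2\<close>: the mass missing
    from the Schreier part and the vector outside it together cost half of \<epsilon>.\<close>
  define \<delta> where "\<delta> = \<epsilon> / (2 * (C + \<epsilon>))"
  have \<delta>: "\<delta> > 0" "\<delta> * (C + \<epsilon>) = \<epsilon> / 2" using \<epsilon> C0 by (simp_all add: \<delta>_def field_simps add_nonneg_pos)
  from near_full[unfolded near_full_def, rule_format, OF M infsets_refl[OF Minf] \<delta>(1), of \<zeta>]
  obtain L where L: "L \<in> infsets M"
    and full: "\<forall>P\<in>infsets L. \<exists>F\<in>schreier s \<zeta>. 1 - \<delta> \<le> sum (ra1 \<zeta> P) (enum1 M ` F)" by (elim bexE)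
  have "\<epsilon> / 4 < norm (dot (ra1 \<zeta> P) x)" if P: "P \<in> infsets L" for P
  proof -
    have P1: "P \<in> infsets {1..}" using P infsets_mono[OF L M] by (rule infsets_mono)
    let ?u = "ra1 \<zeta> P"
    obtain F where F: "F \<in> schreier s \<zeta>" "1 - \<delta> \<le> sum ?u (enum1 M ` F)" using full P by blast
    let ?G = "enum1 M ` F"
    let ?R = "supp ?u - ?G"
    have finG: "finite ?G" and finS: "finite (supp ?u)"
      using schreier_finite[OF F(1)] ra1_supp_finite[OF P1] by auto
    have inj: "inj_on (enum1 M) F"
      using strict_mono_on_enum1[OF Minf F(1)] by (rule strict_mono_on_imp_inj_on)
    have "dot ?u x = (\<Sum>j\<in>?G \<union> ?R. ?u j *\<^sub>R x j)" using finG finS by (intro dot_eq_sum) auto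
    also have "\<dots> = (\<Sum>j\<in>?G. ?u j *\<^sub>R x j) + (\<Sum>j\<in>?R. ?u j *\<^sub>R x j)"
      using finG finS by (intro sum.union_disjoint) auto
    finally have dot: "dot ?u x = (\<Sum>j\<in>?G. ?u j *\<^sub>R x j) + (\<Sum>j\<in>?R. ?u j *\<^sub>R x j)" .
    have "(\<Sum>j\<in>?G. ?u j *\<^sub>R x j) = (\<Sum>i\<in>F. ?u (enum1 M i) *\<^sub>R x (enum1 M i))"
      by (simp add: sum.reindex[OF inj])
    moreover have "(\<Sum>i\<in>F. \<bar>?u (enum1 M i)\<bar>) = sum ?u ?G"
      using ra1_nonneg[OF P1] by (simp add: sum.reindex[OF inj])
    ultimately have "\<epsilon> * sum ?u ?G \<le> norm (\<Sum>j\<in>?G. ?u j *\<^sub>R x j)"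
      using low[OF F(1), of "\<lambda>i. ?u (enum1 M i)"] by (simp only:)
    moreover have "\<epsilon> * (1 - \<delta>) \<le> \<epsilon> * sum ?u ?G" using F(2) \<epsilon> by simp
    moreover have "norm (\<Sum>j\<in>?R. ?u j *\<^sub>R x j) \<le> \<delta> * C"
    proof -
      have "norm (\<Sum>j\<in>?R. ?u j *\<^sub>R x j) \<le> (\<Sum>j\<in>?R. ?u j * C)"
        using ra1_nonneg[OF P1] C by (intro order_trans[OF norm_sum] sum_mono) (simp add: mult_left_mono)
      also have "\<dots> = sum ?u ?R * C" by (simp add: sum_distrib_right)
      also have "sum ?u ?R \<le> \<delta>"
      proof -
        have "sum ?u (?G \<union> ?R) = sum ?u ?G + sum ?u ?R"
          using finG finS by (intro sum.union_disjoint) auto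
        then show ?thesis using sum_ra1_le_1[OF P1, of \<zeta> "?G \<union> ?R"] F(2) by simp
      qed
      finally show ?thesis using C0 by (simp add: mult_right_mono)
    qed
    moreover have "norm (\<Sum>j\<in>?G. ?u j *\<^sub>R x j) - norm (\<Sum>j\<in>?R. ?u j *\<^sub>R x j) \<le> norm (dot ?u x)"
      unfolding dot using norm_diff_ineq by blast
    moreover have "\<epsilon> * (1 - \<delta>) - \<delta> * C = \<epsilon> / 2" using \<delta>(2) by (simp add: algebra_simps)
    ultimately show ?thesis using \<epsilon> by linarith
  qed
  then show ?thesis using L \<epsilon> by (intro exI[of _ "\<epsilon> / 4"] conjI bexI[of _ L]) auto
qed

text \<open>The block length must stay fixed while the block moves to infinity, but a successor
  average has as many terms as its minimum. Grafting the support of one \<zeta>-average with minimum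
  \<open>Suc m\<close> in front of every late tail reconciles the two, at the cost of one bounded
  term.\<close>

lemma RA_cesaro:
  fixes x :: "nat \<Rightarrow> 'a::real_normed_vector"
  assumes unif: "\<And>\<epsilon>. \<epsilon> > 0 \<Longrightarrow> \<exists>l. \<forall>P\<in>infsets L. l \<le> Inf P \<longrightarrow> norm (dot (ra1 (osuc \<zeta>) P) x) \<le> \<epsilon>"
    and C: "\<And>n. norm (x n) \<le> C" and L: "L \<in> infsets {1..}" and P: "P \<in> infsets L"
  shows "cesaro_summable (\<lambda>n. dot (RA s \<zeta> P n) x)"
proof -
  have P1: "P \<in> infsets {1..}" using P L by (rule infsets_mono)
  have Linf: "infinite L" using L by (simp add: infsets_def)
  have C0: "0 \<le> C" using C[of 0] norm_ge_zero order_trans by blast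
  define y where "y k = dot (ra1 \<zeta> (ra_tail \<zeta> P k)) x" for k
  have TL: "ra_tail \<zeta> P k \<in> infsets L" for k using P L by (rule ra_tail_infsets_trans)
  have T1: "ra_tail \<zeta> P k \<in> infsets {1..}" for k using TL L by (rule infsets_mono)
  have yC: "norm (y k) \<le> C" for k unfolding y_def using T1 C by (rule norm_dot_ra1_le)
  have chunks: "\<exists>m\<ge>1. \<exists>k0. \<forall>k\<ge>k0. norm (\<Sum>j<m. y (k + j)) \<le> real m * (3 * \<epsilon>)" if \<epsilon>: "\<epsilon> > 0" for \<epsilon>
  proof -
    obtain l0 where l0: "\<And>Q. Q \<in> infsets L \<Longrightarrow> l0 \<le> Inf Q \<Longrightarrow> norm (dot (ra1 (osuc \<zeta>) Q) x) \<le> \<epsilon>"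
      using unif[OF \<epsilon>] by blast
    \<comment> \<open>Ensures \<open>l0 \<le> Suc m\<close>, \<open>m \<ge> 1\<close> and
      \<open>C \<le> real m * \<epsilon>\<close>; the last makes the grafted average negligible
      against the block.\<close>
    define b0 where "b0 = l0 + nat \<lceil>C / \<epsilon>\<rceil> + 2"
    let ?R = "{l\<in>L. b0 < l}"
    have R: "?R \<in> infsets L" using Linf by (rule infsets_greater)
    have R1: "?R \<in> infsets {1..}" using R L by (rule infsets_mono)
    define m where "m = Inf ?R - 1"
    have "Inf ?R \<in> ?R" using R1 by (rule Inf_in_infsets)
    then have "b0 < Inf ?R" by blast
    then have m: "Inf ?R = Suc m" "m \<ge> 1" "l0 \<le> Suc m" "C / \<epsilon> \<le> real m"
      unfolding m_def b0_def by linarith+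
    have Cm: "C \<le> real m * \<epsilon>" using m(4) \<epsilon> by (simp add: field_simps)
    let ?Q = "supp (ra1 \<zeta> ?R)"
    define b where "b = Max ?Q"
    have finQ: "finite ?Q" using R1 by (rule ra1_supp_finite)
    have Qb: "q \<le> b" if "q \<in> ?Q" for q using that finQ by (simp add: b_def)
    have bQ: "b \<in> ?Q" unfolding b_def using finQ ra1_supp_nonempty[OF R1] by (rule Max_in)
    have QR: "?Q \<subseteq> ?R" using R1 by (rule ra1_supp_subset)
    have "norm (\<Sum>j<m. y (k + j)) \<le> real m * (3 * \<epsilon>)" if k: "k \<ge> Suc b" for k
    proof -
      let ?T = "ra_tail \<zeta> P k"
      have bT: "b < t" if "t \<in> ?T" for t
        using Inf_le[OF that] ra_tail_Inf_ge[OF P1, of k \<zeta>] k by linarith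
      let ?P = "?Q \<union> ?T"
      have P'L: "?P \<in> infsets L" using TL[of k] QR R by (auto simp: infsets_def)
      have P'1: "?P \<in> infsets {1..}" using P'L L by (rule infsets_mono)
      \<comment> \<open>The sets \<open>?P\<close> and \<open>?R\<close> agree up to
        \<open>b\<close>, so by locality \<open>?Q\<close> is also the first support of
        \<open>?P\<close>; the next averages of \<open>?P\<close> then give \<open>y k\<close>,
        \<open>y (k + 1)\<close> and so on.\<close>
      have "?R \<inter> {..b} = ?Q"
      proof (intro equalityI subsetI)
        fix p assume p: "p \<in> ?R \<inter> {..b}"
        show "p \<in> ?Q"
        proof (rule ccontr)
          assume "p \<notin> ?Q"
          then have "b < p" using ra1_supp_initial[OF R1 bQ, of p] p by blast
          then show False using p by simp
        qed
      next
        fix p assume "p \<in> ?Q"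
        then show "p \<in> ?R \<inter> {..b}" using QR Qb by blast
      qed
      moreover have "?P \<inter> {..b} = ?Q" using Qb bT by fastforce
      ultimately have eq: "ra1 \<zeta> ?P = ra1 \<zeta> ?R"
        using Qb by (intro ra1_local[OF R1 P'1, where n=b]) auto
      have "?P - supp (ra1 \<zeta> ?P) = ?T" unfolding eq using Qb bT by fastforce
      then have tail: "ra_tail \<zeta> ?P (Suc j) = ra_tail \<zeta> P (k + j)" for j by (simp add: rest_add)
      have "Inf ?P = Inf ?R"
        using Min_supp_ra1[OF P'1, of \<zeta>] Min_supp_ra1[OF R1, of \<zeta>] eq by simp
      then have Inf: "Inf ?P = Suc m" using m(1) by simp
      have "dot (ra1 (osuc \<zeta>) ?P) x = (1 / real (Suc m)) *\<^sub>R (\<Sum>j<Suc m. dot (ra1 \<zeta> (ra_tail \<zeta> ?P j)) x)"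
        unfolding dot_ra1_osuc[OF P'1] Inf ..
      also have "(\<Sum>j<Suc m. dot (ra1 \<zeta> (ra_tail \<zeta> ?P j)) x) = dot (ra1 \<zeta> ?P) x + (\<Sum>j<m. y (k + j))"
        unfolding sum.lessThan_Suc_shift tail y_def by simp
      finally have "real (Suc m) *\<^sub>R dot (ra1 (osuc \<zeta>) ?P) x = dot (ra1 \<zeta> ?P) x + (\<Sum>j<m. y (k + j))"
        by simp
      then have "(\<Sum>j<m. y (k + j)) = real (Suc m) *\<^sub>R dot (ra1 (osuc \<zeta>) ?P) x - dot (ra1 \<zeta> ?P) x"
        by simp
      then have "norm (\<Sum>j<m. y (k + j)) \<le> real (Suc m) * norm (dot (ra1 (osuc \<zeta>) ?P) x) + norm (dot (ra1 \<zeta> ?P) x)"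
        using norm_triangle_ineq4[of "real (Suc m) *\<^sub>R dot (ra1 (osuc \<zeta>) ?P) x"] by simp
      also have "\<dots> \<le> real (Suc m) * \<epsilon> + C"
        using l0[OF P'L] m(3) Inf norm_dot_ra1_le[OF P'1 C] by (intro add_mono mult_left_mono) auto
      \<comment> \<open>The factor 3 comes from \<open>Suc m \<le> 2 * m\<close> and
        \<open>C \<le> real m * \<epsilon>\<close>.\<close>
      also have "\<dots> \<le> 2 * real m * \<epsilon> + real m * \<epsilon>"
        using m(2) \<epsilon> Cm by (intro add_mono mult_right_mono) auto
      finally show ?thesis by (simp add: algebra_simps)
    qed
    then show ?thesis using m(2) by blast
  qed
  have "(\<lambda>n. (1 / real n) *\<^sub>R (\<Sum>k<n. y k)) \<longlonglongrightarrow> 0"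
  proof (rule LIMSEQ_I)
    fix r :: real assume r: "r > 0"
    obtain m k0 where m: "m \<ge> 1" "\<And>k. k \<ge> k0 \<Longrightarrow> norm (\<Sum>j<m. y (k + j)) \<le> real m * (r / 2)"
      using chunks[of "r / 6"] r by auto
    let ?D = "real (k0 + m) * C"
    have bound: "norm (\<Sum>k<n. y k) \<le> real n * (r / 2) + ?D" for n
      using yC _ m(2,1) by (rule chunk_sum_bound) (use r in auto)
    define N where "N = nat \<lceil>2 * ?D / r\<rceil> + 1"
    have "norm ((1 / real n) *\<^sub>R (\<Sum>k<n. y k) - 0) < r" if n: "n \<ge> N" for n
    proof -
      have "2 * ?D / r < real n" using n unfolding N_def by linarith
      then have "?D < real n * (r / 2)" using r by (simp add: field_simps)
      then have "norm (\<Sum>k<n. y k) < real n * r" using bound[of n] by (simp add: field_simps)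
      moreover have "n \<ge> 1" using n by (simp add: N_def)
      ultimately show ?thesis by (simp add: field_simps)
    qed
    then show "\<exists>N. \<forall>n\<ge>N. norm ((1 / real n) *\<^sub>R (\<Sum>k<n. y k) - 0) < r" by blast
  qed
  moreover have "(\<Sum>k = 1..n. dot (RA s \<zeta> P k) x) = (\<Sum>k<n. y k)" for n
    by (simp add: sum.atLeast1_atMost_eq y_def RA_eq[OF P1])
  ultimately show ?thesis unfolding cesaro_summable_def by (auto intro: convergentI)
qed

end

theorem theoremC:
  fixes x :: "nat \<Rightarrow> 'a::banach"
    and s :: "omega1 \<Rightarrow> nat \<Rightarrow> omega1"
    and \<xi> :: omega1
  assumes "fundamental_sequences s"
    and "weakly_null x"
    and "has_BS_index s x \<xi>"
  shows "\<forall>\<eta> :: omega1.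
    ((\<forall>M\<in>infsets {1..}. \<exists>L\<in>infsets M. \<forall>P\<in>infsets L.
        (\<lambda>n. norm (dot (RA s \<eta> P n) x)) \<longlonglongrightarrow> 0) \<and>
     (\<forall>\<zeta><\<eta>. \<exists>L\<in>infsets {1..}. l1_spreading_model s \<zeta> (\<lambda>i. x (enum1 L i))) \<and>
     (\<forall>\<zeta>. \<eta> = osuc \<zeta> \<longrightarrow>
        (\<exists>\<epsilon>>0. \<exists>L\<in>infsets {1..}. \<forall>P\<in>infsets L.
          (\<forall>n\<ge>1. norm (dot (RA s \<zeta> P n) x) > \<epsilon>) \<and>
          cesaro_summable (\<lambda>n. dot (RA s \<zeta> P n) x))))
    \<longleftrightarrow> \<eta> = \<xi>"
proof
  interpret fundamental_system s using assms(1) by unfold_locales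
  obtain C where C: "\<And>n. norm (x n) \<le> C" using weakly_null_bounded[OF assms(2)] by blast
  have no: "no_l1_subsequence s x \<xi>" and least: "\<And>\<eta>. no_l1_subsequence s x \<eta> \<Longrightarrow> \<xi> \<le> \<eta>"
    using assms(3) by (auto simp: has_BS_index_def)
  have l1: "\<exists>L\<in>infsets {1..}. l1_spreading_model s \<zeta> (\<lambda>i. x (enum1 L i))" if "\<zeta> < \<xi>" for \<zeta>
    using least[of \<zeta>] that unfolding no_l1_subsequence_def by (meson not_le)
  \<comment> \<open>Every average is the first average of a tail, so the bound for first averages
    holds for all \<open>n\<close>.\<close>
  have lower: "\<exists>\<epsilon>>0. \<exists>L\<in>infsets {1..}. \<forall>P\<in>infsets L. \<forall>n\<ge>1. \<epsilon> < norm (dot (RA s \<zeta> P n) x)"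
    if less: "\<zeta> < \<xi>" for \<zeta>
  proof -
    from l1[OF less] obtain M where M: "M \<in> infsets {1..}" "l1_spreading_model s \<zeta> (\<lambda>i. x (enum1 M i))"
      by (elim bexE)
    from l1_lower_ra1[OF M C] obtain \<epsilon> L where \<epsilon>: "\<epsilon> > 0" and L: "L \<in> infsets M"
      and low: "\<forall>P\<in>infsets L. \<epsilon> < norm (dot (ra1 \<zeta> P) x)" by blast
    have L1: "L \<in> infsets {1..}" using L M(1) by (rule infsets_mono)
    have "\<epsilon> < norm (dot (RA s \<zeta> P n) x)" if P: "P \<in> infsets L" and "n \<ge> 1" for P n
    proof -
      obtain k where "n = Suc k" using \<open>n \<ge> 1\<close> by (cases n) auto
      then show ?thesis
        using low ra_tail_infsets_trans[OF P L1] RA_eq[OF infsets_mono[OF P L1]] by simp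
    qed
    then show ?thesis using \<epsilon> L1 by (intro exI[of _ \<epsilon>] conjI bexI[of _ L]) auto
  qed
  fix \<eta>
  show "((\<forall>M\<in>infsets {1..}. \<exists>L\<in>infsets M. \<forall>P\<in>infsets L.
        (\<lambda>n. norm (dot (RA s \<eta> P n) x)) \<longlonglongrightarrow> 0) \<and>
     (\<forall>\<zeta><\<eta>. \<exists>L\<in>infsets {1..}. l1_spreading_model s \<zeta> (\<lambda>i. x (enum1 L i))) \<and>
     (\<forall>\<zeta>. \<eta> = osuc \<zeta> \<longrightarrow>
        (\<exists>\<epsilon>>0. \<exists>L\<in>infsets {1..}. \<forall>P\<in>infsets L.
          (\<forall>n\<ge>1. norm (dot (RA s \<zeta> P n) x) > \<epsilon>) \<and>
          cesaro_summable (\<lambda>n. dot (RA s \<zeta> P n) x))))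
    \<longleftrightarrow> \<eta> = \<xi>" (is "?a \<and> ?b \<and> ?c \<longleftrightarrow> _")
  proof
    assume abc: "?a \<and> ?b \<and> ?c"
    \<comment> \<open>For a larger \<eta>, condition (b) would provide a spreading model at \<xi>
      itself.\<close>
    have "\<not> \<xi> < \<eta>"
    proof
      assume "\<xi> < \<eta>"
      then show False using abc no unfolding no_l1_subsequence_def by blast
    qed
    \<comment> \<open>For a smaller \<eta>, the averages are bounded away from zero on all subsets
      of some \<open>L\<close>, against condition (a) inside that \<open>L\<close>.\<close>
    moreover have "\<not> \<eta> < \<xi>"
    proof
      assume "\<eta> < \<xi>"
      from lower[OF this] obtain \<epsilon> L where \<epsilon>: "\<epsilon> > 0" and L: "L \<in> infsets {1..}"
        and low: "\<forall>P\<in>infsets L. \<forall>n\<ge>1. \<epsilon> < norm (dot (RA s \<eta> P n) x)" by blast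
      from abc L obtain P where P: "P \<in> infsets L" "\<forall>Q\<in>infsets P. (\<lambda>n. norm (dot (RA s \<eta> Q n) x)) \<longlonglongrightarrow> 0"
        by blast
      have "P \<in> infsets P" using P(1) by (simp add: infsets_def)
      then have "(\<lambda>n. norm (dot (RA s \<eta> P n) x)) \<longlonglongrightarrow> 0" using P(2) by blast
      moreover have "\<exists>N. \<forall>n\<ge>N. \<epsilon> \<le> norm (dot (RA s \<eta> P n) x)"
        using low P(1) by (intro exI[of _ 1]) (simp add: less_imp_le)
      ultimately have "\<epsilon> \<le> 0" by (rule LIMSEQ_le_const)
      then show False using \<epsilon> by simp
    qed
    ultimately show "\<eta> = \<xi>" by simp
  next
    assume \<eta>: "\<eta> = \<xi>"
    have ?a
    proof
      fix M assume M: "M \<in> infsets {1..}"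
      from uniformly_small_ra1[OF assms(2) no M] obtain L where L: "L \<in> infsets M"
        and unif: "\<forall>\<epsilon>>0. \<exists>l. \<forall>P\<in>infsets L. l \<le> Inf P \<longrightarrow> norm (dot (ra1 \<xi> P) x) \<le> \<epsilon>" by (elim bexE)
      have "(\<lambda>n. norm (dot (RA s \<eta> P n) x)) \<longlonglongrightarrow> 0" if "P \<in> infsets L" for P
        unfolding \<eta> using unif[rule_format] infsets_mono[OF L M] that by (rule RA_tendsto_zero)
      then show "\<exists>L\<in>infsets M. \<forall>P\<in>infsets L. (\<lambda>n. norm (dot (RA s \<eta> P n) x)) \<longlonglongrightarrow> 0"
        using L by blast
    qed
    moreover have ?b using l1 \<eta> by blast
    moreover have ?c
    proof (intro allI impI)
      fix \<zeta> assume \<zeta>: "\<eta> = osuc \<zeta>"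
      then have "\<zeta> < \<xi>" using \<eta> less_osuc by simp
      from lower[OF this] obtain \<epsilon> M where \<epsilon>: "\<epsilon> > 0" and M: "M \<in> infsets {1..}"
        and low: "\<forall>P\<in>infsets M. \<forall>n\<ge>1. \<epsilon> < norm (dot (RA s \<zeta> P n) x)" by blast
      \<comment> \<open>Refining inside \<open>M\<close> puts the lower bound and the uniform
        smallness on the same set.\<close>
      from uniformly_small_ra1[OF assms(2) no M] obtain L where L: "L \<in> infsets M"
        and unif: "\<forall>\<epsilon>>0. \<exists>l. \<forall>P\<in>infsets L. l \<le> Inf P \<longrightarrow> norm (dot (ra1 (osuc \<zeta>) P) x) \<le> \<epsilon>"
        unfolding \<eta>[symmetric] \<zeta> by (elim bexE)
      have L1: "L \<in> infsets {1..}" using L M by (rule infsets_mono)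
      have "(\<forall>n\<ge>1. norm (dot (RA s \<zeta> P n) x) > \<epsilon>) \<and> cesaro_summable (\<lambda>n. dot (RA s \<zeta> P n) x)"
        if P: "P \<in> infsets L" for P
      proof
        show "\<forall>n\<ge>1. norm (dot (RA s \<zeta> P n) x) > \<epsilon>" using low infsets_mono[OF P L] by blast
        show "cesaro_summable (\<lambda>n. dot (RA s \<zeta> P n) x)"
          using unif[rule_format] C L1 P by (rule RA_cesaro)
      qed
      then show "\<exists>\<epsilon>>0. \<exists>L\<in>infsets {1..}. \<forall>P\<in>infsets L.
          (\<forall>n\<ge>1. norm (dot (RA s \<zeta> P n) x) > \<epsilon>) \<and> cesaro_summable (\<lambda>n. dot (RA s \<zeta> P n) x)"
        using \<epsilon> L1 by (intro exI[of _ \<epsilon>] conjI bexI[of _ L]) auto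
    qed
    ultimately show "?a \<and> ?b \<and> ?c" by blast
  qed
qed

end
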